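(* Let $n\ge1$. The deformation derivatives for a system of regular semi-classical bi-orthogonal polynomials and associated functions, namely $$\dot\phi_n(z)=\Big\{-\frac{\dot\kappa_n}{\kappa_n}-\sum_{j=1}^m\rho_j\frac{\dot z_j}{z_j}+\frac12\sum_{j=1}^m\rho_j\frac{\dot z_j}{z_j}z_j^{-n}\epsilon_n(z_j)\phi^*_n(z_j)\frac{z}{z-z_j}\Big\}\phi_n(z)-\Big\{\frac12\sum_{j=1}^m\rho_j\frac{\dot z_j}{z_j}z_j^{1-n}\epsilon_n(z_j)\phi_n(z_j)\frac{1}{z-z_j}\Big\}\phi^*_n(z),$$ $$\dot\phi^*_n(z)=\Big\{-\frac{\dot\kappa_n}{\kappa_n}+\frac12\sum_{j=1}^m\rho_j\frac{\dot z_j}{z_j}z_j^{1-n}\epsilon^*_n(z_j)\phi_n(z_j)\frac{1}{z-z_j}\Big\}\phi^*_n(z)-\Big\{\frac12\sum_{j=1}^m\rho_j\frac{\dot z_j}{z_j}z_j^{-n}\epsilon^*_n(z_j)\phi^*_n(z_j)\frac{z}{z-z_j}\Big\}\phi_n(z),$$ $$\dot\epsilon_n(z)=\Big\{-\frac{\dot\kappa_n}{\kappa_n}-\frac12\sum_{j=1}^m\rho_j\frac{\dot z_j}{z_j}z_j^{-n}\epsilon^*_n(z_j)\phi_n(z_j)\frac{z}{z-z_j}\Big\}\epsilon_n(z)+\Big\{\frac12\sum_{j=1}^m\rho_j\frac{\dot z_j}{z_j}z_j^{1-n}\epsilon_n(z_j)\phi_n(z_j)\frac{1}{z-z_j}\Big\}\epsilon^*_n(z),$$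 $$\dot\epsilon^*_n(z)=\Big\{-\frac{\dot\kappa_n}{\kappa_n}-\frac12\sum_{j=1}^m\rho_j\frac{\dot z_j}{z_j}z_j^{1-n}\epsilon_n(z_j)\phi^*_n(z_j)\frac{1}{z-z_j}\Big\}\epsilon^*_n(z)+\Big\{\frac12\sum_{j=1}^m\rho_j\frac{\dot z_j}{z_j}z_j^{-n}\epsilon^*_n(z_j)\phi^*_n(z_j)\frac{z}{z-z_j}\Big\}\epsilon_n(z),$$ are equivalent to the matrix differential equation $$\dot Y_n=B_nY_n=\Big\{B_\infty-\sum_{j=1}^m\frac{\dot z_j}{z-z_j}A_{nj}\Big\}Y_n,\qquad B_\infty=\begin{pmatrix}\dfrac{\dot\kappa_n}{\kappa_n}&0\\[6pt]\dfrac{\kappa_n\dot{\bar\phi}_n(0)+\dot\kappa_n\bar\phi_n(0)}{\kappa_n^2}&-\dfrac{\dot\kappa_n}{\kappa_n}\end{pmatrix}.$$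
   Context: Regular semi-classical weight depending on a deformation variable $t$ ($\dot{}=d/dt$, $'=d/dz$): $w(z)=\prod_{j=1}^m(z-z_j(t))^{\rho_j}$ with $m\ge2$ distinct points $z_j=z_j(t)$ depending differentiably on $t$, and $t$-independent exponents $\rho_j\in\mathbb C\setminus\mathbb Z_{\ge0}$; $W(z)=\prod_{j=1}^m(z-z_j)$, $\frac{2V}{W}=\sum_{j=1}^m\frac{\rho_j}{z-z_j}$. One singular point is fixed at the origin, $z_1=0$ for all $t$; the $j=1$ term ($\dot z_1=0$) in every sum containing $\dot z_j$ or $\dot z_j/z_j$ is zero. A branch of $w$ analytic in a cut plane is fixed; let $\mathbb T=\{|\zeta|=1\}$ be parametrised by $\zeta=e^{i\theta}$, $\theta\in(-\pi,\pi]$, the cuts being such that on $\mathbb T$ the branch is analytic except possibly at $-1$ and at those $z_j$ lying on $\mathbb T$. For all $t$ assume $w(e^{\pi i})=w(e^{-\pi i})$, $z^jw,z^jw'\in L^1(\mathbb T)$ for all $j\in\mathbb Z$ (so $\mathrm{Re}\,\rho_j>0$ when $z_j\in\mathbb T$), and $\det[w_{j-k}]_{0\le j,k\le n-1}\neq0$ for all $n\ge1$, where $w_k=\int_{\mathbb T}\frac{d\zeta}{2\pi i\zeta}w(\zeta)\zeta^{-k}$. The bi-orthonormal polynomials are $\phi_n(z)=\kappa_nz^n+\dots+\phi_n(0)$ and $\bar\phi_n(z)=\kappa_nz^n+\dots+\bar\phi_n(0)$ with $\kappa_n\neq0$ (differentiable in $t$), satisfying $\int_{\mathbb T}\frac{d\zeta}{2\pi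 i\zeta}w(\zeta)\phi_m(\zeta)\bar\phi_n(\bar\zeta)=\delta_{m,n}$, $\bar\zeta=\zeta^{-1}$; the bar on $\bar\phi_n$ is notation, not complex conjugation. $\phi^*_n(z)=z^n\bar\phi_n(1/z)$. Assume $\phi_n(0)\neq0$, $\bar\phi_n(0)\ne0$. For $n\ge1$ and $z\notin\mathbb T$, $\epsilon_n(z)=\int_{\mathbb T}\frac{d\zeta}{2\pi i\zeta}\frac{\zeta+z}{\zeta-z}w(\zeta)\phi_n(\zeta)$ and $\epsilon^*_n(z)=-z^n\int_{\mathbb T}\frac{d\zeta}{2\pi i\zeta}\frac{\zeta+z}{\zeta-z}w(\zeta)\bar\phi_n(\bar\zeta)$; values at a point $z_j\in\mathbb T$ are understood as limiting values. Put $$Y_n(z)=\begin{pmatrix}\phi_n&\epsilon_n/w\\ \phi^*_n&-\epsilon^*_n/w\end{pmatrix},$$ and let $A_n(z)$ be the matrix with $Y_n'=A_nY_n$; for these weights $A_n(z)=\sum_{j=1}^m\frac{A_{nj}}{z-z_j}$, which defines the residue matrices $A_{nj}$. (Explicitly, for $z_j\ne0$, $A_{nj}=-\frac12\rho_jz_j^{-n}\begin{pmatrix}\phi^*_n(z_j)\epsilon_n(z_j)&-\phi_n(z_j)\epsilon_n(z_j)\\-\phi^*_n(z_j)\epsilon^*_n(z_j)&\phi_n(z_j)\epsilon^*_n(z_j)\end{pmatrix}$.) *)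

theory Defs
  imports "Jordan_Normal_Form.Determinant" "HOL-Analysis.Analysis"
begin

(* The 2x2 matrices below are those of HOL-Analysis; the Toeplitz determinants, whose size
   varies, are those of Jordan_Normal_Form. *)
hide_const (open) Matrix.mat Determinant.det Matrix.row Matrix.vec
no_notation vec_index (infixl "$" 100)

(* The integral of f(zeta) dzeta / (2 pi i zeta) over the unit circle, zeta = exp(i theta). *)
definition circle_mean :: "(complex \<Rightarrow> complex) \<Rightarrow> complex" where
  "circle_mean f = set_lebesgue_integral lborel {-pi<..pi} (\<lambda>\<theta>. f (cis \<theta>)) / (2 * of_real pi)"

definition moment :: "(complex \<Rightarrow> complex) \<Rightarrow> int \<Rightarrow> complex" where
  "moment w k = circle_mean (\<lambda>\<zeta>. w \<zeta> * \<zeta> powi (-k))"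

(* The derivative with respect to the deformation variable, which ranges over U. *)
definition ddt :: "complex set \<Rightarrow> (complex \<Rightarrow> complex) \<Rightarrow> complex \<Rightarrow> complex" where
  "ddt U f t = (THE D. (f has_field_derivative D) (at t within U))"

(* The associated functions epsilon_n (p = phi_n) and epsilon_n^* (q = bar phi_n). *)
definition eps :: "(complex \<Rightarrow> complex) \<Rightarrow> complex poly \<Rightarrow> complex \<Rightarrow> complex" where
  "eps w p x = circle_mean (\<lambda>\<zeta>. (\<zeta> + x) / (\<zeta> - x) * w \<zeta> * poly p \<zeta>)"

definition eps_star :: "nat \<Rightarrow> (complex \<Rightarrow> complex) \<Rightarrow> complex poly \<Rightarrow> complex \<Rightarrow> complex" where
  "eps_star n w q x =
     - (x ^ n) * circle_mean (\<lambda>\<zeta>. (\<zeta> + x) / (\<zeta> - x) * w \<zeta> * poly q (1 / \<zeta>))"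

(* Values at a singular point a.  If a lies on the circle, its exponent has positive real part,
   so w tends to 0 at a and the boundary values of eps and eps_star at a from inside and outside
   agree; the limiting value is taken along the ray through a, from both sides. *)
definition limiting_value :: "(complex \<Rightarrow> complex) \<Rightarrow> complex \<Rightarrow> complex" where
  "limiting_value f a =
     (if a \<in> sphere 0 1 then Lim (at 1) (\<lambda>r::real. f (of_real r * a)) else f a)"

(* p = phi_n and q = bar phi_n, so that reflect_poly q = phi_n^* when q has degree n. *)
definition Ymat ::
  "nat \<Rightarrow> (complex \<Rightarrow> complex) \<Rightarrow> complex poly \<Rightarrow> complex poly \<Rightarrow> complex \<Rightarrow> complex ^ 2 ^ 2" where
  "Ymat n w p q x =
     vector [vector [poly p x, eps w p x / w x],
             vector [poly (reflect_poly q) x, - eps_star n w q x / w x]]"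

(* Y_n' = A_n Y_n with A_n(x) = sum_j A_nj / (x - z_j), off the cuts and off the circle; this
   determines the residue matrices A 1, ..., A m.  "mat c ** M" is the scalar multiple c M. *)
definition residue_matrices ::
  "nat \<Rightarrow> (nat \<Rightarrow> complex) \<Rightarrow> complex set \<Rightarrow> (complex \<Rightarrow> complex ^ 2 ^ 2)
    \<Rightarrow> (nat \<Rightarrow> complex ^ 2 ^ 2) \<Rightarrow> bool" where
  "residue_matrices m a D Y A \<longleftrightarrow>
     (\<forall>x \<in> D - sphere 0 1. \<forall>i k.
        ((\<lambda>x. Y x $ i $ k) has_field_derivative
           ((\<Sum>j=1..m. mat (1 / (x - a j)) ** A j) ** Y x) $ i $ k) (at x))"

definition Binf :: "complex set \<Rightarrow> (complex \<Rightarrow> complex) \<Rightarrow> (complex \<Rightarrow> complex) \<Rightarrow> complex \<Rightarrow> complex ^ 2 ^ 2" where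
  "Binf U \<kappa> b t =
     vector [vector [ddt U \<kappa> t / \<kappa> t, 0],
             vector [(\<kappa> t * ddt U b t + ddt U \<kappa> t * b t) / (\<kappa> t)\<^sup>2, - (ddt U \<kappa> t / \<kappa> t)]]"

(* An analytic branch w of prod_j (x - a_j)^(rho_j) on the cut plane D. *)
definition is_branch ::
  "nat \<Rightarrow> (nat \<Rightarrow> complex) \<Rightarrow> (nat \<Rightarrow> complex) \<Rightarrow> complex set \<Rightarrow> (complex \<Rightarrow> complex) \<Rightarrow> bool" where
  "is_branch m a \<rho> D w \<longleftrightarrow>
     w holomorphic_on D \<and>
     (\<forall>x\<in>D. \<exists>l. (\<forall>j\<in>{1..m}. exp (l j) = x - a j) \<and> w x = exp (\<Sum>j=1..m. \<rho> j * l j))"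

(* z j t, Omega t, w t are the singular points, the cut plane and the weight at time t;
   phi n t and phib n t are phi_n and bar phi_n.  The deformation variable t is complex
   (U open in the plane) or real (U an open set of reals, embedded in the plane). *)
locale semiclassical_deformation =
  fixes m :: nat
    and U :: "complex set"
    and z :: "nat \<Rightarrow> complex \<Rightarrow> complex"
    and \<rho> :: "nat \<Rightarrow> complex"
    and \<Omega> :: "complex \<Rightarrow> complex set"
    and w :: "complex \<Rightarrow> complex \<Rightarrow> complex"
    and \<kappa> :: "nat \<Rightarrow> complex \<Rightarrow> complex"
    and \<phi> \<phi>b :: "nat \<Rightarrow> complex \<Rightarrow> complex poly"
  assumes deformation_domain: "open U \<or> (\<exists>I :: real set. open I \<and> U = complex_of_real ` I)"
    and m_ge_2: "m \<ge> 2"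
    and distinct_points: "\<And>t. t \<in> U \<Longrightarrow> inj_on (\<lambda>j. z j t) {1..m}"
    and points_differentiable:
      "\<And>j t. \<lbrakk>j \<in> {1..m}; t \<in> U\<rbrakk> \<Longrightarrow> z j field_differentiable (at t within U)"
    and z_1: "\<And>t. t \<in> U \<Longrightarrow> z 1 t = 0"
    and exponents: "\<And>j. j \<in> {1..m} \<Longrightarrow> \<rho> j \<notin> \<nat>"
    \<comment> \<open>the cut plane and the branch of the weight\<close>
    and cut_plane:
      "\<And>t. t \<in> U \<Longrightarrow> open (\<Omega> t) \<and> connected (\<Omega> t) \<and> closure (\<Omega> t) = UNIV"
    and cuts_on_circle:
      "\<And>t. t \<in> U \<Longrightarrow> sphere 0 1 - {-1} - (\<lambda>j. z j t) ` {1..m} \<subseteq> \<Omega> t"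
    and branch: "\<And>t. t \<in> U \<Longrightarrow> is_branch m (\<lambda>j. z j t) \<rho> (\<Omega> t) (w t)"
    \<comment> \<open>the cuts move with \<open>t\<close>, and the branch is continued continuously in \<open>t\<close>\<close>
    and cuts_move: "\<And>t x. \<lbrakk>t \<in> U; x \<in> \<Omega> t\<rbrakk> \<Longrightarrow> \<forall>\<^sub>F s in at t within U. x \<in> \<Omega> s"
    and branch_continued:
      "\<And>t x. \<lbrakk>t \<in> U; x \<in> \<Omega> t\<rbrakk> \<Longrightarrow> continuous (at t within U) (\<lambda>s. w s x)"
    \<comment> \<open>\<open>w(e^{\<pi>i}) = w(e^{-\<pi>i})\<close>, as one-sided limits along the circle\<close>
    and periodic:
      "\<And>t. t \<in> U \<Longrightarrow> \<exists>L. ((\<lambda>\<theta>. w t (cis \<theta>)) \<longlongrightarrow> L) (at_left pi) \<and>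
                         ((\<lambda>\<theta>. w t (cis \<theta>)) \<longlongrightarrow> L) (at_right (-pi))"
    and w_integrable:
      "\<And>t k. t \<in> U \<Longrightarrow>
         set_integrable lborel {-pi<..pi} (\<lambda>\<theta>. cis \<theta> powi k * w t (cis \<theta>))"
    and w'_integrable:
      "\<And>t k. t \<in> U \<Longrightarrow>
         set_integrable lborel {-pi<..pi} (\<lambda>\<theta>. cis \<theta> powi k * deriv (w t) (cis \<theta>))"
    and toeplitz_nonzero:
      "\<And>t n. \<lbrakk>t \<in> U; n \<ge> 1\<rbrakk> \<Longrightarrow>
         Determinant.det (Matrix.mat n n (\<lambda>(j, k). moment (w t) (int j - int k))) \<noteq> 0"
    \<comment> \<open>the bi-orthonormal polynomials\<close>
    and \<kappa>_nonzero: "\<And>n t. t \<in> U \<Longrightarrow> \<kappa> n t \<noteq> 0"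
    and degrees: "\<And>n t. t \<in> U \<Longrightarrow> degree (\<phi> n t) = n \<and> degree (\<phi>b n t) = n"
    and leading_coeffs:
      "\<And>n t. t \<in> U \<Longrightarrow> coeff (\<phi> n t) n = \<kappa> n t \<and> coeff (\<phi>b n t) n = \<kappa> n t"
    and coeffs_differentiable:
      "\<And>n k t. t \<in> U \<Longrightarrow> (\<lambda>s. coeff (\<phi> n s) k) field_differentiable (at t within U) \<and>
                            (\<lambda>s. coeff (\<phi>b n s) k) field_differentiable (at t within U)"
    and biorthonormal:
      "\<And>i n t. t \<in> U \<Longrightarrow>
         circle_mean (\<lambda>\<zeta>. w t \<zeta> * poly (\<phi> i t) \<zeta> * poly (\<phi>b n t) (1 / \<zeta>)) =
           (if i = n then 1 else 0)"
    and constant_terms: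
      "\<And>n t. t \<in> U \<Longrightarrow> poly (\<phi> n t) 0 \<noteq> 0 \<and> poly (\<phi>b n t) 0 \<noteq> 0"

end

theory Submission
  imports Defs "HOL-Complex_Analysis.Cauchy_Integral_Formula"
begin

text \<open>
  Write \<open>a j\<close> for the singular points, \<open>W = \<Prod>(x - a j)\<close> and \<open>V = \<Sum>\<rho> j \<Prod>(x - a i)\<close> (product over \<open>i \<noteq> j\<close>), so that
  \<open>W w' = V w\<close>.  Both systems of the theorem are linear in the same data once the residue matrices
  are known explicitly.  They are determined by three linear relations (\<open>residue_matrix_entries\<close>): the first column of
  \<open>Y\<close> is polynomial, so \<open>A j\<close> annihilates \<open>(\<phi>, \<phi>\<^sup>*)\<close> at \<open>a j\<close>; \<open>\<epsilon>\<close> and \<open>\<epsilon>\<^sup>*\<close> have finite radial limits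
  at \<open>a j\<close>, so \<open>(x - a j) \<epsilon>'\<close> tends to 0 there; and \<open>\<phi> \<epsilon>\<^sup>* + \<phi>\<^sup>* \<epsilon> = 2 x ^ n\<close>.

  With \<open>S i k = \<Sum>(a' j / a j) A j $ i $ k\<close> and \<open>T i k x = \<Sum>(a' j / (x - a j)) A j $ i $ k\<close>, the partial
  fraction \<open>x / (a (x - a)) = 1 / a + 1 / (x - a)\<close> shows that the scalar and the matrix system differ
  only by constants: they coincide if and only if \<open>2 r = S 2 2\<close>, with \<open>r\<close> the logarithmic derivative of \<open>\<kappa>\<close>, and the lower left
  entry \<open>b\<close> of \<open>B\<^sub>\<infinity>\<close> is \<open>- S 2 1\<close>.  So the theorem says that each system, taken alone, forces these two
  relations.  For the scalar system they are the leading coefficients at infinity of the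
  equations for \<open>\<phi>\<close> and \<open>\<phi>\<^sup>*\<close>.  For the matrix system, the equation for \<open>\<phi>\<^sup>*\<close> at \<open>x = 0\<close> gives one
  linear relation between the two defects.  A second one comes from \<open>\<epsilon> = x ^ n \<eta>\<close>, where \<open>\<eta>\<close> takes the value
  \<open>2 / \<kappa>\<close> at 0: the equation for \<open>\<epsilon>\<close>, divided by \<open>x ^ n\<close>, gives \<open>2 r = S 2 2\<close> in the limit \<open>x \<rightarrow> 0\<close>.

  That limit, and the passage from the cut plane to the points on the cuts, exchange the derivative
  in \<open>t\<close> with a limit in \<open>x\<close>.  This is justified by bounds \<open>\<bar>h s y - h t y\<bar> \<le> C \<bar>s - t\<bar>\<close> that hold locally uniformly in \<open>y\<close>: a
  difference quotient in \<open>s\<close> that is holomorphic and bounded in \<open>y\<close> is equicontinuous in \<open>y\<close>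
  (\<open>lips_derivative_extends\<close>).  All associated functions are combinations of the Cauchy transforms of
  \<open>w\<close>.  Near 0 and near infinity the bound for these follows from the linear recurrence that
  \<open>W w' = V w\<close> imposes on the moments (\<open>moment_recurrence\<close>), whose coefficients are differentiable in \<open>t\<close>;
  from there the linear equation \<open>W C' = V C + Q\<close> for the Cauchy transform (\<open>cauchy_moment_ode\<close>) carries it to the
  whole complement of the circle and the singular points.
\<close>

section \<open>Means over the unit circle\<close>

definition circle_integrable :: "(complex \<Rightarrow> complex) \<Rightarrow> bool" where
  "circle_integrable f \<longleftrightarrow> set_integrable lborel {-pi<..pi} (\<lambda>\<theta>. f (cis \<theta>))"

lemma circle_mean_cong:
  assumes "\<And>\<zeta>. \<zeta> \<in> sphere 0 1 \<Longrightarrow> f \<zeta> = g \<zeta>"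
  shows "circle_mean f = circle_mean g"
  using assms by (simp add: circle_mean_def)

lemma circle_integrable_add:
  "circle_integrable f \<Longrightarrow> circle_integrable g \<Longrightarrow> circle_integrable (\<lambda>\<zeta>. f \<zeta> + g \<zeta>)"
  unfolding circle_integrable_def by (rule set_integral_add)

lemma circle_integrable_diff:
  "circle_integrable f \<Longrightarrow> circle_integrable g \<Longrightarrow> circle_integrable (\<lambda>\<zeta>. f \<zeta> - g \<zeta>)"
  unfolding circle_integrable_def by (rule set_integral_diff)

lemma circle_integrable_cmult:
  "circle_integrable f \<Longrightarrow> circle_integrable (\<lambda>\<zeta>. c * f \<zeta>)"
  unfolding circle_integrable_def by simp

lemma circle_integrable_sum:
  assumes "\<And>i. i \<in> I \<Longrightarrow> circle_integrable (f i)"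
  shows "circle_integrable (\<lambda>\<zeta>. \<Sum>i\<in>I. f i \<zeta>)"
proof (cases "finite I")
  case True
  then show ?thesis using assms
    by (induction I rule: finite_induct)
      (auto intro!: circle_integrable_add, simp add: circle_integrable_def set_integrable_def)
qed (simp add: circle_integrable_def set_integrable_def)

lemma circle_mean_add:
  "circle_integrable f \<Longrightarrow> circle_integrable g \<Longrightarrow>
    circle_mean (\<lambda>\<zeta>. f \<zeta> + g \<zeta>) = circle_mean f + circle_mean g"
  unfolding circle_integrable_def circle_mean_def by (simp add: set_integral_add add_divide_distrib)

lemma circle_mean_diff:
  "circle_integrable f \<Longrightarrow> circle_integrable g \<Longrightarrow>
    circle_mean (\<lambda>\<zeta>. f \<zeta> - g \<zeta>) = circle_mean f - circle_mean g"
  unfolding circle_integrable_def circle_mean_def by (simp add: set_integral_diff diff_divide_distrib)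

lemma circle_mean_cmult: "circle_mean (\<lambda>\<zeta>. c * f \<zeta>) = c * circle_mean f"
  unfolding circle_mean_def by simp

lemma circle_mean_sum:
  assumes "\<And>i. i \<in> I \<Longrightarrow> circle_integrable (f i)"
  shows "circle_mean (\<lambda>\<zeta>. \<Sum>i\<in>I. f i \<zeta>) = (\<Sum>i\<in>I. circle_mean (f i))"
proof (cases "finite I")
  case True
  then show ?thesis using assms
    by (induction I rule: finite_induct)
      (auto simp: circle_mean_add circle_integrable_sum, simp add: circle_mean_def)
qed (simp add: circle_mean_def)

lemma circle_integrable_continuous_mult:
  assumes f: "circle_integrable f" and g: "continuous_on (sphere 0 1) g"
  shows "circle_integrable (\<lambda>\<zeta>. g \<zeta> * f \<zeta>)"
proof -
  have "compact (g ` sphere 0 1)"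
    using g by (intro compact_continuous_image) auto
  then obtain K where K: "\<And>\<zeta>. \<zeta> \<in> sphere 0 1 \<Longrightarrow> cmod (g \<zeta>) \<le> K"
    by (meson bounded_iff compact_imp_bounded imageI)
  have gc: "continuous_on UNIV (\<lambda>\<theta>. g (cis \<theta>))"
    by (rule continuous_on_compose2[OF g]) (auto intro!: continuous_intros simp: cis_conv_exp)
  then have gm: "(\<lambda>\<theta>. g (cis \<theta>)) \<in> borel_measurable lborel"
    using borel_measurable_continuous_onI by simp
  have "set_integrable lborel {-pi<..pi} (\<lambda>\<theta>. g (cis \<theta>) * f (cis \<theta>))"
    unfolding set_integrable_def
  proof (rule Bochner_Integration.integrable_bound)
    show "integrable lborel (\<lambda>\<theta>. of_real K * (indicat_real {-pi<..pi} \<theta> *\<^sub>R f (cis \<theta>)))"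
      using f unfolding circle_integrable_def set_integrable_def by (rule integrable_mult_right)
    have "(\<lambda>\<theta>. g (cis \<theta>) * (indicat_real {-pi<..pi} \<theta> *\<^sub>R f (cis \<theta>))) \<in> borel_measurable lborel"
      using f gm unfolding circle_integrable_def set_integrable_def
      by (intro borel_measurable_times) auto
    then show "(\<lambda>\<theta>. indicat_real {-pi<..pi} \<theta> *\<^sub>R (g (cis \<theta>) * f (cis \<theta>))) \<in> borel_measurable lborel"
      by (simp add: algebra_simps)
    show "AE \<theta> in lborel. cmod (indicat_real {-pi<..pi} \<theta> *\<^sub>R (g (cis \<theta>) * f (cis \<theta>)))
        \<le> cmod (of_real K * (indicat_real {-pi<..pi} \<theta> *\<^sub>R f (cis \<theta>)))"
    proof (intro AE_I2)
      fix \<theta> :: real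
      have "cmod (g (cis \<theta>)) \<le> \<bar>K\<bar>" using K[of "cis \<theta>"] by simp
      then show "cmod (indicat_real {-pi<..pi} \<theta> *\<^sub>R (g (cis \<theta>) * f (cis \<theta>)))
        \<le> cmod (of_real K * (indicat_real {-pi<..pi} \<theta> *\<^sub>R f (cis \<theta>)))"
        by (auto simp: norm_mult indicator_def intro!: mult_right_mono)
    qed
  qed
  then show ?thesis by (simp add: circle_integrable_def)
qed

text \<open>
  The normalisation differs from that of \<open>circle_mean\<close> by \<open>2 \<pi>\<close>; only upper bounds are derived from it.
\<close>

definition circle_norm :: "(complex \<Rightarrow> complex) \<Rightarrow> real" where
  "circle_norm f = set_lebesgue_integral lborel {-pi<..pi} (\<lambda>\<theta>. cmod (f (cis \<theta>)))"

lemma circle_mean_le_norm: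
  assumes "circle_integrable f" "circle_integrable g"
    and le: "\<And>\<zeta>. \<zeta> \<in> sphere 0 1 \<Longrightarrow> cmod (f \<zeta>) \<le> K * cmod (g \<zeta>)"
  shows "cmod (circle_mean f) \<le> K * circle_norm g"
proof -
  have "cmod (LINT \<theta>:{-pi<..pi}|lborel. f (cis \<theta>)) \<le> (LINT \<theta>:{-pi<..pi}|lborel. cmod (f (cis \<theta>)))"
    using assms(1) unfolding circle_integrable_def by (rule set_integral_norm_bound)
  also have "\<dots> \<le> (LINT \<theta>:{-pi<..pi}|lborel. K * cmod (g (cis \<theta>)))"
  proof (rule set_integral_mono)
    show "set_integrable lborel {-pi<..pi} (\<lambda>\<theta>. cmod (f (cis \<theta>)))"
      using assms(1) unfolding circle_integrable_def by (rule set_integrable_norm)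
    show "set_integrable lborel {-pi<..pi} (\<lambda>\<theta>. K * cmod (g (cis \<theta>)))"
      using assms(2) unfolding circle_integrable_def by (intro set_integrable_mult_right set_integrable_norm)
  qed (use le in auto)
  also have "\<dots> = K * circle_norm g"
    by (simp add: circle_norm_def)
  finally have *: "cmod (LINT \<theta>:{-pi<..pi}|lborel. f (cis \<theta>)) \<le> K * circle_norm g" .
  have "cmod (circle_mean f) = cmod (LINT \<theta>:{-pi<..pi}|lborel. f (cis \<theta>)) / (2 * pi)"
    unfolding circle_mean_def by (simp add: norm_divide norm_mult)
  also have "\<dots> \<le> cmod (LINT \<theta>:{-pi<..pi}|lborel. f (cis \<theta>))"
    using pi_gt3 by (simp add: divide_le_eq mult_le_cancel_left1)
  finally show ?thesis using * by linarith
qed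

lemma finite_cis_preimage:
  assumes "finite S"
  shows "finite {\<theta>\<in>{-pi<..pi}. cis \<theta> \<in> S}"
proof (rule finite_imageD)
  show "finite (cis ` {\<theta>\<in>{-pi<..pi}. cis \<theta> \<in> S})"
    using assms by (rule finite_subset[rotated]) auto
  show "inj_on cis {\<theta>\<in>{-pi<..pi}. cis \<theta> \<in> S}"
    by (rule inj_on_inverseI[where g = Arg]) (auto intro!: cis_Arg_unique simp: sgn_cis)
qed

text \<open>
  The exceptional finite set accommodates a boundary point of the circle that is approached along
  its radius, where no bound holds.
\<close>

lemma circle_mean_dominated_convergence:
  fixes f :: "'b::first_countable_topology \<Rightarrow> complex \<Rightarrow> complex"
  assumes g: "circle_integrable g"
    and f: "\<forall>\<^sub>F y in at x. circle_integrable (f y)"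
    and l: "circle_integrable l"
    and fin: "finite S"
    and lim: "\<And>\<zeta>. \<zeta> \<in> sphere 0 1 - S \<Longrightarrow> ((\<lambda>y. f y \<zeta>) \<longlongrightarrow> l \<zeta>) (at x)"
    and bd: "\<forall>\<^sub>F y in at x. \<forall>\<zeta>\<in>sphere 0 1 - S. cmod (f y \<zeta>) \<le> K * cmod (g \<zeta>)"
  shows "((\<lambda>y. circle_mean (f y)) \<longlongrightarrow> circle_mean l) (at x)"
proof -
  let ?i = "\<lambda>\<theta>::real. indicat_real {-pi<..pi} \<theta>"
  let ?N = "{\<theta>\<in>{-pi<..pi}. cis \<theta> \<in> S}"
  have AE: "AE \<theta> in lborel. \<theta> \<notin> ?N"
  proof (rule AE_not_in)
    have "?N \<in> null_sets lborel"
      using finite_cis_preimage[OF fin] by (rule finite_imp_null_set_lborel)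
    then show "?N \<in> null_sets lborel" .
  qed
  have "((\<lambda>y. LINT \<theta>|lborel. ?i \<theta> *\<^sub>R f y (cis \<theta>)) \<longlongrightarrow> (LINT \<theta>|lborel. ?i \<theta> *\<^sub>R l (cis \<theta>))) (at x)"
    unfolding tendsto_at_iff_sequentially comp_def
  proof (intro allI impI)
    fix X :: "nat \<Rightarrow> 'b"
    assume X: "\<forall>i. X i \<in> UNIV - {x}" "X \<longlonglongrightarrow> x"
    have Xat: "filterlim X (at x) sequentially"
      using X by (simp add: filterlim_at)
    have ev: "\<forall>\<^sub>F n in sequentially. circle_integrable (f (X n)) \<and> (\<forall>\<zeta>\<in>sphere 0 1 - S. cmod (f (X n) \<zeta>) \<le> K * cmod (g \<zeta>))"
      using filterlim_iff[THEN iffD1, OF Xat, rule_format, OF eventually_conj[OF f bd]] .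
    then obtain N where N: "\<And>n. n \<ge> N \<Longrightarrow> circle_integrable (f (X n))"
       "\<And>n \<zeta>. n \<ge> N \<Longrightarrow> \<zeta>\<in>sphere 0 1 - S \<Longrightarrow> cmod (f (X n) \<zeta>) \<le> K * cmod (g \<zeta>)"
      unfolding eventually_sequentially by blast
    have "(\<lambda>n. LINT \<theta>|lborel. ?i \<theta> *\<^sub>R f (X (n + N)) (cis \<theta>)) \<longlonglongrightarrow> (LINT \<theta>|lborel. ?i \<theta> *\<^sub>R l (cis \<theta>))"
    proof (rule integral_dominated_convergence[where w = "\<lambda>\<theta>. K * cmod (?i \<theta> *\<^sub>R g (cis \<theta>))"])
      show "(\<lambda>\<theta>. ?i \<theta> *\<^sub>R l (cis \<theta>)) \<in> borel_measurable lborel"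
        using l unfolding circle_integrable_def set_integrable_def by simp
      show "(\<lambda>\<theta>. ?i \<theta> *\<^sub>R f (X (n + N)) (cis \<theta>)) \<in> borel_measurable lborel" for n
        using N(1)[of "n + N"] unfolding circle_integrable_def set_integrable_def by simp
      show "integrable lborel (\<lambda>\<theta>. K * cmod (?i \<theta> *\<^sub>R g (cis \<theta>)))"
        using g unfolding circle_integrable_def set_integrable_def by (intro integrable_mult_right integrable_norm)
      show "AE \<theta> in lborel. (\<lambda>n. ?i \<theta> *\<^sub>R f (X (n + N)) (cis \<theta>)) \<longlonglongrightarrow> ?i \<theta> *\<^sub>R l (cis \<theta>)"
        using AE
      proof eventually_elim
        case (elim \<theta>)
        show ?case
        proof (cases "\<theta> \<in> {-pi<..pi}")
          case True
          then have "cis \<theta> \<in> sphere 0 1 - S" using elim by auto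
          from filterlim_compose[OF lim[OF this] Xat]
          have "(\<lambda>n. f (X n) (cis \<theta>)) \<longlonglongrightarrow> l (cis \<theta>)" .
          then have "(\<lambda>n. f (X (n + N)) (cis \<theta>)) \<longlonglongrightarrow> l (cis \<theta>)" by (rule LIMSEQ_ignore_initial_segment)
          then show ?thesis by (intro tendsto_intros)
        qed auto
      qed
      show "AE \<theta> in lborel. cmod (?i \<theta> *\<^sub>R f (X (n + N)) (cis \<theta>)) \<le> K * cmod (?i \<theta> *\<^sub>R g (cis \<theta>))" for n
        using AE
      proof eventually_elim
        case (elim \<theta>)
        then show ?case using N(2)[of "n + N" "cis \<theta>"] by (auto simp: indicator_def)
      qed
    qed
    then show "(\<lambda>n. LINT \<theta>|lborel. ?i \<theta> *\<^sub>R f (X n) (cis \<theta>)) \<longlonglongrightarrow> (LINT \<theta>|lborel. ?i \<theta> *\<^sub>R l (cis \<theta>))"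
      by (rule LIMSEQ_offset)
  qed
  then show ?thesis
    unfolding circle_mean_def set_lebesgue_integral_def by (intro tendsto_intros) auto
qed

subsection \<open>Cauchy integrals\<close>

definition cauchy_integral :: "(complex \<Rightarrow> complex) \<Rightarrow> complex \<Rightarrow> complex" where
  "cauchy_integral u x = circle_mean (\<lambda>\<zeta>. u \<zeta> / (\<zeta> - x))"

text \<open>
  One number serves as the radius of the ball and as the lower bound for the distance, which makes
  the Cauchy kernel uniformly bounded near \<open>x\<close>.
\<close>

lemma dist_sphere_pos:
  fixes x :: complex
  assumes "x \<notin> sphere 0 1"
  obtains d where "d > 0" "\<And>y \<zeta>. y \<in> ball x d \<Longrightarrow> \<zeta> \<in> sphere 0 1 \<Longrightarrow> d \<le> cmod (\<zeta> - y)"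
proof -
  define d where "d = \<bar>cmod x - 1\<bar> / 2"
  have "d > 0" using assms by (auto simp: d_def)
  moreover have "d \<le> cmod (\<zeta> - y)" if "y \<in> ball x d" "\<zeta> \<in> sphere 0 1" for y \<zeta>
  proof -
    have "cmod (x - y) < d" "cmod \<zeta> = 1" using that by (auto simp: dist_norm)
    moreover have "\<bar>cmod x - 1\<bar> \<le> cmod (x - \<zeta>)"
      using \<open>cmod \<zeta> = 1\<close> norm_triangle_ineq3[of x \<zeta>] by simp
    moreover have "cmod (x - \<zeta>) \<le> cmod (x - y) + cmod (\<zeta> - y)"
      by (metis norm_triangle_ineq4 add.commute diff_diff_eq2 diff_add_cancel)
    moreover have "2 * d = \<bar>cmod x - 1\<bar>" by (simp add: d_def)
    ultimately show ?thesis by linarith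
  qed
  ultimately show ?thesis using that by blast
qed

lemma circle_integrable_cauchy_kernel:
  assumes "circle_integrable u" "x \<notin> sphere 0 1"
  shows "circle_integrable (\<lambda>\<zeta>. u \<zeta> / (\<zeta> - x) ^ k)"
proof -
  have "circle_integrable (\<lambda>\<zeta>. (1 / (\<zeta> - x) ^ k) * u \<zeta>)"
    using assms by (intro circle_integrable_continuous_mult continuous_intros) auto
  then show ?thesis by (simp add: mult.commute)
qed

lemma cauchy_integral_has_field_derivative:
  assumes u: "circle_integrable u" and x: "x \<notin> sphere 0 1"
  shows "(cauchy_integral u has_field_derivative circle_mean (\<lambda>\<zeta>. u \<zeta> / (\<zeta> - x)\<^sup>2)) (at x)"
proof -
  obtain d where d: "d > 0" and dd: "\<And>y \<zeta>. y \<in> ball x d \<Longrightarrow> \<zeta> \<in> sphere 0 1 \<Longrightarrow> d \<le> cmod (\<zeta> - y)"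
    using dist_sphere_pos[OF x] by blast
  have off: "y \<notin> sphere 0 1" if "y \<in> ball x d" for y
    using dd[OF that, of y] d by auto
  have ne: "\<zeta> - y \<noteq> 0" if "y \<in> ball x d" "\<zeta> \<in> sphere 0 1" for y \<zeta>
    using dd[OF that] d by auto
  have xb: "x \<in> ball x d" using d by simp
  have evb: "\<forall>\<^sub>F y in at x. y \<in> ball x d"
    using d by (intro eventually_at_in_open') auto
  have int2: "circle_integrable (\<lambda>\<zeta>. u \<zeta> / ((\<zeta> - y) * (\<zeta> - x)))" if "y \<in> ball x d" for y
  proof -
    have "circle_integrable (\<lambda>\<zeta>. (1 / ((\<zeta> - y) * (\<zeta> - x))) * u \<zeta>)"
      using u ne[OF that] ne[OF xb] by (intro circle_integrable_continuous_mult continuous_intros) auto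
    then show ?thesis by (simp add: mult.commute)
  qed
  have "((\<lambda>y. circle_mean (\<lambda>\<zeta>. u \<zeta> / ((\<zeta> - y) * (\<zeta> - x)))) \<longlongrightarrow> circle_mean (\<lambda>\<zeta>. u \<zeta> / (\<zeta> - x)\<^sup>2)) (at x)"
  proof (rule circle_mean_dominated_convergence[where S = "{}" and g = u and K = "1 / d^2"])
    show "\<forall>\<^sub>F y in at x. circle_integrable (\<lambda>\<zeta>. u \<zeta> / ((\<zeta> - y) * (\<zeta> - x)))"
      using evb by eventually_elim (rule int2)
    show "circle_integrable (\<lambda>\<zeta>. u \<zeta> / (\<zeta> - x)\<^sup>2)"
      by (rule circle_integrable_cauchy_kernel[OF u x])
    show "((\<lambda>y. u \<zeta> / ((\<zeta> - y) * (\<zeta> - x))) \<longlongrightarrow> u \<zeta> / (\<zeta> - x)\<^sup>2) (at x)" if "\<zeta> \<in> sphere 0 1 - {}" for \<zeta>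
      using ne[OF xb] that unfolding power2_eq_square by (intro tendsto_intros) auto
    show "\<forall>\<^sub>F y in at x. \<forall>\<zeta>\<in>sphere 0 1 - {}. cmod (u \<zeta> / ((\<zeta> - y) * (\<zeta> - x))) \<le> 1 / d\<^sup>2 * cmod (u \<zeta>)"
      using evb
    proof eventually_elim
      case (elim y)
      have "cmod (u \<zeta> / ((\<zeta> - y) * (\<zeta> - x))) \<le> 1 / d\<^sup>2 * cmod (u \<zeta>)" if "\<zeta> \<in> sphere 0 1" for \<zeta>
      proof -
        have "d * d \<le> cmod (\<zeta> - y) * cmod (\<zeta> - x)"
          using dd[OF elim that] dd[OF xb that] d by (intro mult_mono) auto
        then have "cmod (u \<zeta>) / (cmod (\<zeta> - y) * cmod (\<zeta> - x)) \<le> cmod (u \<zeta>) / (d * d)"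
          using d ne[OF elim that] ne[OF xb that] by (intro divide_left_mono) auto
        then show ?thesis by (simp add: norm_divide norm_mult power2_eq_square)
      qed
      then show ?case by simp
    qed
  qed (use u in auto)
  moreover have "\<forall>\<^sub>F y in at x. (cauchy_integral u y - cauchy_integral u x) / (y - x)
      = circle_mean (\<lambda>\<zeta>. u \<zeta> / ((\<zeta> - y) * (\<zeta> - x)))"
    using evb eventually_neq_at_within[of x]
  proof eventually_elim
    case (elim y)
    have "cauchy_integral u y - cauchy_integral u x = circle_mean (\<lambda>\<zeta>. u \<zeta> / (\<zeta> - y) - u \<zeta> / (\<zeta> - x))"
      unfolding cauchy_integral_def
      using circle_integrable_cauchy_kernel[OF u off[OF elim(1)], of 1] circle_integrable_cauchy_kernel[OF u x, of 1]
      by (simp add: circle_mean_diff)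
    also have "\<dots> = circle_mean (\<lambda>\<zeta>. (y - x) * (u \<zeta> / ((\<zeta> - y) * (\<zeta> - x))))"
    proof (rule circle_mean_cong)
      fix \<zeta> :: complex assume "\<zeta> \<in> sphere 0 1"
      then have "\<zeta> - y \<noteq> 0" "\<zeta> - x \<noteq> 0" using ne[OF elim(1)] ne[OF xb] by auto
      then show "u \<zeta> / (\<zeta> - y) - u \<zeta> / (\<zeta> - x) = (y - x) * (u \<zeta> / ((\<zeta> - y) * (\<zeta> - x)))"
        by (simp add: divide_simps) (simp add: algebra_simps)
    qed
    finally show ?case unfolding circle_mean_cmult using elim(2) by simp
  qed
  ultimately show ?thesis
    unfolding has_field_derivative_iff by (subst tendsto_cong)
qed

section \<open>The weight at a fixed time\<close>

lemma cis_has_vector_derivative: "(cis has_vector_derivative (\<i> * cis \<theta>)) (at \<theta>)"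
proof -
  have "((\<lambda>z. exp (\<i> * z)) has_field_derivative \<i> * exp (\<i> * of_real \<theta>)) (at (of_real \<theta>))"
    by (rule derivative_eq_intros refl | simp)+
  from has_vector_derivative_real_field[OF this] show ?thesis
    by (simp add: cis_conv_exp[abs_def])
qed

text \<open>
  The quotient of the two sides is continuous with values in the countable set of numbers
  \<open>exp (2 \<pi> \<i> \<Sum>\<rho> j k j)\<close>, \<open>k j\<close> integers, hence constant on a connected set.  The parameter is the
  space variable in \<open>w_has_field_derivative\<close> and the deformation variable in \<open>w_deformation_derivative\<close>.
\<close>

lemma branch_continuation:
  fixes f :: "'a::topological_space \<Rightarrow> complex" and b :: "nat \<Rightarrow> 'a \<Rightarrow> complex"
  assumes X: "connected X" "x0 \<in> X" and J: "finite J"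
    and f: "continuous_on X f" and b: "\<And>j. j \<in> J \<Longrightarrow> continuous_on X (b j)"
    and logs: "\<And>x. x \<in> X \<Longrightarrow> \<exists>l. (\<forall>j\<in>J. exp (l j) = b j x) \<and> f x = exp (\<Sum>j\<in>J. \<rho> j * l j)"
    and pos: "\<And>x j. x \<in> X \<Longrightarrow> j \<in> J \<Longrightarrow> Re (b j x / b j x0) > 0"
    and x: "x \<in> X"
  shows "f x = f x0 * exp (\<Sum>j\<in>J. \<rho> j * Ln (b j x / b j x0))"
proof -
  define E where "E = (\<lambda>x. exp (\<Sum>j\<in>J. \<rho> j * Ln (b j x / b j x0)))"
  define h where "h = (\<lambda>x. f x / (f x0 * E x))"
  define G where "G = (\<lambda>k. exp (\<Sum>j\<in>J. \<rho> j * (of_int (2 * k j) * pi * \<i>))) ` (Pi\<^sub>E J (\<lambda>_. UNIV :: int set))"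
  obtain l0 where l0: "\<And>j. j \<in> J \<Longrightarrow> exp (l0 j) = b j x0" "f x0 = exp (\<Sum>j\<in>J. \<rho> j * l0 j)"
    using logs[OF X(2)] by blast
  have b0: "b j x0 \<noteq> 0" if "j \<in> J" for j
    using l0(1)[OF that] by (metis exp_not_eq_zero)
  have nonpos: "b j y / b j x0 \<notin> \<real>\<^sub>\<le>\<^sub>0" if "y \<in> X" "j \<in> J" for j y
    using pos[OF that] complex_nonpos_Reals_iff[of "b j y / b j x0"] by linarith
  have cont: "continuous_on X h"
    unfolding h_def E_def
    by (intro continuous_intros f b continuous_on_Ln) (use J b0 l0(2) nonpos in auto)
  have "countable G"
    unfolding G_def using J by (intro countable_image countable_PiE) auto
  moreover have "h y \<in> G" if y: "y \<in> X" for y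
  proof -
    obtain l where l: "\<And>j. j \<in> J \<Longrightarrow> exp (l j) = b j y" "f y = exp (\<Sum>j\<in>J. \<rho> j * l j)"
      using logs[OF y] by blast
    have "\<exists>k::int. l j = l0 j + Ln (b j y / b j x0) + (of_int (2 * k) * pi) * \<i>" if "j \<in> J" for j
    proof -
      have ne: "b j y / b j x0 \<noteq> 0" using nonpos[OF y that] by auto
      have "exp (l0 j + Ln (b j y / b j x0)) = b j y"
        by (subst exp_add, subst exp_Ln[OF ne]) (simp add: l0(1)[OF that] b0[OF that])
      then show ?thesis using l(1)[OF that] exp_eq[of "l j" "l0 j + Ln (b j y / b j x0)"] by metis
    qed
    then obtain k :: "nat \<Rightarrow> int" where
      k: "\<And>j. j \<in> J \<Longrightarrow> l j = l0 j + Ln (b j y / b j x0) + (of_int (2 * k j) * pi) * \<i>" by metis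
    have "f y = exp ((\<Sum>j\<in>J. \<rho> j * l0 j) + (\<Sum>j\<in>J. \<rho> j * Ln (b j y / b j x0))
               + (\<Sum>j\<in>J. \<rho> j * (of_int (2 * k j) * pi * \<i>)))"
      unfolding l(2) sum.distrib[symmetric]
      by (intro arg_cong[where f = exp] sum.cong refl) (simp add: k algebra_simps)
    then have "f y = f x0 * E y * exp (\<Sum>j\<in>J. \<rho> j * (of_int (2 * k j) * pi * \<i>))"
      unfolding l0(2) E_def exp_add by simp
    then have "h y = exp (\<Sum>j\<in>J. \<rho> j * (of_int (2 * k j) * pi * \<i>))"
      unfolding h_def using l0(2) by (simp add: E_def)
    also have "\<dots> = exp (\<Sum>j\<in>J. \<rho> j * (of_int (2 * restrict k J j) * pi * \<i>))"
      by (intro arg_cong[where f = exp] sum.cong refl) simp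
    finally show ?thesis unfolding G_def by (intro image_eqI[where x = "restrict k J"]) auto
  qed
  ultimately have "countable (h ` X)" by (meson countable_subset image_subsetI)
  moreover have "connected (h ` X)"
    using connected_continuous_image[OF cont X(1)] .
  ultimately have "h x = h x0"
    using connected_uncountable[of "h ` X" "h x" "h x0"] x X(2) by blast
  also have "h x0 = 1" using b0 l0(2) by (simp add: h_def E_def)
  finally show ?thesis
    using l0(2) by (simp add: h_def E_def divide_eq_1_iff)
qed

text \<open>
  The coefficients of the Pearson equation \<open>W w' = V w\<close>.
\<close>

definition pearson_W :: "nat \<Rightarrow> (nat \<Rightarrow> complex) \<Rightarrow> complex poly" where
  "pearson_W m a = (\<Prod>j=1..m. [:- a j, 1:])"

definition pearson_V :: "nat \<Rightarrow> (nat \<Rightarrow> complex) \<Rightarrow> (nat \<Rightarrow> complex) \<Rightarrow> complex poly" where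
  "pearson_V m a \<rho> = (\<Sum>j=1..m. smult (\<rho> j) (\<Prod>i\<in>{1..m}-{j}. [:- a i, 1:]))"

locale semiclassical_weight =
  fixes m :: nat and a :: "nat \<Rightarrow> complex" and \<rho> :: "nat \<Rightarrow> complex"
    and D :: "complex set" and w :: "complex \<Rightarrow> complex"
  assumes m_ge_2: "m \<ge> 2"
    and origin: "a 1 = 0"
    and inj: "inj_on a {1..m}"
    and exponents: "\<And>j. j \<in> {1..m} \<Longrightarrow> \<rho> j \<noteq> 0"
    and D_open: "open D" and D_dense: "closure D = UNIV"
    and cuts_on_circle: "sphere 0 1 - {-1} - a ` {1..m} \<subseteq> D"
    and branch: "is_branch m a \<rho> D w"
    and periodic: "\<exists>L. ((\<lambda>\<theta>. w (cis \<theta>)) \<longlongrightarrow> L) (at_left pi) \<and> ((\<lambda>\<theta>. w (cis \<theta>)) \<longlongrightarrow> L) (at_right (-pi))"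
    and w_integrable: "circle_integrable w"
    and w'_integrable: "circle_integrable (deriv w)"
begin

abbreviation "Wp \<equiv> pearson_W m a"
abbreviation "Vp \<equiv> pearson_V m a \<rho>"

definition logderiv :: "complex \<Rightarrow> complex" where
  "logderiv x = (\<Sum>j=1..m. \<rho> j / (x - a j))"

lemma poly_Wp: "poly Wp x = (\<Prod>j=1..m. x - a j)"
  by (simp add: pearson_W_def poly_prod)

lemma degree_Wp: "degree Wp = m"
  unfolding pearson_W_def by (subst degree_prod_eq_sum_degree) auto

lemma coeff_Wp_m: "coeff Wp m = 1"
proof -
  have "lead_coeff Wp = 1" unfolding pearson_W_def by (simp add: lead_coeff_prod)
  then show ?thesis by (simp add: degree_Wp)
qed

lemma degree_linear_prod:
  "finite J \<Longrightarrow> degree (\<Prod>i\<in>J. [:- a i, 1:]) = card J"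
  by (subst degree_prod_eq_sum_degree) auto

lemma degree_Vp: "degree Vp \<le> m - 1"
  unfolding pearson_V_def
  by (intro degree_sum_le order.trans[OF degree_smult_le]) (auto simp: degree_linear_prod)

lemma coeff_Vp: "coeff Vp (m - 1) = (\<Sum>j=1..m. \<rho> j)"
  unfolding pearson_V_def coeff_sum
proof (rule sum.cong)
  fix j assume j: "j \<in> {1..m}"
  have "lead_coeff (\<Prod>i\<in>{1..m}-{j}. [:- a i, 1:]) = 1" by (simp add: lead_coeff_prod)
  moreover have "degree (\<Prod>i\<in>{1..m}-{j}. [:- a i, 1:]) = m - 1"
    using j by (subst degree_linear_prod) auto
  ultimately show "coeff (smult (\<rho> j) (\<Prod>i\<in>{1..m}-{j}. [:- a i, 1:])) (m - 1) = \<rho> j" by simp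
qed simp

lemma one_mem: "1 \<in> {1..m}" using m_ge_2 by simp

lemma nonzero_point: "j \<in> {1..m} \<Longrightarrow> j \<noteq> 1 \<Longrightarrow> a j \<noteq> 0"
  using inj_onD[OF inj, of j 1] one_mem origin by auto

lemma coeff_Wp_0: "coeff Wp 0 = 0"
proof -
  have "poly Wp 0 = (\<Prod>j=1..m. 0 - a j)"
    unfolding pearson_W_def by (simp add: poly_prod)
  also have "\<dots> = 0" using one_mem origin by (intro prod_zero) auto
  finally show ?thesis by (simp add: poly_0_coeff_0)
qed

lemma coeff_Wp_1: "coeff Wp 1 = (\<Prod>i\<in>{1..m}-{1}. - a i)"
proof -
  have "Wp = [:0, 1:] * (\<Prod>i\<in>{1..m}-{1}. [:- a i, 1:])"
    unfolding pearson_W_def using one_mem origin by (subst prod.remove[of _ 1]) auto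
  then have "coeff Wp 1 = poly (\<Prod>i\<in>{1..m}-{1}. [:- a i, 1:]) 0"
    by (simp add: poly_0_coeff_0)
  then show ?thesis by (simp add: poly_prod)
qed

lemma coeff_Wp_1_nonzero: "coeff Wp 1 \<noteq> 0"
  unfolding coeff_Wp_1 prod_zero_iff[OF finite_Diff[OF finite_atLeastAtMost]] using nonzero_point by auto

lemma coeff_Vp_0: "coeff Vp 0 = \<rho> 1 * coeff Wp 1"
proof -
  have "coeff Vp 0 = (\<Sum>j=1..m. \<rho> j * (\<Prod>i\<in>{1..m}-{j}. - a i))"
    by (simp add: poly_0_coeff_0[symmetric] pearson_V_def poly_sum poly_prod)
  also have "\<dots> = (\<Sum>j\<in>{1}. \<rho> j * (\<Prod>i\<in>{1..m}-{j}. - a i))"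
  proof (rule sum.mono_neutral_right)
    show "\<forall>j\<in>{1..m} - {1}. \<rho> j * (\<Prod>i\<in>{1..m}-{j}. - a i) = 0"
    proof
      fix j assume "j \<in> {1..m} - {1}"
      then have "(\<Prod>i\<in>{1..m}-{j}. - a i) = 0"
        using one_mem origin by (intro prod_zero) auto
      then show "\<rho> j * (\<Prod>i\<in>{1..m}-{j}. - a i) = 0" by simp
    qed
  qed (use one_mem in auto)
  finally show ?thesis unfolding coeff_Wp_1 by simp
qed

lemma poly_Wp_eq_0_iff: "poly Wp x = 0 \<longleftrightarrow> x \<in> a ` {1..m}"
  by (auto simp: poly_Wp)

lemma Wp_mult_logderiv:
  assumes "x \<notin> a ` {1..m}"
  shows "poly Wp x * logderiv x = poly Vp x"
  unfolding logderiv_def pearson_V_def poly_sum sum_distrib_left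
proof (rule sum.cong)
  fix j assume j: "j \<in> {1..m}"
  have "poly Wp x = (x - a j) * (\<Prod>i\<in>{1..m}-{j}. x - a i)"
    unfolding poly_Wp using j by (subst prod.remove[of _ j]) auto
  then show "poly Wp x * (\<rho> j / (x - a j)) = poly (smult (\<rho> j) (\<Prod>i\<in>{1..m}-{j}. [:- a i, 1:])) x"
    using assms j by (auto simp: poly_prod)
qed simp

lemma D_avoids_points: "x \<in> D \<Longrightarrow> x \<notin> a ` {1..m}"
proof
  assume x: "x \<in> D" and "x \<in> a ` {1..m}"
  then obtain j where j: "j \<in> {1..m}" "x = a j" by blast
  obtain l :: "nat \<Rightarrow> complex" where "\<forall>j\<in>{1..m}. exp (l j) = x - a j"
    using branch x unfolding is_branch_def by blast
  then have "exp (l j) = x - a j" using j(1) by blast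
  then show False using j(2) by simp
qed

lemma w_nonzero: "x \<in> D \<Longrightarrow> w x \<noteq> 0"
  using branch unfolding is_branch_def by (metis exp_not_eq_zero)

lemma w_has_field_derivative:
  assumes x: "x \<in> D"
  shows "(w has_field_derivative logderiv x * w x) (at x)"
proof -
  have xa: "x - a j \<noteq> 0" if "j \<in> {1..m}" for j
    using D_avoids_points[OF x] that by auto
  have "open (D \<inter> (\<Inter>j\<in>{1..m}. {y. Re ((y - a j) / (x - a j)) > 0}))"
    using xa by (intro open_Int D_open open_INT ballI open_Collect_less continuous_intros) auto
  moreover have "x \<in> D \<inter> (\<Inter>j\<in>{1..m}. {y. Re ((y - a j) / (x - a j)) > 0})"
    using x xa by auto
  ultimately obtain r where r: "r > 0" and
    rs: "ball x r \<subseteq> D \<inter> (\<Inter>j\<in>{1..m}. {y. Re ((y - a j) / (x - a j)) > 0})"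
    by (meson openE)
  have eq: "w y = w x * exp (\<Sum>j=1..m. \<rho> j * Ln ((y - a j) / (x - a j)))" if "y \<in> ball x r" for y
  proof (rule branch_continuation[where X = "ball x r"])
    show "continuous_on (ball x r) w"
      using branch rs unfolding is_branch_def
      by (meson continuous_on_subset holomorphic_on_imp_continuous_on Int_subset_iff)
    show "\<exists>l. (\<forall>j\<in>{1..m}. exp (l j) = y - a j) \<and> w y = exp (\<Sum>j=1..m. \<rho> j * l j)" if "y \<in> ball x r" for y
      using branch rs that unfolding is_branch_def by blast
    show "Re ((y - a j) / (x - a j)) > 0" if "y \<in> ball x r" "j \<in> {1..m}" for y j
      using rs that by blast
  qed (use r that in \<open>auto intro!: continuous_intros\<close>)
  have "((\<lambda>y. w x * exp (\<Sum>j=1..m. \<rho> j * Ln ((y - a j) / (x - a j)))) has_field_derivative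
          w x * (exp (\<Sum>j=1..m. \<rho> j * Ln ((x - a j) / (x - a j))) * (\<Sum>j=1..m. \<rho> j * (1 / (x - a j))))) (at x)"
  proof (intro DERIV_cmult DERIV_chain2[OF DERIV_exp] DERIV_sum)
    fix j assume "j \<in> {1..m}"
    then have "(x - a j) / (x - a j) = 1" using xa by simp
    then show "((\<lambda>y. Ln ((y - a j) / (x - a j))) has_field_derivative 1 / (x - a j)) (at x)"
      using xa[OF \<open>j \<in> {1..m}\<close>] by (auto intro!: derivative_eq_intros)
  qed
  moreover have "(\<Sum>j=1..m. \<rho> j * Ln ((x - a j) / (x - a j))) = 0"
    using xa by (intro sum.neutral ballI) simp
  then have "exp (\<Sum>j=1..m. \<rho> j * Ln ((x - a j) / (x - a j))) = 1" by simp
  ultimately have "((\<lambda>y. w x * exp (\<Sum>j=1..m. \<rho> j * Ln ((y - a j) / (x - a j)))) has_field_derivative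
     logderiv x * w x) (at x)"
    by (simp add: logderiv_def mult.commute)
  moreover have "\<forall>\<^sub>F y in nhds x. w x * exp (\<Sum>j=1..m. \<rho> j * Ln ((y - a j) / (x - a j))) = w y"
    by (rule eventually_mono[OF eventually_nhds_in_open[OF open_ball, of x x r]])
      (use r eq[symmetric] in auto)
  ultimately show ?thesis
    by (subst (asm) DERIV_cong_ev[OF refl _ refl]) auto
qed

lemma deriv_w: "x \<in> D \<Longrightarrow> deriv w x = logderiv x * w x"
  using w_has_field_derivative by (rule DERIV_imp_deriv)

lemma circle_mem_D:
  assumes "\<theta> \<in> {-pi<..<pi}" "cis \<theta> \<notin> a ` {1..m}"
  shows "cis \<theta> \<in> D"
proof -
  have "cis \<theta> \<noteq> -1"
  proof
    assume "cis \<theta> = -1"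
    then have "cos \<bar>\<theta>\<bar> = -1" by (metis cos_abs_real cis.sel(1) one_complex.sel(1) uminus_complex.sel(1))
    moreover have "cos \<bar>\<theta>\<bar> > cos pi" using assms(1) by (intro cos_monotone_0_pi) auto
    ultimately show False by simp
  qed
  then show ?thesis using cuts_on_circle assms(2) by auto
qed

abbreviation "circle_angles \<equiv> {\<theta>\<in>{-pi<..pi}. cis \<theta> \<in> a ` {1..m}}"

lemma finite_circle_angles: "finite circle_angles"
  using finite_cis_preimage[of "a ` {1..m}"] by simp

lemma w_circle_has_vector_derivative:
  assumes "\<theta> \<in> {-pi<..<pi} - circle_angles"
  shows "((\<lambda>\<theta>. w (cis \<theta>)) has_vector_derivative (\<i> * cis \<theta>) * deriv w (cis \<theta>)) (at \<theta>)"
proof -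
  have "cis \<theta> \<in> D" using assms by (intro circle_mem_D) auto
  from w_has_field_derivative[OF this] deriv_w[OF this]
  have "(w has_field_derivative deriv w (cis \<theta>)) (at (cis \<theta>))" by simp
  moreover have "(cis has_vector_derivative (\<i> * cis \<theta>)) (at \<theta>)"
    by (rule cis_has_vector_derivative)
  ultimately have "(w \<circ> cis has_vector_derivative (\<i> * cis \<theta>) * deriv w (cis \<theta>)) (at \<theta>)"
    by (rule field_vector_diff_chain_at[rotated])
  then show ?thesis by (simp add: comp_def)
qed

text \<open>
  Integrability of \<open>w'\<close> controls the variation of \<open>w\<close> on an arc without singular points.
\<close>

lemma w_circle_increment:
  assumes cd: "c \<le> d" "-pi < c" "d < pi" and avoid: "{c..d} \<inter> circle_angles = {}"
  shows "cmod (w (cis d) - w (cis c)) \<le> circle_norm (deriv w)"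
proof -
  have int: "set_integrable lborel {-pi<..pi} (\<lambda>\<theta>. (\<i> * cis \<theta>) * deriv w (cis \<theta>))"
  proof -
    have "circle_integrable (\<lambda>\<zeta>. \<i> * \<zeta> * deriv w \<zeta>)"
      by (intro circle_integrable_continuous_mult w'_integrable continuous_intros)
    then show ?thesis by (simp add: circle_integrable_def)
  qed
  have sub: "{c..d} \<subseteq> {-pi<..pi}" using cd by auto
  have int': "set_integrable lborel {c..d} (\<lambda>\<theta>. (\<i> * cis \<theta>) * deriv w (cis \<theta>))"
    by (rule set_integrable_subset[OF int _ sub]) simp
  have "((\<lambda>\<theta>. (\<i> * cis \<theta>) * deriv w (cis \<theta>)) has_integral (w (cis d) - w (cis c))) {c..d}"
  proof (rule fundamental_theorem_of_calculus)
    fix \<theta> assume "\<theta> \<in> {c..d}"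
    then have "\<theta> \<in> {-pi<..<pi} - circle_angles" using cd avoid by auto
    then show "((\<lambda>\<theta>. w (cis \<theta>)) has_vector_derivative (\<i> * cis \<theta>) * deriv w (cis \<theta>)) (at \<theta> within {c..d})"
      by (rule has_vector_derivative_at_within[OF w_circle_has_vector_derivative])
  qed (use cd in simp)
  then have "w (cis d) - w (cis c) = (LINT \<theta>:{c..d}|lborel. (\<i> * cis \<theta>) * deriv w (cis \<theta>))"
    using set_borel_integral_eq_integral(2)[OF int'] by (simp add: integral_unique)
  also have "cmod \<dots> \<le> (LINT \<theta>:{c..d}|lborel. cmod ((\<i> * cis \<theta>) * deriv w (cis \<theta>)))"
    by (rule set_integral_norm_bound[OF int'])
  also have "\<dots> = (LINT \<theta>:{c..d}|lborel. cmod (deriv w (cis \<theta>)))"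
    by (simp add: norm_mult)
  also have "\<dots> \<le> (LINT \<theta>:{-pi<..pi}|lborel. cmod (deriv w (cis \<theta>)))"
    unfolding set_lebesgue_integral_def
  proof (rule integral_mono_AE)
    have i: "set_integrable lborel {-pi<..pi} (\<lambda>\<theta>. cmod (deriv w (cis \<theta>)))"
      using w'_integrable unfolding circle_integrable_def by (rule set_integrable_norm)
    then show "integrable lborel (\<lambda>\<theta>. indicat_real {-pi<..pi} \<theta> *\<^sub>R cmod (deriv w (cis \<theta>)))"
      unfolding set_integrable_def .
    show "integrable lborel (\<lambda>\<theta>. indicat_real {c..d} \<theta> *\<^sub>R cmod (deriv w (cis \<theta>)))"
      using set_integrable_subset[OF i _ sub] unfolding set_integrable_def by simp
    show "AE \<theta> in lborel. indicat_real {c..d} \<theta> *\<^sub>R cmod (deriv w (cis \<theta>))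
        \<le> indicat_real {-pi<..pi} \<theta> *\<^sub>R cmod (deriv w (cis \<theta>))"
      using sub by (intro AE_I2) (auto simp: indicator_def)
  qed
  finally show ?thesis by (simp add: circle_norm_def)
qed

text \<open>
  On both sides of a singular point the increments of \<open>w\<close> are bounded by the integral of \<open>w'\<close>.
\<close>

lemma w_circle_locally_bounded:
  assumes \<theta>0: "\<theta>0 \<in> {-pi<..<pi}"
  obtains B where "\<forall>\<^sub>F \<theta> in at \<theta>0. cmod (w (cis \<theta>)) \<le> B"
proof -
  have "open ({-pi<..<pi} - (circle_angles - {\<theta>0}))"
    using finite_circle_angles by (intro open_Diff finite_imp_closed) auto
  moreover have "\<theta>0 \<in> {-pi<..<pi} - (circle_angles - {\<theta>0})" using \<theta>0 by auto
  ultimately obtain e where e: "e > 0" "cball \<theta>0 e \<subseteq> {-pi<..<pi} - (circle_angles - {\<theta>0})"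
    by (meson open_contains_cball)
  define B where "B = max (cmod (w (cis (\<theta>0 - e)))) (cmod (w (cis (\<theta>0 + e)))) + circle_norm (deriv w)"
  have mem: "\<theta> \<in> {-pi<..<pi} - (circle_angles - {\<theta>0})" if "\<bar>\<theta> - \<theta>0\<bar> \<le> e" for \<theta>
    using e(2) that by (auto simp: cball_def dist_real_def abs_minus_commute subset_iff)
  have "cmod (w (cis \<theta>)) \<le> B" if "\<bar>\<theta> - \<theta>0\<bar> < e" "\<theta> \<noteq> \<theta>0" for \<theta>
  proof (cases "\<theta> < \<theta>0")
    case True
    have "cmod (w (cis \<theta>) - w (cis (\<theta>0 - e))) \<le> circle_norm (deriv w)"
    proof (rule w_circle_increment)
      show "{\<theta>0 - e..\<theta>} \<inter> circle_angles = {}"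
      proof (rule equals0I)
        fix \<tau> assume \<tau>: "\<tau> \<in> {\<theta>0 - e..\<theta>} \<inter> circle_angles"
        then have "\<bar>\<tau> - \<theta>0\<bar> \<le> e" "\<tau> \<noteq> \<theta>0" using True by auto
        then show False using mem[of \<tau>] \<tau> by blast
      qed
      show "- pi < \<theta>0 - e" using mem[of "\<theta>0 - e"] e(1) by auto
      show "\<theta> < pi" using mem[of \<theta>] that by auto
      show "\<theta>0 - e \<le> \<theta>" using that True by linarith
    qed
    then have "cmod (w (cis \<theta>)) \<le> cmod (w (cis (\<theta>0 - e))) + circle_norm (deriv w)"
      using norm_triangle_sub[of "w (cis \<theta>)" "w (cis (\<theta>0 - e))"] by linarith
    then show ?thesis unfolding B_def by linarith
  next
    case False
    have "cmod (w (cis (\<theta>0 + e)) - w (cis \<theta>)) \<le> circle_norm (deriv w)"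
    proof (rule w_circle_increment)
      show "{\<theta>..\<theta>0 + e} \<inter> circle_angles = {}"
      proof (rule equals0I)
        fix \<tau> assume \<tau>: "\<tau> \<in> {\<theta>..\<theta>0 + e} \<inter> circle_angles"
        then have "\<bar>\<tau> - \<theta>0\<bar> \<le> e" "\<tau> \<noteq> \<theta>0" using False that by auto
        then show False using mem[of \<tau>] \<tau> by blast
      qed
      show "\<theta>0 + e < pi" using mem[of "\<theta>0 + e"] e(1) by auto
      show "- pi < \<theta>" using mem[of \<theta>] that by auto
      show "\<theta> \<le> \<theta>0 + e" using that False by linarith
    qed
    then have "cmod (w (cis \<theta>)) \<le> cmod (w (cis (\<theta>0 + e))) + circle_norm (deriv w)"
      using norm_triangle_sub[of "w (cis \<theta>)" "w (cis (\<theta>0 + e))"] by (simp add: norm_minus_commute)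
    then show ?thesis unfolding B_def by linarith
  qed
  then have "\<forall>\<^sub>F \<theta> in at \<theta>0. cmod (w (cis \<theta>)) \<le> B"
    unfolding eventually_at using e(1) by (auto simp: dist_real_def)
  then show ?thesis using that by blast
qed

text \<open>
  Since \<open>w\<close> is bounded at the singular points and \<open>W\<close> vanishes there, \<open>g W w\<close> is continuous along
  the whole circle, and its end values agree at \<open>-1\<close> by periodicity.  Its derivative is the integrand
  because \<open>W w' = V w\<close>.
\<close>

lemma circle_integration_by_parts:
  assumes g: "\<And>\<zeta>. \<zeta> \<in> sphere 0 1 \<Longrightarrow> (g has_field_derivative g' \<zeta>) (at \<zeta>)"
    and g'c: "continuous_on (sphere 0 1) g'"
  shows "circle_mean (\<lambda>\<zeta>. \<zeta> * (g' \<zeta> * poly Wp \<zeta> + g \<zeta> * poly (pderiv Wp + Vp) \<zeta>) * w \<zeta>) = 0"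
proof -
  define H where "H = (\<lambda>\<zeta>. \<zeta> * (g' \<zeta> * poly Wp \<zeta> + g \<zeta> * poly (pderiv Wp + Vp) \<zeta>) * w \<zeta>)"
  obtain L where L: "((\<lambda>\<theta>. w (cis \<theta>)) \<longlongrightarrow> L) (at_left pi)" "((\<lambda>\<theta>. w (cis \<theta>)) \<longlongrightarrow> L) (at_right (-pi))"
    using periodic by blast
  define p where "p = (\<lambda>\<theta>. g (cis \<theta>) * poly Wp (cis \<theta>))"
  define G where "G = (\<lambda>\<theta>. if \<theta> \<in> {-pi<..<pi} then p \<theta> * w (cis \<theta>) else g (-1) * poly Wp (-1) * L)"
  have gc: "continuous_on (sphere 0 1) g"
    using g by (meson DERIV_isCont continuous_at_imp_continuous_on)
  have cisc: "continuous_on UNIV cis" by (auto intro!: continuous_intros simp: cis_conv_exp[abs_def])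
  have pc: "continuous_on UNIV p"
    unfolding p_def by (intro continuous_intros continuous_on_compose2[OF gc cisc] cisc) auto
  have cm: "cis (-pi) = -1" by (rule complex_eqI) auto
  have pp: "p pi = g (-1) * poly Wp (-1)" "p (-pi) = g (-1) * poly Wp (-1)"
    by (simp_all add: p_def cm)
  have pl: "(p \<longlongrightarrow> p \<theta>) (at \<theta>)" for \<theta>
    using pc by (simp add: continuous_on_eq_continuous_at isCont_def)
  have "circle_integrable H"
    unfolding H_def
    by (intro circle_integrable_continuous_mult w_integrable continuous_intros gc g'c)
  then have int: "set_integrable lborel {-pi<..pi} (\<lambda>\<theta>. H (cis \<theta>))"
    by (simp add: circle_integrable_def)
  have deriv: "(G has_vector_derivative \<i> * H (cis \<theta>)) (at \<theta>)" if \<theta>: "\<theta> \<in> {-pi<..<pi} - circle_angles" for \<theta>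
  proof -
    have D: "cis \<theta> \<in> D" using \<theta> by (intro circle_mem_D) auto
    have "((\<lambda>x. g x * poly Wp x * w x) has_field_derivative
        (g' (cis \<theta>) * poly Wp (cis \<theta>) + g (cis \<theta>) * poly (pderiv Wp) (cis \<theta>)) * w (cis \<theta>)
          + g (cis \<theta>) * poly Wp (cis \<theta>) * (logderiv (cis \<theta>) * w (cis \<theta>))) (at (cis \<theta>))"
      by (rule derivative_eq_intros g w_has_field_derivative D poly_DERIV refl | simp)+
    moreover have "poly Wp (cis \<theta>) * logderiv (cis \<theta>) = poly Vp (cis \<theta>)"
      using D_avoids_points[OF D] by (rule Wp_mult_logderiv)
    then have "(g' (cis \<theta>) * poly Wp (cis \<theta>) + g (cis \<theta>) * poly (pderiv Wp) (cis \<theta>)) * w (cis \<theta>)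
          + g (cis \<theta>) * ((poly Wp (cis \<theta>) * logderiv (cis \<theta>)) * w (cis \<theta>))
        = (g' (cis \<theta>) * poly Wp (cis \<theta>) + g (cis \<theta>) * poly (pderiv Wp + Vp) (cis \<theta>)) * w (cis \<theta>)"
      unfolding poly_add by (simp only: ring_distribs mult.assoc add.assoc)
    ultimately have "((\<lambda>x. g x * poly Wp x * w x) has_field_derivative
       (g' (cis \<theta>) * poly Wp (cis \<theta>) + g (cis \<theta>) * poly (pderiv Wp + Vp) (cis \<theta>)) * w (cis \<theta>)) (at (cis \<theta>))"
      by (simp only: mult.assoc)
    moreover have "(cis has_vector_derivative (\<i> * cis \<theta>)) (at \<theta>)"
      by (rule cis_has_vector_derivative)
    ultimately have "((\<lambda>x. g x * poly Wp x * w x) \<circ> cis has_vector_derivative \<i> * cis \<theta> *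
       ((g' (cis \<theta>) * poly Wp (cis \<theta>) + g (cis \<theta>) * poly (pderiv Wp + Vp) (cis \<theta>)) * w (cis \<theta>))) (at \<theta>)"
      by (rule field_vector_diff_chain_at[rotated])
    then have "((\<lambda>\<theta>. p \<theta> * w (cis \<theta>)) has_vector_derivative \<i> * H (cis \<theta>)) (at \<theta>)"
      by (simp add: comp_def p_def H_def mult.assoc)
    then show ?thesis
      by (rule has_vector_derivative_transform_within_open[where S = "{-pi<..<pi}"]) (use \<theta> in \<open>auto simp: G_def\<close>)
  qed
  have cont: "continuous_on {-pi..pi} G"
  proof (rule continuous_on_IccI)
    have ev: "\<forall>\<^sub>F \<theta> in at_right (-pi). p \<theta> * w (cis \<theta>) = G \<theta>"
      using eventually_at_right_real[of "-pi" pi] pi_gt_zero by (auto elim!: eventually_mono simp: G_def)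
    have "((\<lambda>\<theta>. p \<theta> * w (cis \<theta>)) \<longlongrightarrow> p (-pi) * L) (at_right (-pi))"
      by (intro tendsto_intros L filterlim_mono[OF pl order_refl at_le]) auto
    then show "(G \<longlongrightarrow> G (-pi)) (at_right (-pi))"
      using tendsto_cong[OF ev] by (simp add: G_def pp)
    have ev: "\<forall>\<^sub>F \<theta> in at_left pi. p \<theta> * w (cis \<theta>) = G \<theta>"
      using eventually_at_left_real[of "-pi" pi] pi_gt_zero by (auto elim!: eventually_mono simp: G_def)
    have "((\<lambda>\<theta>. p \<theta> * w (cis \<theta>)) \<longlongrightarrow> p pi * L) (at_left pi)"
      by (intro tendsto_intros L filterlim_mono[OF pl order_refl at_le]) auto
    then show "(G \<longlongrightarrow> G pi) (at_left pi)"
      using tendsto_cong[OF ev] by (simp add: G_def pp)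
    fix \<theta> :: real assume \<theta>: "-pi < \<theta>" "\<theta> < pi"
    show "G \<midarrow>\<theta>\<rightarrow> G \<theta>"
    proof (cases "\<theta> \<in> circle_angles")
      case False
      then have "(G has_vector_derivative \<i> * H (cis \<theta>)) (at \<theta>)" using deriv[of \<theta>] \<theta> by simp
      then have "isCont G \<theta>" by (rule has_vector_derivative_continuous)
      then show ?thesis by (simp add: isCont_def)
    next
      case True
      obtain B where B: "\<forall>\<^sub>F \<theta>' in at \<theta>. cmod (w (cis \<theta>')) \<le> B"
        using w_circle_locally_bounded[of \<theta>] \<theta> by auto
      have "poly Wp (cis \<theta>) = 0" using True by (auto simp: poly_Wp_eq_0_iff)
      then have p0: "p \<theta> = 0" by (simp add: p_def)
      have "((\<lambda>\<theta>. p \<theta> * w (cis \<theta>)) \<longlongrightarrow> 0) (at \<theta>)"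
      proof (rule Lim_null_comparison)
        show "\<forall>\<^sub>F \<theta>' in at \<theta>. cmod (p \<theta>' * w (cis \<theta>')) \<le> cmod (p \<theta>') * B"
          using B by eventually_elim (auto simp: norm_mult intro!: mult_left_mono)
        have "((\<lambda>\<theta>'. cmod (p \<theta>') * B) \<longlongrightarrow> cmod (p \<theta>) * B) (at \<theta>)"
          by (intro tendsto_intros pl)
        then show "((\<lambda>\<theta>'. cmod (p \<theta>') * B) \<longlongrightarrow> 0) (at \<theta>)" by (simp add: p0)
      qed
      moreover have "\<forall>\<^sub>F \<theta>' in at \<theta>. p \<theta>' * w (cis \<theta>') = G \<theta>'"
        using eventually_at_in_open'[of "{-pi<..<pi}" \<theta>] \<theta> by (auto elim!: eventually_mono simp: G_def)
      ultimately have "(G \<longlongrightarrow> 0) (at \<theta>)" by (simp add: tendsto_cong)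
      moreover have "G \<theta> = 0" using \<theta> p0 by (simp add: G_def)
      ultimately show ?thesis by simp
    qed
  qed (use pi_gt_zero in simp)
  have "((\<lambda>\<theta>. \<i> * H (cis \<theta>)) has_integral (G pi - G (-pi))) {-pi..pi}"
    by (rule fundamental_theorem_of_calculus_interior_strong[OF finite_circle_angles _ deriv cont]) auto
  then have hi: "((\<lambda>\<theta>. \<i> * H (cis \<theta>)) has_integral 0) {-pi..pi}" by (simp add: G_def)
  have n1: "negligible {x \<in> {-pi..pi} - {-pi<..pi}. \<i> * H (cis x) \<noteq> 0}"
    by (rule negligible_subset[of "{-pi}"]) auto
  have n2: "negligible {x \<in> {-pi<..pi} - {-pi..pi}. \<i> * H (cis x) \<noteq> 0}"
    by (rule negligible_subset[of "{}"]) auto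
  have "((\<lambda>\<theta>. \<i> * H (cis \<theta>)) has_integral 0) {-pi<..pi}"
    by (rule iffD1[OF has_integral_spike_set_eq[OF n1 n2] hi])
  moreover have "set_integrable lborel {-pi<..pi} (\<lambda>\<theta>. \<i> * H (cis \<theta>))"
    using int by simp
  ultimately have "(LINT \<theta>:{-pi<..pi}|lborel. \<i> * H (cis \<theta>)) = 0"
    using set_borel_integral_eq_integral(2) integral_unique by metis
  then have "circle_mean H = 0" by (simp add: circle_mean_def)
  then show ?thesis by (simp add: H_def)
qed

text \<open>
  Near \<open>a j\<close> the derivative \<open>w'\<close> behaves like \<open>\<rho> j w / (\<zeta> - a j)\<close>, so integrability of \<open>w'\<close> is
  integrability of this quotient.  Precisely, with \<open>G = W / (x - a j)\<close>, the difference of \<open>G w'\<close> and a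
  polynomial multiple of \<open>w\<close> is \<open>\<rho> j G(a j) w / (\<zeta> - a j)\<close>.
\<close>

lemma w_pole_integrable:
  assumes j: "j \<in> {1..m}"
  shows "circle_integrable (\<lambda>\<zeta>. w \<zeta> / (\<zeta> - a j))"
proof -
  define Gp where "Gp = (\<Prod>i\<in>{1..m}-{j}. [:- a i, 1:])"
  define g where "g = poly Gp (a j)"
  have W: "Wp = [:- a j, 1:] * Gp"
    unfolding pearson_W_def Gp_def using j by (subst prod.remove[of _ j]) auto
  have "a j - a i \<noteq> 0" if "i \<in> {1..m} - {j}" for i
    using inj_onD[OF inj, of j i] j that by auto
  then have "g \<noteq> 0"
    unfolding g_def Gp_def poly_prod by simp
  have "poly (Gp - [:g:]) (a j) = 0" by (simp add: g_def)
  then obtain K where K: "Gp - [:g:] = [:- a j, 1:] * K"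
    unfolding poly_eq_0_iff_dvd by blast
  then have K': "Gp = [:g:] + [:- a j, 1:] * K" by (simp add: algebra_simps)
  define R where "R = (\<lambda>\<zeta>. (poly Gp \<zeta> * deriv w \<zeta> - (poly (\<Sum>i\<in>{1..m}-{j}. smult (\<rho> i) (\<Prod>l\<in>{1..m}-{j}-{i}. [:- a l, 1:])) \<zeta> + \<rho> j * poly K \<zeta>) * w \<zeta>) :: complex)"
  have intR: "circle_integrable R"
    unfolding R_def
    by (intro circle_integrable_diff circle_integrable_continuous_mult w_integrable w'_integrable continuous_intros)
  have eq: "R x = \<rho> j * g * (w x / (x - a j))" if "x \<in> D" for x
  proof -
    have ne: "x - a i \<noteq> 0" if "i \<in> {1..m}" for i using D_avoids_points[OF \<open>x \<in> D\<close>] that by auto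
    have "poly Gp x * logderiv x = poly Gp x * (\<rho> j / (x - a j)) + (\<Sum>i\<in>{1..m}-{j}. poly Gp x * (\<rho> i / (x - a i)))"
      unfolding logderiv_def using j by (subst sum.remove[of _ j]) (auto simp: sum_distrib_left algebra_simps)
    also have "(\<Sum>i\<in>{1..m}-{j}. poly Gp x * (\<rho> i / (x - a i)))
       = poly (\<Sum>i\<in>{1..m}-{j}. smult (\<rho> i) (\<Prod>l\<in>{1..m}-{j}-{i}. [:- a l, 1:])) x"
      unfolding poly_sum
    proof (rule sum.cong)
      fix i assume i: "i \<in> {1..m} - {j}"
      have "poly Gp x = (x - a i) * poly (\<Prod>l\<in>{1..m}-{j}-{i}. [:- a l, 1:]) x"
        unfolding Gp_def using i by (subst prod.remove[of _ i]) (auto simp: algebra_simps)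
      then show "poly Gp x * (\<rho> i / (x - a i)) = poly (smult (\<rho> i) (\<Prod>l\<in>{1..m}-{j}-{i}. [:- a l, 1:])) x"
        using ne[of i] i by simp
    qed simp
    also have "poly Gp x * (\<rho> j / (x - a j)) = \<rho> j * g / (x - a j) + \<rho> j * poly K x"
      using ne[OF j] by (simp add: K' divide_simps) (simp add: algebra_simps)
    finally show ?thesis
      unfolding R_def deriv_w[OF that] by (simp add: algebra_simps)
  qed
  have rg: "\<rho> j * g \<noteq> 0" using exponents[OF j] \<open>g \<noteq> 0\<close> by simp
  have "set_integrable lborel {-pi<..pi} (\<lambda>\<theta>. (1 / (\<rho> j * g)) * R (cis \<theta>))"
    using intR unfolding circle_integrable_def by (rule set_integrable_mult_right)
  moreover have "set_integrable lborel {-pi<..pi} (\<lambda>\<theta>. (1 / (\<rho> j * g)) * R (cis \<theta>)) =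
     set_integrable lborel {-pi<..pi} (\<lambda>\<theta>. w (cis \<theta>) / (cis \<theta> - a j))"
    unfolding set_integrable_def
  proof (rule integrable_discrete_difference[where X = "insert pi circle_angles"])
    show "countable (insert pi circle_angles)"
      using finite_circle_angles by (intro countable_finite) auto
    fix \<theta> assume \<theta>: "\<theta> \<notin> insert pi circle_angles"
    show "indicat_real {-pi<..pi} \<theta> *\<^sub>R ((1 / (\<rho> j * g)) * R (cis \<theta>)) = indicat_real {-pi<..pi} \<theta> *\<^sub>R (w (cis \<theta>) / (cis \<theta> - a j))"
    proof (cases "\<theta> \<in> {-pi<..pi}")
      case True
      then have "cis \<theta> \<in> D" using \<theta> by (intro circle_mem_D) auto
      then show ?thesis using rg by (simp add: eq)
    qed simp
  qed (use finite_circle_angles in auto)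
  ultimately show ?thesis by (simp add: circle_integrable_def)
qed

end

section \<open>Cauchy transforms and moments of the weight\<close>

text \<open>
  With \<open>k = 1\<close> this is the Cauchy transform \<open>\<integral>u(\<zeta>) / (\<zeta> - x) d\<zeta> / (2 \<pi> \<i>)\<close>.
\<close>

definition cauchy_moment :: "(complex \<Rightarrow> complex) \<Rightarrow> int \<Rightarrow> complex \<Rightarrow> complex" where
  "cauchy_moment u k = cauchy_integral (\<lambda>\<zeta>. \<zeta> powi k * u \<zeta>)"

lemma sphere_nonzero: "\<zeta> \<in> sphere 0 1 \<Longrightarrow> (\<zeta>::complex) \<noteq> 0" by auto

lemma continuous_on_sphere_power_int: "continuous_on (sphere 0 1) (\<lambda>\<zeta>::complex. \<zeta> powi k)"
  by (intro continuous_intros) auto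

lemma circle_integrable_power_int:
  "circle_integrable u \<Longrightarrow> circle_integrable (\<lambda>\<zeta>. \<zeta> powi k * u \<zeta>)"
  by (intro circle_integrable_continuous_mult continuous_on_sphere_power_int)

lemma moment_le: "circle_integrable u \<Longrightarrow> cmod (moment u k) \<le> circle_norm u"
  unfolding moment_def
  using circle_mean_le_norm[of "\<lambda>\<zeta>. u \<zeta> * \<zeta> powi (-k)" u 1] circle_integrable_power_int[of u "-k"]
  by (simp add: norm_mult norm_power_int mult.commute)

lemma cauchy_moment_kernel_integrable:
  assumes "circle_integrable u" "x \<notin> sphere 0 1"
  shows "circle_integrable (\<lambda>\<zeta>. \<zeta> powi k * u \<zeta> / (\<zeta> - x))"
  using circle_integrable_cauchy_kernel[OF circle_integrable_power_int[OF assms(1)] assms(2), of k 1] by simp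

text \<open>
  Up to moments of \<open>u\<close>, one of the functions \<open>cauchy_moment u k\<close> determines all others.
\<close>

lemma cauchy_moment_add_one:
  assumes u: "circle_integrable u" and x: "x \<notin> sphere 0 1"
  shows "cauchy_moment u (k + 1) x = x * cauchy_moment u k x + moment u (-k)"
proof -
  have "cauchy_moment u (k + 1) x = circle_mean (\<lambda>\<zeta>. x * (\<zeta> powi k * u \<zeta> / (\<zeta> - x)) + u \<zeta> * \<zeta> powi k)"
    unfolding cauchy_moment_def cauchy_integral_def
  proof (rule circle_mean_cong)
    fix \<zeta> :: complex assume s: "\<zeta> \<in> sphere 0 1"
    then have "\<zeta> \<noteq> 0" "\<zeta> - x \<noteq> 0" using x by auto
    then show "\<zeta> powi (k + 1) * u \<zeta> / (\<zeta> - x) = x * (\<zeta> powi k * u \<zeta> / (\<zeta> - x)) + u \<zeta> * \<zeta> powi k"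
      by (simp add: power_int_add divide_simps) (simp add: algebra_simps)
  qed
  also have "\<dots> = x * cauchy_moment u k x + moment u (-k)"
    unfolding cauchy_moment_def cauchy_integral_def moment_def
    using cauchy_moment_kernel_integrable[OF u x, of k] circle_integrable_power_int[OF u, of k]
    by (subst circle_mean_add, (intro circle_integrable_cmult)?)
       (simp_all only: circle_mean_cmult mult.commute[of "u _"] minus_minus)
  finally show ?thesis .
qed

lemma cauchy_moment_has_field_derivative:
  assumes "circle_integrable u" "x \<notin> sphere 0 1"
  shows "(cauchy_moment u k has_field_derivative circle_mean (\<lambda>\<zeta>. \<zeta> powi k * u \<zeta> / (\<zeta> - x)\<^sup>2)) (at x)"
  unfolding cauchy_moment_def
  by (rule cauchy_integral_has_field_derivative[OF circle_integrable_power_int[OF assms(1)] assms(2)])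

lemma cauchy_moment_holomorphic:
  assumes "circle_integrable u"
  shows "cauchy_moment u k holomorphic_on - sphere 0 1"
  unfolding holomorphic_on_def field_differentiable_def
  using cauchy_moment_has_field_derivative[OF assms] has_field_derivative_at_within by blast

lemma cauchy_moment_le:
  assumes u: "circle_integrable u" and x: "x \<notin> sphere 0 1"
  shows "cmod (cauchy_moment u k x) \<le> circle_norm u / \<bar>cmod x - 1\<bar>"
proof -
  have "cmod (cauchy_moment u k x) \<le> (1 / \<bar>cmod x - 1\<bar>) * circle_norm u"
    unfolding cauchy_moment_def cauchy_integral_def
  proof (rule circle_mean_le_norm[OF cauchy_moment_kernel_integrable[OF u x] u])
    fix \<zeta> :: complex assume "\<zeta> \<in> sphere 0 1"
    then have z: "cmod \<zeta> = 1" by simp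
    have "\<bar>cmod x - 1\<bar> \<le> cmod (\<zeta> - x)"
      using norm_triangle_ineq3[of x \<zeta>] z by (simp add: norm_minus_commute)
    moreover have "\<bar>cmod x - 1\<bar> > 0" using x by auto
    ultimately have "cmod (u \<zeta>) / cmod (\<zeta> - x) \<le> cmod (u \<zeta>) / \<bar>cmod x - 1\<bar>"
      by (intro divide_left_mono) (auto intro!: mult_pos_pos)
    then show "cmod (\<zeta> powi k * u \<zeta> / (\<zeta> - x)) \<le> 1 / \<bar>cmod x - 1\<bar> * cmod (u \<zeta>)"
      using z by (simp add: norm_mult norm_divide norm_power_int)
  qed
  then show ?thesis by simp
qed

lemma cauchy_moment_expand_at_0:
  assumes u: "circle_integrable u" and x: "x \<notin> sphere 0 1"
  shows "cauchy_moment u k x = (\<Sum>l<N. x ^ l * moment u (int l + 1 - k)) + x ^ N * cauchy_moment u (k - int N) x"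
proof (induction N)
  case (Suc N)
  have "cauchy_moment u (k - int N) x = x * cauchy_moment u (k - int (Suc N)) x + moment u (int N + 1 - k)"
    using cauchy_moment_add_one[OF u x, of "k - int (Suc N)"] by (simp add: algebra_simps)
  then show ?case using Suc by (simp add: algebra_simps)
qed simp

lemma cauchy_moment_sums_at_0:
  assumes u: "circle_integrable u" and x: "cmod x < 1"
  shows "(\<lambda>l. x ^ l * moment u (int l + 1 - k)) sums cauchy_moment u k x"
proof -
  have x': "x \<notin> sphere 0 1" using x by auto
  have "(\<lambda>N. x ^ N * cauchy_moment u (k - int N) x) \<longlonglongrightarrow> 0"
  proof (rule Lim_null_comparison)
    show "\<forall>\<^sub>F N in sequentially. cmod (x ^ N * cauchy_moment u (k - int N) x) \<le> cmod x ^ N * (circle_norm u / \<bar>cmod x - 1\<bar>)"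
      using cauchy_moment_le[OF u x']
      by (intro always_eventually allI) (simp add: norm_mult norm_power mult_left_mono del: times_divide_eq_right)
    show "(\<lambda>N. cmod x ^ N * (circle_norm u / \<bar>cmod x - 1\<bar>)) \<longlonglongrightarrow> 0"
      using x by (intro tendsto_mult_left_zero LIMSEQ_power_zero) auto
  qed
  then have "(\<lambda>N. cauchy_moment u k x - x ^ N * cauchy_moment u (k - int N) x) \<longlonglongrightarrow> cauchy_moment u k x - 0"
    by (intro tendsto_intros)
  moreover have "cauchy_moment u k x - x ^ N * cauchy_moment u (k - int N) x = (\<Sum>l<N. x ^ l * moment u (int l + 1 - k))" for N
    using cauchy_moment_expand_at_0[OF u x', of k N] by simp
  ultimately show ?thesis by (simp add: sums_def)
qed

lemma cauchy_moment_expand_at_infinity: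
  assumes u: "circle_integrable u" and x: "x \<notin> sphere 0 1" "x \<noteq> 0"
  shows "cauchy_moment u k x = - (\<Sum>l<N. (1 / x) ^ Suc l * moment u (- k - int l)) + (1 / x) ^ N * cauchy_moment u (k + int N) x"
proof (induction N)
  case (Suc N)
  have "cauchy_moment u (k + int N + 1) x = x * cauchy_moment u (k + int N) x + moment u (- k - int N)"
    using cauchy_moment_add_one[OF u x(1), of "k + int N"] by (simp add: algebra_simps)
  then have "cauchy_moment u (k + int N) x = (1 / x) * (cauchy_moment u (k + int (Suc N)) x - moment u (- k - int N))"
    using x(2) by (simp add: field_simps)
  then have "(1 / x) ^ N * cauchy_moment u (k + int N) x
      = (1 / x) ^ Suc N * cauchy_moment u (k + int (Suc N)) x - (1 / x) ^ Suc N * moment u (- k - int N)"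
    by (simp only:) (simp add: algebra_simps)
  then show ?case unfolding Suc by simp
qed simp

lemma cauchy_moment_sums_at_infinity:
  assumes u: "circle_integrable u" and x: "cmod x > 1"
  shows "(\<lambda>l. - ((1 / x) ^ Suc l * moment u (- k - int l))) sums cauchy_moment u k x"
proof -
  have x': "x \<notin> sphere 0 1" "x \<noteq> 0" using x by auto
  have "(\<lambda>N. (1 / x) ^ N * cauchy_moment u (k + int N) x) \<longlonglongrightarrow> 0"
  proof (rule Lim_null_comparison)
    show "\<forall>\<^sub>F N in sequentially. cmod ((1 / x) ^ N * cauchy_moment u (k + int N) x) \<le> (1 / cmod x) ^ N * (circle_norm u / \<bar>cmod x - 1\<bar>)"
      using cauchy_moment_le[OF u x'(1)]
      by (intro always_eventually allI) (simp only: norm_mult norm_power norm_divide norm_one, intro mult_left_mono, auto)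
    show "(\<lambda>N. (1 / cmod x) ^ N * (circle_norm u / \<bar>cmod x - 1\<bar>)) \<longlonglongrightarrow> 0"
      using x by (intro tendsto_mult_left_zero LIMSEQ_power_zero) (auto simp: divide_simps)
  qed
  then have "(\<lambda>N. cauchy_moment u k x - (1 / x) ^ N * cauchy_moment u (k + int N) x) \<longlonglongrightarrow> cauchy_moment u k x - 0"
    by (intro tendsto_intros)
  moreover have "cauchy_moment u k x - (1 / x) ^ N * cauchy_moment u (k + int N) x
     = (\<Sum>l<N. - ((1 / x) ^ Suc l * moment u (- k - int l)))" for N
    using cauchy_moment_expand_at_infinity[OF u x', of k N] by (simp add: sum_negf)
  ultimately show ?thesis by (simp add: sums_def)
qed

text \<open>
  The polynomial part of \<open>cauchy_moment u (k + 1) x\<close>, by iteration of \<open>cauchy_moment_add_one\<close>.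
\<close>

fun moment_poly :: "(complex \<Rightarrow> complex) \<Rightarrow> nat \<Rightarrow> complex poly" where
  "moment_poly u 0 = 0"
| "moment_poly u (Suc k) = pCons (moment u (- int k - 1)) (moment_poly u k)"

lemma cauchy_moment_via_one:
  assumes u: "circle_integrable u" and x: "x \<notin> sphere 0 1"
  shows "cauchy_moment u (int k + 1) x = x ^ k * cauchy_moment u 1 x + poly (moment_poly u k) x"
proof (induction k)
  case (Suc k)
  have "cauchy_moment u (int (Suc k) + 1) x = x * cauchy_moment u (int k + 1) x + moment u (- int k - 1)"
    using cauchy_moment_add_one[OF u x, of "int k + 1"] by simp
  then show ?case using Suc by (simp add: algebra_simps)
qed simp

lemma poly_bounded_sum:
  fixes p :: "'a::comm_semiring_1 poly"
  assumes "degree p \<le> N"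
  shows "poly p x = (\<Sum>i\<le>N. coeff p i * x ^ i)"
  unfolding poly_altdef using assms
  by (intro sum.mono_neutral_left) (auto simp: coeff_eq_0)

lemma circle_mean_poly_mult:
  assumes u: "circle_integrable u" and p: "degree p \<le> N"
  shows "circle_mean (\<lambda>\<zeta>. poly p \<zeta> * u \<zeta>) = (\<Sum>i\<le>N. coeff p i * moment u (- int i))"
proof -
  have "circle_mean (\<lambda>\<zeta>. poly p \<zeta> * u \<zeta>) = circle_mean (\<lambda>\<zeta>. \<Sum>i\<le>N. coeff p i * (\<zeta> powi int i * u \<zeta>))"
    by (intro circle_mean_cong) (simp add: poly_bounded_sum[OF p] sum_distrib_right mult.assoc)
  also have "\<dots> = (\<Sum>i\<le>N. circle_mean (\<lambda>\<zeta>. coeff p i * (\<zeta> powi int i * u \<zeta>)))"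
    by (intro circle_mean_sum circle_integrable_cmult circle_integrable_power_int u)
  also have "\<dots> = (\<Sum>i\<le>N. coeff p i * moment u (- int i))"
    by (simp add: circle_mean_cmult moment_def mult.commute)
  finally show ?thesis .
qed

lemma moment_power_int: "moment (\<lambda>\<zeta>. \<zeta> powi k * u \<zeta>) l = moment u (l - k)"
proof -
  have "\<zeta> powi k * u \<zeta> * \<zeta> powi (- l) = u \<zeta> * \<zeta> powi (- (l - k))" if "\<zeta> \<in> sphere 0 1" for \<zeta>
    using sphere_nonzero[OF that] by (simp add: power_int_diff power_int_minus field_simps)
  then show ?thesis unfolding moment_def by (rule circle_mean_cong)
qed

text \<open>
  The inhomogeneity of the equation satisfied by the Cauchy transform of the weight.
\<close>

definition pearson_source :: "nat \<Rightarrow> (nat \<Rightarrow> complex) \<Rightarrow> (nat \<Rightarrow> complex) \<Rightarrow> (complex \<Rightarrow> complex) \<Rightarrow> complex poly" where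
  "pearson_source m a \<rho> w = (\<Sum>i\<le>m. smult (coeff (pderiv (pearson_W m a) + pearson_V m a \<rho>) i) (moment_poly w i)
     - smult (coeff (pearson_W m a) i) (pderiv (moment_poly w i)))"

context semiclassical_weight
begin

text \<open>
  Integration by parts against \<open>\<zeta> powi (- k)\<close>.
\<close>

lemma moment_recurrence:
  "(\<Sum>i\<le>m. ((of_nat i - of_int k) * coeff Wp i + coeff (pCons 0 Vp) i) * moment w (k - int i)) = 0"
proof -
  let ?p = "pCons 0 (pderiv Wp + Vp) - smult (of_int k) Wp"
  have deg: "degree ?p \<le> m"
  proof (intro degree_diff_le)
    have "degree (pderiv Wp + Vp) \<le> m - 1"
      using degree_Vp by (intro degree_add_le) (auto simp: degree_pderiv degree_Wp)
    then show "degree (pCons 0 (pderiv Wp + Vp)) \<le> m"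
      using m_ge_2 degree_pCons_le[of 0 "pderiv Wp + Vp"] by linarith
  qed (use degree_smult_le[of "of_int k" Wp] degree_Wp in simp)
  have "circle_mean (\<lambda>\<zeta>. \<zeta> * ((of_int (-k) * \<zeta> powi (-k - 1)) * poly Wp \<zeta> + \<zeta> powi (-k) * poly (pderiv Wp + Vp) \<zeta>) * w \<zeta>) = 0"
    by (rule circle_integration_by_parts) (auto intro!: derivative_eq_intros continuous_intros simp: norm_eq_zero[symmetric] simp del: norm_eq_zero)
  moreover have "circle_mean (\<lambda>\<zeta>. \<zeta> * ((of_int (-k) * \<zeta> powi (-k - 1)) * poly Wp \<zeta> + \<zeta> powi (-k) * poly (pderiv Wp + Vp) \<zeta>) * w \<zeta>)
     = circle_mean (\<lambda>\<zeta>. poly ?p \<zeta> * (\<zeta> powi (-k) * w \<zeta>))"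
  proof (rule circle_mean_cong)
    fix \<zeta> :: complex assume "\<zeta> \<in> sphere 0 1"
    then have z: "\<zeta> \<noteq> 0" by auto
    have "\<zeta> * \<zeta> powi (-k - 1) = \<zeta> powi (-k)" using z power_int_add_1'[of \<zeta> "-k - 1"] by simp
    moreover have "\<zeta> * ((of_int (-k) * A) * W + B * S) * v = (\<zeta> * S - of_int k * W) * (B * v)"
      if "\<zeta> * A = B" for A B W S v :: complex
      using that by (auto simp: algebra_simps)
    ultimately show "\<zeta> * ((of_int (-k) * \<zeta> powi (-k - 1)) * poly Wp \<zeta> + \<zeta> powi (-k) * poly (pderiv Wp + Vp) \<zeta>) * w \<zeta>
       = poly ?p \<zeta> * (\<zeta> powi (-k) * w \<zeta>)"
      by (simp only: poly_diff poly_smult poly_pCons) simp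
  qed
  ultimately have "circle_mean (\<lambda>\<zeta>. poly ?p \<zeta> * (\<zeta> powi (-k) * w \<zeta>)) = 0" by simp
  then have "(\<Sum>i\<le>m. coeff ?p i * moment (\<lambda>\<zeta>. \<zeta> powi (-k) * w \<zeta>) (- int i)) = 0"
    unfolding circle_mean_poly_mult[OF circle_integrable_power_int[OF w_integrable] deg] .
  moreover have "coeff ?p i = (of_nat i - of_int k) * coeff Wp i + coeff (pCons 0 Vp) i" for i
    by (cases i) (simp_all add: coeff_pderiv algebra_simps)
  moreover have "moment (\<lambda>\<zeta>. \<zeta> powi (-k) * w \<zeta>) (- int i) = moment w (k - int i)" for i
    unfolding moment_power_int by simp
  ultimately show ?thesis by (simp only:)
qed

abbreviation "ode_poly \<equiv> pearson_source m a \<rho> w"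

text \<open>
  Integration by parts against the kernel \<open>1 / (\<zeta> - x)\<close> gives a linear relation between the
  functions \<open>cauchy_moment w i\<close> and their derivatives; \<open>cauchy_moment_via_one\<close> and its
  derivative reduce it to \<open>i = 1\<close>.
\<close>

lemma cauchy_moment_ode:
  assumes x: "x \<notin> sphere 0 1"
  shows "\<exists>d. (cauchy_moment w 1 has_field_derivative d) (at x) \<and>
     poly Wp x * d = poly Vp x * cauchy_moment w 1 x + poly ode_poly x"
proof -
  let ?C = "cauchy_moment w 1"
  let ?q = "moment_poly w"
  let ?S = "pderiv Wp + Vp"
  define d where "d = (\<lambda>i::nat. circle_mean (\<lambda>\<zeta>. \<zeta> powi (int i + 1) * w \<zeta> / (\<zeta> - x)\<^sup>2))"
  have dC: "(cauchy_moment w (int i + 1) has_field_derivative d i) (at x)" for i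
    unfolding d_def by (rule cauchy_moment_has_field_derivative[OF w_integrable x])
  have d: "d i = of_nat i * x ^ (i - 1) * ?C x + x ^ i * d 0 + poly (pderiv (?q i)) x" for i
  proof -
    have C0: "(?C has_field_derivative d 0) (at x)" using dC[of 0] by simp
    have "((\<lambda>x. x ^ i * ?C x + poly (?q i) x) has_field_derivative
        of_nat i * x ^ (i - 1) * ?C x + x ^ i * d 0 + poly (pderiv (?q i)) x) (at x)"
      by (rule derivative_eq_intros C0 poly_DERIV refl | simp)+
    then have "(cauchy_moment w (int i + 1) has_field_derivative
        of_nat i * x ^ (i - 1) * ?C x + x ^ i * d 0 + poly (pderiv (?q i)) x) (at x)"
      by (rule has_field_derivative_transform_within_open[where S = "- sphere 0 1"])
         (use x cauchy_moment_via_one[OF w_integrable] in \<open>auto simp: open_Compl\<close>)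
    then show ?thesis using dC DERIV_unique by blast
  qed
  have degS: "degree ?S \<le> m"
    using degree_Vp m_ge_2 by (intro degree_add_le) (auto simp: degree_pderiv degree_Wp)
  have ne: "\<zeta> - x \<noteq> 0" if "\<zeta> \<in> sphere 0 1" for \<zeta> using x that by auto
  have i1: "circle_integrable (\<lambda>\<zeta>. \<zeta> powi (int i + 1) * w \<zeta> / (\<zeta> - x))" for i
    by (rule cauchy_moment_kernel_integrable[OF w_integrable x])
  have i2: "circle_integrable (\<lambda>\<zeta>. \<zeta> powi (int i + 1) * w \<zeta> / (\<zeta> - x)\<^sup>2)" for i
    by (rule circle_integrable_cauchy_kernel[OF circle_integrable_power_int[OF w_integrable] x])
  have "0 = circle_mean (\<lambda>\<zeta>. \<zeta> * (- 1 / (\<zeta> - x)\<^sup>2 * poly Wp \<zeta> + 1 / (\<zeta> - x) * poly ?S \<zeta>) * w \<zeta>)"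
    by (rule circle_integration_by_parts[symmetric])
      (use ne in \<open>auto intro!: derivative_eq_intros continuous_intros simp: power2_eq_square\<close>)
  also have "\<dots> = circle_mean (\<lambda>\<zeta>. (\<Sum>i\<le>m. coeff ?S i * (\<zeta> powi (int i + 1) * w \<zeta> / (\<zeta> - x)))
        - (\<Sum>i\<le>m. coeff Wp i * (\<zeta> powi (int i + 1) * w \<zeta> / (\<zeta> - x)\<^sup>2)))"
  proof (rule circle_mean_cong)
    fix \<zeta> :: complex assume s: "\<zeta> \<in> sphere 0 1"
    have 1: "(\<Sum>i\<le>m. coeff ?S i * (\<zeta> powi (int i + 1) * w \<zeta> / (\<zeta> - x))) = poly ?S \<zeta> * (\<zeta> * w \<zeta> / (\<zeta> - x))"
      unfolding poly_bounded_sum[OF degS] sum_distrib_right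
      by (intro sum.cong refl) (use sphere_nonzero[OF s] in \<open>simp add: power_int_add\<close>)
    have 2: "(\<Sum>i\<le>m. coeff Wp i * (\<zeta> powi (int i + 1) * w \<zeta> / (\<zeta> - x)\<^sup>2)) = poly Wp \<zeta> * (\<zeta> * w \<zeta> / (\<zeta> - x)\<^sup>2)"
      unfolding poly_bounded_sum[OF eq_refl[OF degree_Wp]] sum_distrib_right
      by (intro sum.cong refl) (use sphere_nonzero[OF s] in \<open>simp add: power_int_add\<close>)
    show "\<zeta> * (- 1 / (\<zeta> - x)\<^sup>2 * poly Wp \<zeta> + 1 / (\<zeta> - x) * poly ?S \<zeta>) * w \<zeta>
      = (\<Sum>i\<le>m. coeff ?S i * (\<zeta> powi (int i + 1) * w \<zeta> / (\<zeta> - x)))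
        - (\<Sum>i\<le>m. coeff Wp i * (\<zeta> powi (int i + 1) * w \<zeta> / (\<zeta> - x)\<^sup>2))"
      unfolding 1 2 by (simp add: algebra_simps)
  qed
  also have "\<dots> = (\<Sum>i\<le>m. coeff ?S i * cauchy_moment w (int i + 1) x) - (\<Sum>i\<le>m. coeff Wp i * d i)"
    unfolding d_def cauchy_moment_def cauchy_integral_def
    by (subst circle_mean_diff)
      (auto intro!: circle_integrable_sum circle_integrable_cmult i1 i2
        simp: circle_mean_sum circle_mean_cmult circle_integrable_cmult i1 i2 simp del: times_divide_eq_right)
  also have "(\<Sum>i\<le>m. coeff ?S i * cauchy_moment w (int i + 1) x) = poly ?S x * ?C x + (\<Sum>i\<le>m. coeff ?S i * poly (?q i) x)"
    unfolding cauchy_moment_via_one[OF w_integrable x] poly_bounded_sum[OF degS] sum_distrib_right sum.distrib[symmetric]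
    by (intro sum.cong refl) (simp add: algebra_simps)
  also have "(\<Sum>i\<le>m. coeff Wp i * d i) = (\<Sum>i\<le>m. coeff Wp i * of_nat i * x ^ (i - 1)) * ?C x
      + poly Wp x * d 0 + (\<Sum>i\<le>m. coeff Wp i * poly (pderiv (?q i)) x)"
    unfolding poly_bounded_sum[OF eq_refl[OF degree_Wp]] sum_distrib_right sum.distrib[symmetric]
    by (intro sum.cong refl, subst d) (simp add: algebra_simps)
  also have "(\<Sum>i\<le>m. coeff Wp i * of_nat i * x ^ (i - 1)) = poly (pderiv Wp) x"
  proof -
    have "(\<Sum>i\<le>m. coeff Wp i * of_nat i * x ^ (i - 1)) = (\<Sum>i\<in>{Suc 0..m}. coeff Wp i * of_nat i * x ^ (i - 1))"
      by (intro sum.mono_neutral_right) auto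
    also have "\<dots> = (\<Sum>i\<in>{0..<m}. coeff Wp (Suc i) * of_nat (Suc i) * x ^ i)"
      using sum.shift_bounds_Suc_ivl[of "\<lambda>i. coeff Wp i * of_nat i * x ^ (i - 1)" 0 m]
      by (simp add: atLeastLessThanSuc_atLeastAtMost)
    also have "\<dots> = (\<Sum>i\<le>m - 1. coeff (pderiv Wp) i * x ^ i)"
      using m_ge_2 by (intro sum.cong) (auto simp: coeff_pderiv algebra_simps)
    also have "\<dots> = poly (pderiv Wp) x"
      by (rule poly_bounded_sum[symmetric]) (simp add: degree_pderiv degree_Wp)
    finally show ?thesis .
  qed
  finally have "poly Wp x * d 0 = poly Vp x * ?C x + poly ode_poly x"
    unfolding pearson_source_def poly_sum by (simp add: sum_subtractf algebra_simps)
  moreover have "(?C has_field_derivative d 0) (at x)" using dC[of 0] by simp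
  ultimately show ?thesis by blast
qed

end

subsection \<open>Radial boundary values\<close>

text \<open>
  On the radius through \<open>c\<close> the kernel is at most twice \<open>1 / (\<zeta> - c)\<close>, so dominated convergence
  applies from the inside and from the outside alike.
\<close>

lemma cauchy_integral_radial_limit:
  assumes u: "circle_integrable u" and ua: "circle_integrable (\<lambda>\<zeta>. u \<zeta> / (\<zeta> - c))"
    and c: "c \<in> sphere 0 1"
  shows "((\<lambda>r::real. cauchy_integral u (of_real r * c)) \<longlongrightarrow> cauchy_integral u c) (at 1)"
  unfolding cauchy_integral_def
proof (rule circle_mean_dominated_convergence[OF ua _ ua, where S = "{c}" and K = 2])
  have c1: "cmod c = 1" using c by simp
  have ev: "\<forall>\<^sub>F r::real in at 1. r \<noteq> 1 \<and> r > 0"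
    by (intro eventually_conj eventually_neq_at_within order_tendstoD(1)[OF tendsto_ident_at]) simp
  show "\<forall>\<^sub>F r in at 1. circle_integrable (\<lambda>\<zeta>. u \<zeta> / (\<zeta> - of_real r * c))"
    using ev
  proof eventually_elim
    case (elim r)
    then have "of_real r * c \<notin> sphere 0 1" using c1 by (auto simp: norm_mult)
    then show ?case using circle_integrable_cauchy_kernel[OF u, of _ 1] by simp
  qed
  show "finite {c}" by simp
  show "((\<lambda>r. u \<zeta> / (\<zeta> - of_real r * c)) \<longlongrightarrow> u \<zeta> / (\<zeta> - c)) (at 1)" if "\<zeta> \<in> sphere 0 1 - {c}" for \<zeta>
  proof -
    have "((\<lambda>r. u \<zeta> / (\<zeta> - of_real r * c)) \<longlongrightarrow> u \<zeta> / (\<zeta> - of_real 1 * c)) (at 1)"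
      using that by (intro tendsto_intros) auto
    then show ?thesis by simp
  qed
  show "\<forall>\<^sub>F r in at 1. \<forall>\<zeta>\<in>sphere 0 1 - {c}. cmod (u \<zeta> / (\<zeta> - of_real r * c)) \<le> 2 * cmod (u \<zeta> / (\<zeta> - c))"
    using ev
  proof (eventually_elim, intro ballI)
    fix r :: real and \<zeta> :: complex assume r: "r \<noteq> 1 \<and> r > 0" and z: "\<zeta> \<in> sphere 0 1 - {c}"
    \<comment> \<open>the distance to a radial approach point is at least half the distance to its end point\<close>
    have "cmod (of_real r * c - c) = \<bar>r - 1\<bar>"
    proof -
      have "of_real r * c - c = of_real (r - 1) * c" by (simp add: algebra_simps)
      then show ?thesis using c1 by (simp only: norm_mult norm_of_real) simp
    qed
    moreover have "\<bar>r - 1\<bar> \<le> cmod (\<zeta> - of_real r * c)"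
      using norm_triangle_ineq3[of \<zeta> "of_real r * c"] z c1 r by (simp add: norm_mult)
    moreover have "cmod (\<zeta> - c) \<le> cmod (\<zeta> - of_real r * c) + cmod (of_real r * c - c)"
      using norm_triangle_ineq[of "\<zeta> - of_real r * c" "of_real r * c - c"] by simp
    ultimately have le: "cmod (\<zeta> - c) \<le> 2 * cmod (\<zeta> - of_real r * c)" by linarith
    have pos: "cmod (\<zeta> - c) > 0" using z by auto
    then have pos': "cmod (\<zeta> - of_real r * c) > 0" using le by linarith
    show "cmod (u \<zeta> / (\<zeta> - of_real r * c)) \<le> 2 * cmod (u \<zeta> / (\<zeta> - c))"
      unfolding norm_divide using le pos pos' mult_left_mono[OF le, of "cmod (u \<zeta>)"]
      by (simp add: field_simps)
  qed
qed

section \<open>Bi-orthogonal polynomials at a fixed time\<close>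

text \<open>
  Orthogonality to polynomials of every degree up to \<open>n\<close>, rewritten for monomials.
\<close>

lemma triangular_orthogonality:
  fixes L :: "nat \<Rightarrow> complex" and p :: "nat \<Rightarrow> complex poly"
  assumes lead: "\<And>k. k \<le> n \<Longrightarrow> coeff (p k) k \<noteq> 0"
    and orth: "\<And>k. k \<le> n \<Longrightarrow> (\<Sum>j\<le>k. coeff (p k) j * L j) = (if k = n then 1 else 0)"
  shows "k \<le> n \<Longrightarrow> L k = (if k = n then 1 / coeff (p n) n else 0)"
proof (induction k rule: less_induct)
  case (less k)
  have "(\<Sum>j\<le>k. coeff (p k) j * L j) = coeff (p k) k * L k"
    using less by (subst sum.remove[of _ k]) (auto intro!: sum.neutral)
  then show ?case using orth[OF less.prems] lead[OF less.prems] by (auto simp: field_simps)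
qed

lemma circle_mean_reflect_poly_mult:
  assumes u: "circle_integrable u" and p: "degree p \<le> N"
  shows "circle_mean (\<lambda>\<zeta>. u \<zeta> * poly p (1 / \<zeta>)) = (\<Sum>i\<le>N. coeff p i * moment u (int i))"
proof -
  have "circle_mean (\<lambda>\<zeta>. u \<zeta> * poly p (1 / \<zeta>)) = circle_mean (\<lambda>\<zeta>. \<Sum>i\<le>N. coeff p i * (\<zeta> powi (- int i) * u \<zeta>))"
    by (intro circle_mean_cong)
      (simp add: poly_bounded_sum[OF p] sum_distrib_left power_int_minus field_simps)
  also have "\<dots> = (\<Sum>i\<le>N. circle_mean (\<lambda>\<zeta>. coeff p i * (\<zeta> powi (- int i) * u \<zeta>)))"
    by (intro circle_mean_sum circle_integrable_cmult circle_integrable_power_int u)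
  also have "\<dots> = (\<Sum>i\<le>N. coeff p i * moment u (int i))"
    by (simp add: circle_mean_cmult moment_def mult.commute)
  finally show ?thesis .
qed

lemma cauchy_moment_poly_mult:
  assumes w: "circle_integrable w" and x: "x \<notin> sphere 0 1" and p: "degree p \<le> N"
  shows "cauchy_moment (\<lambda>\<zeta>. w \<zeta> * poly p \<zeta>) k x = (\<Sum>i\<le>N. coeff p i * cauchy_moment w (k + int i) x)"
proof -
  have "cauchy_moment (\<lambda>\<zeta>. w \<zeta> * poly p \<zeta>) k x
      = circle_mean (\<lambda>\<zeta>. \<Sum>i\<le>N. coeff p i * (\<zeta> powi (k + int i) * w \<zeta> / (\<zeta> - x)))"
    unfolding cauchy_moment_def cauchy_integral_def
  proof (rule circle_mean_cong)
    fix \<zeta> :: complex assume s: "\<zeta> \<in> sphere 0 1"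
    show "\<zeta> powi k * (w \<zeta> * poly p \<zeta>) / (\<zeta> - x) = (\<Sum>i\<le>N. coeff p i * (\<zeta> powi (k + int i) * w \<zeta> / (\<zeta> - x)))"
      unfolding poly_bounded_sum[OF p] sum_distrib_left sum_divide_distrib
      using sphere_nonzero[OF s] by (intro sum.cong refl) (simp add: power_int_add)
  qed
  also have "\<dots> = (\<Sum>i\<le>N. circle_mean (\<lambda>\<zeta>. coeff p i * (\<zeta> powi (k + int i) * w \<zeta> / (\<zeta> - x))))"
    by (intro circle_mean_sum circle_integrable_cmult cauchy_moment_kernel_integrable w x)
  finally show ?thesis unfolding cauchy_moment_def cauchy_integral_def by (simp only: circle_mean_cmult)
qed

lemma cauchy_moment_reflect_poly_mult:
  assumes w: "circle_integrable w" and x: "x \<notin> sphere 0 1" and p: "degree p \<le> N"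
  shows "cauchy_moment (\<lambda>\<zeta>. w \<zeta> * poly p (1 / \<zeta>)) k x = (\<Sum>i\<le>N. coeff p i * cauchy_moment w (k - int i) x)"
proof -
  have "cauchy_moment (\<lambda>\<zeta>. w \<zeta> * poly p (1 / \<zeta>)) k x
      = circle_mean (\<lambda>\<zeta>. \<Sum>i\<le>N. coeff p i * (\<zeta> powi (k - int i) * w \<zeta> / (\<zeta> - x)))"
    unfolding cauchy_moment_def cauchy_integral_def
  proof (rule circle_mean_cong)
    fix \<zeta> :: complex assume s: "\<zeta> \<in> sphere 0 1"
    show "\<zeta> powi k * (w \<zeta> * poly p (1 / \<zeta>)) / (\<zeta> - x) = (\<Sum>i\<le>N. coeff p i * (\<zeta> powi (k - int i) * w \<zeta> / (\<zeta> - x)))"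
      unfolding poly_bounded_sum[OF p] sum_distrib_left sum_divide_distrib
      using sphere_nonzero[OF s] by (intro sum.cong refl) (simp add: power_int_diff field_simps)
  qed
  also have "\<dots> = (\<Sum>i\<le>N. circle_mean (\<lambda>\<zeta>. coeff p i * (\<zeta> powi (k - int i) * w \<zeta> / (\<zeta> - x))))"
    by (intro circle_mean_sum circle_integrable_cmult cauchy_moment_kernel_integrable w x)
  finally show ?thesis unfolding cauchy_moment_def cauchy_integral_def by (simp only: circle_mean_cmult)
qed

lemma poly_inverse_eq_reflect_poly:
  assumes "degree q = n" "x \<noteq> (0::complex)"
  shows "x ^ n * poly q (1 / x) = poly (reflect_poly q) x"
  using poly_reflect_poly_nz[OF assms(2), of q] assms by (simp add: inverse_eq_divide)

text \<open>
  \<open>(\<zeta> + x) / (\<zeta> - x) = 2 \<zeta> / (\<zeta> - x) - 1\<close>.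
\<close>

lemma circle_mean_schwarz_kernel:
  assumes u: "circle_integrable u" and x: "x \<notin> sphere 0 1" and u0: "moment u 0 = 0"
  shows "circle_mean (\<lambda>\<zeta>. (\<zeta> + x) / (\<zeta> - x) * u \<zeta>) = 2 * cauchy_moment u 1 x"
proof -
  have "circle_mean (\<lambda>\<zeta>. (\<zeta> + x) / (\<zeta> - x) * u \<zeta>) = circle_mean (\<lambda>\<zeta>. \<zeta> powi 1 * u \<zeta> / (\<zeta> - x) + x * (\<zeta> powi 0 * u \<zeta> / (\<zeta> - x)))"
    by (intro circle_mean_cong) (simp add: add_divide_distrib ring_distribs)
  also have "\<dots> = cauchy_moment u 1 x + x * cauchy_moment u 0 x"
    unfolding cauchy_moment_def cauchy_integral_def
    by (subst circle_mean_add, (intro circle_integrable_cmult cauchy_moment_kernel_integrable u x)+)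
       (simp only: circle_mean_cmult)
  also have "x * cauchy_moment u 0 x = cauchy_moment u 1 x"
    using cauchy_moment_add_one[OF u x, of 0] u0 by simp
  finally show ?thesis by simp
qed

lemma ray_tendsto: "((\<lambda>r::real. of_real r * c) \<longlongrightarrow> (c::complex)) (at 1)"
proof -
  have "((\<lambda>r::real. of_real r * c) \<longlongrightarrow> of_real 1 * c) (at 1)"
    by (intro tendsto_intros)
  then show ?thesis by simp
qed

locale semiclassical_system = semiclassical_weight +
  fixes \<kappa> :: "nat \<Rightarrow> complex" and \<phi> \<phi>b :: "nat \<Rightarrow> complex poly"
  assumes \<kappa>_nonzero: "\<kappa> n \<noteq> 0"
    and degree_phi: "degree (\<phi> n) = n" and degree_phib: "degree (\<phi>b n) = n"
    and lead_phi: "coeff (\<phi> n) n = \<kappa> n" and lead_phib: "coeff (\<phi>b n) n = \<kappa> n"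
    and biorthonormal: "circle_mean (\<lambda>\<zeta>. w \<zeta> * poly (\<phi> i) \<zeta> * poly (\<phi>b n) (1 / \<zeta>)) = (if i = n then 1 else 0)"
begin

abbreviation "u n \<equiv> (\<lambda>\<zeta>. w \<zeta> * poly (\<phi> n) \<zeta>)"
abbreviation "v n \<equiv> (\<lambda>\<zeta>. w \<zeta> * poly (\<phi>b n) (1 / \<zeta>))"

lemma u_integrable: "circle_integrable (u n)"
proof -
  have "circle_integrable (\<lambda>\<zeta>. poly (\<phi> n) \<zeta> * w \<zeta>)"
    by (intro circle_integrable_continuous_mult w_integrable continuous_intros)
  then show ?thesis by (simp add: mult.commute)
qed

lemma v_integrable: "circle_integrable (v n)"
proof -
  have "circle_integrable (\<lambda>\<zeta>. poly (\<phi>b n) (1 / \<zeta>) * w \<zeta>)"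
    by (intro circle_integrable_continuous_mult w_integrable continuous_intros) auto
  then show ?thesis by (simp add: mult.commute)
qed

lemma moment_u: "k \<le> n \<Longrightarrow> moment (u n) (int k) = (if k = n then 1 / \<kappa> n else 0)"
proof -
  assume k: "k \<le> n"
  have "moment (u n) (int k) = (if k = n then 1 / coeff (\<phi>b n) n else 0)"
  proof (rule triangular_orthogonality[where p = \<phi>b and n = n, OF _ _ k])
    show "(\<Sum>j\<le>k. coeff (\<phi>b k) j * moment (u n) (int j)) = (if k = n then 1 else 0)" for k
      using biorthonormal[of n k] circle_mean_reflect_poly_mult[OF u_integrable[of n] eq_refl[OF degree_phib[of k]]] by auto
  qed (simp add: lead_phib \<kappa>_nonzero)
  then show ?thesis by (simp add: lead_phib)
qed

lemma moment_v: "k \<le> n \<Longrightarrow> moment (v n) (- int k) = (if k = n then 1 / \<kappa> n else 0)"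
proof -
  assume k: "k \<le> n"
  have "moment (v n) (- int k) = (if k = n then 1 / coeff (\<phi> n) n else 0)"
  proof (rule triangular_orthogonality[where p = \<phi> and n = n, OF _ _ k])
    show "(\<Sum>j\<le>k. coeff (\<phi> k) j * moment (v n) (- int j)) = (if k = n then 1 else 0)" for k
      using biorthonormal[of k n] circle_mean_poly_mult[OF v_integrable[of n] eq_refl[OF degree_phi[of k]]]
      by (simp add: mult_ac)
  qed (simp add: lead_phi \<kappa>_nonzero)
  then show ?thesis by (simp add: lead_phi)
qed

lemma eps_eq:
  assumes n: "n \<ge> 1" and x: "x \<notin> sphere 0 1"
  shows "eps w (\<phi> n) x = 2 * cauchy_moment (u n) 1 x"
  using circle_mean_schwarz_kernel[OF u_integrable x] moment_u[of 0 n] n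
  unfolding eps_def by (simp add: mult.assoc)

lemma eps_star_eq:
  assumes n: "n \<ge> 1" and x: "x \<notin> sphere 0 1"
  shows "eps_star n w (\<phi>b n) x = - 2 * x ^ n * cauchy_moment (v n) 1 x"
  using circle_mean_schwarz_kernel[OF v_integrable x] moment_v[of 0 n] n
  unfolding eps_star_def by (simp add: mult.assoc)

lemma cauchy_moment_u_shift:
  assumes "x \<notin> sphere 0 1" "k \<le> n"
  shows "cauchy_moment (u n) 1 x = x ^ k * cauchy_moment (u n) (1 - int k) x"
proof -
  have "(\<Sum>l<k. x ^ l * moment (u n) (int l + 1 - 1)) = 0"
    using assms(2) moment_u by (intro sum.neutral) auto
  then show ?thesis using cauchy_moment_expand_at_0[OF u_integrable assms(1), of n 1 k] by simp
qed

text \<open>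
  Orthogonality removes the first \<open>n\<close> Taylor coefficients at 0.
\<close>

lemma eps_zero_of_order_n:
  assumes n: "n \<ge> 1" and x: "x \<notin> sphere 0 1"
  shows "eps w (\<phi> n) x = x ^ n * (2 * cauchy_moment (u n) (1 - int n) x)"
  using eps_eq[OF n x] cauchy_moment_u_shift[OF x order_refl, of n] by simp

lemma eps_leading_coefficient: "cauchy_moment (u n) (1 - int n) 0 = 1 / \<kappa> n"
proof -
  have "cauchy_moment (u n) (1 - int n) 0 = moment (u n) (int n)"
    using cauchy_moment_add_one[OF u_integrable, of 0 n "- int n"] by simp
  then show ?thesis using moment_u[of n n] by simp
qed

lemma cauchy_moment_v_shift:
  assumes x: "x \<notin> sphere 0 1" and n: "n \<ge> 1"
  shows "k \<le> n \<Longrightarrow> cauchy_moment (v n) (int k + 1) x = x ^ k * cauchy_moment (v n) 1 x + (if k = n then 1 / \<kappa> n else 0)"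
proof (induction k)
  case 0 then show ?case using n by simp
next
  case (Suc k)
  have "cauchy_moment (v n) (int (Suc k) + 1) x = x * cauchy_moment (v n) (int k + 1) x + moment (v n) (- int (Suc k))"
    using cauchy_moment_add_one[OF v_integrable x, of n "int k + 1"] by (simp add: algebra_simps)
  then show ?case using Suc moment_v[of "Suc k" n] by (simp add: algebra_simps)
qed

text \<open>
  The Cauchy transform of \<open>w \<phi> \<phi>b\<close> can be computed by expanding either polynomial: it is
  \<open>\<phi>b (1 / x)\<close> times the transform of \<open>w \<phi>\<close>, and also \<open>\<phi> x\<close> times that of \<open>w \<phi>b\<close> plus the norm 1.
\<close>

lemma wronskian:
  assumes n: "n \<ge> 1" and x: "x \<notin> sphere 0 1" "x \<noteq> 0"
  shows "poly (\<phi> n) x * eps_star n w (\<phi>b n) x + poly (reflect_poly (\<phi>b n)) x * eps w (\<phi> n) x = 2 * x ^ n"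
proof -
  define K where "K = cauchy_moment (\<lambda>\<zeta>. w \<zeta> * poly (\<phi> n) \<zeta> * poly (\<phi>b n) (1 / \<zeta>)) 1 x"
  have "K = (\<Sum>i\<le>n. coeff (\<phi>b n) i * cauchy_moment (u n) (1 - int i) x)"
    unfolding K_def by (rule cauchy_moment_reflect_poly_mult[OF u_integrable x(1)]) (simp add: degree_phib)
  also have "\<dots> = (\<Sum>i\<le>n. coeff (\<phi>b n) i * (1 / x) ^ i) * cauchy_moment (u n) 1 x"
    unfolding sum_distrib_right
    by (intro sum.cong refl, subst cauchy_moment_u_shift[OF x(1)]) (use x in \<open>auto simp: power_one_over\<close>)
  also have "\<dots> = poly (\<phi>b n) (1 / x) * cauchy_moment (u n) 1 x"
    by (simp add: poly_bounded_sum[of "\<phi>b n" n] degree_phib)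
  finally have K1: "K = poly (\<phi>b n) (1 / x) * cauchy_moment (u n) 1 x" .
  have "K = cauchy_moment (\<lambda>\<zeta>. v n \<zeta> * poly (\<phi> n) \<zeta>) 1 x"
    unfolding K_def by (simp add: mult_ac)
  also have "\<dots> = (\<Sum>i\<le>n. coeff (\<phi> n) i * cauchy_moment (v n) (int i + 1) x)"
    by (subst cauchy_moment_poly_mult[OF v_integrable x(1), of _ n]) (simp_all add: degree_phi add.commute)
  also have "\<dots> = (\<Sum>i\<le>n. coeff (\<phi> n) i * x ^ i * cauchy_moment (v n) 1 x + (if i = n then coeff (\<phi> n) n / \<kappa> n else 0))"
    by (intro sum.cong refl, subst cauchy_moment_v_shift[OF x(1) n]) (auto simp: algebra_simps)
  also have "\<dots> = poly (\<phi> n) x * cauchy_moment (v n) 1 x + 1"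
    unfolding sum.distrib using \<kappa>_nonzero
    by (simp add: poly_bounded_sum[of "\<phi> n" n] degree_phi sum_distrib_right lead_phi)
  finally have K2: "poly (\<phi>b n) (1 / x) * cauchy_moment (u n) 1 x = poly (\<phi> n) x * cauchy_moment (v n) 1 x + 1"
    using K1 by simp
  have "poly (reflect_poly (\<phi>b n)) x * eps w (\<phi> n) x = 2 * x ^ n * (poly (\<phi>b n) (1 / x) * cauchy_moment (u n) 1 x)"
    using poly_inverse_eq_reflect_poly[OF degree_phib x(2)] eps_eq[OF n x(1)] by (simp add: mult_ac flip: poly_inverse_eq_reflect_poly[OF degree_phib x(2)])
  then show ?thesis unfolding K2 using eps_star_eq[OF n x(1)] by (simp add: algebra_simps)
qed

lemma eps_holomorphic: "n \<ge> 1 \<Longrightarrow> eps w (\<phi> n) holomorphic_on - sphere 0 1"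
proof -
  assume n: "n \<ge> 1"
  have "(\<lambda>x. 2 * cauchy_moment (u n) 1 x) holomorphic_on - sphere 0 1"
    by (intro holomorphic_intros cauchy_moment_holomorphic u_integrable)
  then show ?thesis by (rule holomorphic_transform) (use eps_eq[OF n] in auto)
qed

lemma eps_star_holomorphic: "n \<ge> 1 \<Longrightarrow> eps_star n w (\<phi>b n) holomorphic_on - sphere 0 1"
proof -
  assume n: "n \<ge> 1"
  have "(\<lambda>x. - 2 * x ^ n * cauchy_moment (v n) 1 x) holomorphic_on - sphere 0 1"
    by (intro holomorphic_intros cauchy_moment_holomorphic v_integrable)
  then show ?thesis by (rule holomorphic_transform) (use eps_star_eq[OF n] in auto)
qed

lemma eventually_on_ray:
  assumes j: "j \<in> {1..m}" and nz: "a j \<noteq> 0"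
  shows "\<forall>\<^sub>F r::real in at 1. of_real r * a j \<in> - sphere 0 1 - a ` {1..m}"
proof -
  define F where "F = insert (1 / cmod (a j)) ((\<lambda>i. Re (a i / a j)) ` {1..m}) - {1::real}"
  have "finite F" by (simp add: F_def)
  then have "\<forall>\<^sub>F r in at 1. r \<in> - F"
    by (intro eventually_at_in_open' open_Compl finite_imp_closed) (auto simp: F_def)
  moreover have "\<forall>\<^sub>F r::real in at 1. r > 0"
    by (intro order_tendstoD(1)[OF tendsto_ident_at]) simp
  ultimately show ?thesis using eventually_neq_at_within[of "1::real"]
  proof eventually_elim
    case (elim r)
    have "of_real r * a j \<noteq> a i" if "i \<in> {1..m}" for i
    proof
      assume "of_real r * a j = a i"
      then have "a i / a j = of_real r" using nz by (simp add: field_simps)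
      then have "r = Re (a i / a j)" by simp
      then show False using elim that by (auto simp: F_def)
    qed
    moreover have "cmod (of_real r * a j) \<noteq> 1"
    proof
      assume "cmod (of_real r * a j) = 1"
      then have "r = 1 / cmod (a j)" using elim nz by (simp add: norm_mult field_simps)
      then show False using elim by (auto simp: F_def)
    qed
    moreover have "of_real r * a j \<notin> a ` {1..m}" using calculation(1) by blast
    ultimately show ?case by simp
  qed
qed

lemma cauchy_moment_radial_limit:
  assumes j: "j \<in> {1..m}" and g: "continuous_on (sphere 0 1) g"
  shows "((\<lambda>r::real. cauchy_moment (\<lambda>\<zeta>. w \<zeta> * g \<zeta>) k (of_real r * a j)) \<longlongrightarrow> cauchy_moment (\<lambda>\<zeta>. w \<zeta> * g \<zeta>) k (a j)) (at 1)"
proof (cases "a j \<in> sphere 0 1")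
  case True
  have c: "continuous_on (sphere 0 1) (\<lambda>\<zeta>. \<zeta> powi k * g \<zeta>)"
    by (intro continuous_intros g) auto
  show ?thesis
    unfolding cauchy_moment_def
  proof (rule cauchy_integral_radial_limit[OF _ _ True])
    show "circle_integrable (\<lambda>\<zeta>. \<zeta> powi k * (w \<zeta> * g \<zeta>))"
      using circle_integrable_continuous_mult[OF w_integrable c] by (simp add: mult_ac)
    show "circle_integrable (\<lambda>\<zeta>. \<zeta> powi k * (w \<zeta> * g \<zeta>) / (\<zeta> - a j))"
      using circle_integrable_continuous_mult[OF w_pole_integrable[OF j] c] by (simp add: mult_ac)
  qed
next
  case False
  have "circle_integrable (\<lambda>\<zeta>. w \<zeta> * g \<zeta>)"
    using circle_integrable_continuous_mult[OF w_integrable g] by (simp add: mult_ac)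
  then have "isCont (cauchy_moment (\<lambda>\<zeta>. w \<zeta> * g \<zeta>) k) (a j)"
    using cauchy_moment_has_field_derivative[OF _ False] DERIV_isCont by blast
  moreover have "((\<lambda>r::real. of_real r * a j) \<longlongrightarrow> a j) (at 1)"
    by (rule ray_tendsto)
  ultimately show ?thesis by (rule isCont_tendsto_compose)
qed

lemma limiting_value_tendsto:
  assumes off: "c \<notin> sphere 0 1 \<Longrightarrow> isCont F c"
    and lim: "((\<lambda>r::real. F (of_real r * c)) \<longlongrightarrow> l) (at 1)"
  shows "((\<lambda>r::real. F (of_real r * c)) \<longlongrightarrow> limiting_value F c) (at 1)"
proof (cases "c \<in> sphere 0 1")
  case True
  then have "limiting_value F c = l"
    unfolding limiting_value_def using tendsto_Lim[OF _ lim] by simp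
  then show ?thesis using lim by simp
next
  case False
  then have "((\<lambda>r::real. F (of_real r * c)) \<longlongrightarrow> F c) (at 1)"
    by (intro isCont_tendsto_compose[OF off ray_tendsto])
  then show ?thesis using False by (simp add: limiting_value_def)
qed

lemma holomorphic_off_circle_isCont:
  "F holomorphic_on - sphere 0 1 \<Longrightarrow> c \<notin> sphere 0 1 \<Longrightarrow> isCont F c"
  using holomorphic_on_imp_continuous_on[of F "- sphere 0 1"]
  by (simp add: continuous_on_eq_continuous_at open_Compl)

lemma eps_limiting_value:
  assumes n: "n \<ge> 1" and j: "j \<in> {1..m}" "a j \<noteq> 0"
  shows "((\<lambda>r::real. eps w (\<phi> n) (of_real r * a j)) \<longlongrightarrow> limiting_value (eps w (\<phi> n)) (a j)) (at 1)"
proof (rule limiting_value_tendsto)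
  have "((\<lambda>r::real. 2 * cauchy_moment (u n) 1 (of_real r * a j)) \<longlongrightarrow> 2 * cauchy_moment (u n) 1 (a j)) (at 1)"
    by (intro tendsto_intros cauchy_moment_radial_limit j) (intro continuous_intros)
  moreover have "\<forall>\<^sub>F r::real in at 1. 2 * cauchy_moment (u n) 1 (of_real r * a j) = eps w (\<phi> n) (of_real r * a j)"
    using eventually_on_ray[OF j] by eventually_elim (use eps_eq[OF n] in auto)
  ultimately show "((\<lambda>r::real. eps w (\<phi> n) (of_real r * a j)) \<longlongrightarrow> 2 * cauchy_moment (u n) 1 (a j)) (at 1)"
    by (rule Lim_transform_eventually)
qed (rule holomorphic_off_circle_isCont[OF eps_holomorphic[OF n]])

lemma eps_star_limiting_value:
  assumes n: "n \<ge> 1" and j: "j \<in> {1..m}" "a j \<noteq> 0"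
  shows "((\<lambda>r::real. eps_star n w (\<phi>b n) (of_real r * a j)) \<longlongrightarrow> limiting_value (eps_star n w (\<phi>b n)) (a j)) (at 1)"
proof (rule limiting_value_tendsto)
  have "continuous_on (sphere 0 1) (\<lambda>\<zeta>. poly (\<phi>b n) (1 / \<zeta>))"
    by (intro continuous_intros) auto
  then have "((\<lambda>r::real. - 2 * (of_real r * a j) ^ n * cauchy_moment (v n) 1 (of_real r * a j)) \<longlongrightarrow>
      - 2 * (of_real 1 * a j) ^ n * cauchy_moment (v n) 1 (a j)) (at 1)"
    by (intro tendsto_intros cauchy_moment_radial_limit j)
  moreover have "\<forall>\<^sub>F r::real in at 1. - 2 * (of_real r * a j) ^ n * cauchy_moment (v n) 1 (of_real r * a j)
      = eps_star n w (\<phi>b n) (of_real r * a j)"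
    using eventually_on_ray[OF j] by eventually_elim (use eps_star_eq[OF n] in auto)
  ultimately show "((\<lambda>r::real. eps_star n w (\<phi>b n) (of_real r * a j)) \<longlongrightarrow>
       - 2 * (of_real 1 * a j) ^ n * cauchy_moment (v n) 1 (a j)) (at 1)"
    by (rule Lim_transform_eventually)
qed (rule holomorphic_off_circle_isCont[OF eps_star_holomorphic[OF n]])

end

section \<open>The residue matrices\<close>

lemma mat_mult_entry: "(mat c ** (M :: complex^2^2)) $ i $ k = c * M $ i $ k"
  unfolding matrix_matrix_mult_def mat_def
  by (simp add: if_distrib[of "\<lambda>x. x * _"] cong: if_cong)

lemma matrix_sum_entry:
  "(\<Sum>j\<in>J. mat (c j) ** (A j :: complex^2^2)) $ i $ k = (\<Sum>j\<in>J. c j * A j $ i $ k)"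
  by (simp add: mat_mult_entry)

lemma matrix_mult_entry_2:
  "((M :: complex^2^2) ** N) $ i $ k = M $ i $ 1 * N $ 1 $ k + M $ i $ 2 * N $ 2 $ k"
  unfolding matrix_matrix_mult_def by (simp add: sum_2)

lemma Ymat_entries:
  "Ymat n w p q x $ 1 $ 1 = poly p x" "Ymat n w p q x $ 1 $ 2 = eps w p x / w x"
  "Ymat n w p q x $ 2 $ 1 = poly (reflect_poly q) x" "Ymat n w p q x $ 2 $ 2 = - eps_star n w q x / w x"
  by (simp_all add: Ymat_def)

lemma equal_on_dense_imp_equal:
  fixes F G :: "complex \<Rightarrow> complex"
  assumes S: "open S" "x \<in> S" and D: "closure D = UNIV"
    and F: "continuous_on S F" and G: "continuous_on S G"
    and eq: "\<And>y. y \<in> S \<Longrightarrow> y \<in> D \<Longrightarrow> F y = G y"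
  shows "F x = G x"
proof (rule ccontr)
  assume ne: "F x \<noteq> G x"
  have "open (S \<inter> (\<lambda>y. F y - G y) -` (- {0}))"
    by (intro continuous_open_preimage continuous_intros F G S)
  moreover have "x \<in> S \<inter> (\<lambda>y. F y - G y) -` (- {0})" using ne S by simp
  ultimately have "D \<inter> (S \<inter> (\<lambda>y. F y - G y) -` (- {0})) \<noteq> {}"
    using D open_Int_closure_eq_empty[of "S \<inter> (\<lambda>y. F y - G y) -` (- {0})" D] by blast
  then show False using eq by auto
qed

text \<open>
  L'Hopital's rule for \<open>(r - 1) h r / (r - 1)\<close>: a nonzero \<open>c\<close> would make \<open>h\<close> diverge
  logarithmically.
\<close>

lemma real_log_derivative_limit:
  fixes h h' :: "real \<Rightarrow> real"
  assumes d: "\<forall>\<^sub>F r in at 1. (h has_field_derivative h' r) (at r)"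
    and h: "(h \<longlongrightarrow> L) (at 1)" and c: "((\<lambda>r. (r - 1) * h' r) \<longlongrightarrow> c) (at 1)"
  shows "c = 0"
proof -
  have "((\<lambda>r. (r - 1) * h r / (r - 1)) \<longlongrightarrow> L + c) (at 1)"
  proof (rule lhopital[where f' = "\<lambda>r. h r + (r - 1) * h' r" and g' = "\<lambda>_. 1"])
    have "((\<lambda>r. (r - 1) * h r) \<longlongrightarrow> (1 - 1) * L) (at 1)" by (intro tendsto_intros h)
    then show "((\<lambda>r. (r - 1) * h r) \<longlongrightarrow> 0) (at 1)" by simp
    have "((\<lambda>r::real. r - 1) \<longlongrightarrow> 1 - 1) (at 1)" by (intro tendsto_intros)
    then show "((\<lambda>r::real. r - 1) \<longlongrightarrow> 0) (at 1)" by simp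
    show "\<forall>\<^sub>F r::real in at 1. r - 1 \<noteq> 0" using eventually_neq_at_within[of 1] by simp
    show "\<forall>\<^sub>F r in at 1. ((\<lambda>r. (r - 1) * h r) has_field_derivative h r + (r - 1) * h' r) (at r)"
      using d by eventually_elim (auto intro!: derivative_eq_intros)
    show "\<forall>\<^sub>F r::real in at 1. ((\<lambda>r. r - 1) has_field_derivative 1) (at r)"
      by (intro always_eventually allI) (auto intro!: derivative_eq_intros)
    show "((\<lambda>r. (h r + (r - 1) * h' r) / 1) \<longlongrightarrow> L + c) (at 1)"
      using tendsto_add[OF h c] by simp
  qed simp
  moreover have "\<forall>\<^sub>F r::real in at 1. (r - 1) * h r / (r - 1) = h r"
    using eventually_neq_at_within[of 1] by eventually_elim simp
  ultimately have "(h \<longlongrightarrow> L + c) (at 1)" by (rule Lim_transform_eventually)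
  then have "L = L + c" by (rule LIM_unique[OF h])
  then show ?thesis by simp
qed

lemma log_derivative_limit:
  fixes h h' :: "real \<Rightarrow> complex"
  assumes d: "\<forall>\<^sub>F r in at 1. (h has_vector_derivative h' r) (at r)"
    and h: "(h \<longlongrightarrow> L) (at 1)" and c: "((\<lambda>r. of_real (r - 1) * h' r) \<longlongrightarrow> c) (at 1)"
  shows "c = 0"
proof -
  have "Re c = 0"
  proof (rule real_log_derivative_limit[OF _ tendsto_Re[OF h]])
    show "\<forall>\<^sub>F r in at 1. ((\<lambda>r. Re (h r)) has_field_derivative Re (h' r)) (at r)"
      using d by eventually_elim
        (auto simp: has_vector_derivative_complex_iff has_real_derivative_iff_has_vector_derivative)
    show "((\<lambda>r. (r - 1) * Re (h' r)) \<longlongrightarrow> Re c) (at 1)" using tendsto_Re[OF c] by simp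
  qed
  moreover have "Im c = 0"
  proof (rule real_log_derivative_limit[OF _ tendsto_Im[OF h]])
    show "\<forall>\<^sub>F r in at 1. ((\<lambda>r. Im (h r)) has_field_derivative Im (h' r)) (at r)"
      using d by eventually_elim
        (auto simp: has_vector_derivative_complex_iff has_real_derivative_iff_has_vector_derivative)
    show "((\<lambda>r. (r - 1) * Im (h' r)) \<longlongrightarrow> Im c) (at 1)" using tendsto_Im[OF c] by simp
  qed
  ultimately show ?thesis by (simp add: complex_eq_iff)
qed

context semiclassical_system
begin

lemma simple_poles_radial_limit:
  assumes j: "j \<in> {1..m}" and nz: "a j \<noteq> 0"
  shows "((\<lambda>r::real. (of_real r * a j - a j) * (\<Sum>i=1..m. b i / (of_real r * a j - a i))) \<longlongrightarrow> b j) (at 1)"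
proof -
  have sp: "(\<Sum>i=1..m. b i / (x - a i)) = b j / (x - a j) + (\<Sum>i\<in>{1..m}-{j}. b i / (x - a i))" for x
    using j by (subst sum.remove[of _ j]) auto
  have dist: "a j - a i \<noteq> 0" if "i \<in> {1..m} - {j}" for i
    using inj_onD[OF inj, of j i] j that by auto
  have "((\<lambda>r::real. b j + (of_real r * a j - a j) * (\<Sum>i\<in>{1..m}-{j}. b i / (of_real r * a j - a i)))
     \<longlongrightarrow> b j + (a j - a j) * (\<Sum>i\<in>{1..m}-{j}. b i / (a j - a i))) (at 1)"
    by (intro tendsto_intros ray_tendsto dist)
  moreover have "\<forall>\<^sub>F r::real in at 1. b j + (of_real r * a j - a j) * (\<Sum>i\<in>{1..m}-{j}. b i / (of_real r * a j - a i))
      = (of_real r * a j - a j) * (\<Sum>i=1..m. b i / (of_real r * a j - a i))"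
    using eventually_on_ray[OF j nz]
  proof eventually_elim
    case (elim r)
    then have "of_real r * a j \<noteq> a j" using j by auto
    then have "of_real r * a j - a j \<noteq> 0" by simp
    then have "(of_real r * a j - a j) * (b j / (of_real r * a j - a j)) = b j" by simp
    then show ?case unfolding sp distrib_left by simp
  qed
  ultimately have "((\<lambda>r::real. (of_real r * a j - a j) * (\<Sum>i=1..m. b i / (of_real r * a j - a i)))
     \<longlongrightarrow> b j + (a j - a j) * (\<Sum>i\<in>{1..m}-{j}. b i / (a j - a i))) (at 1)"
    by (rule Lim_transform_eventually)
  then show ?thesis by simp
qed

text \<open>
  The equation \<open>Y' = A Y\<close>, given on the cut plane, in terms of the functions \<open>\<epsilon>\<close> and \<open>\<epsilon>\<^sup>*\<close>, which
  are holomorphic across the cuts; by density it holds there too, in particular on the rays towards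
  the singular points, which may lie in a cut.
\<close>

lemma residue_linear_system:
  assumes n: "n \<ge> 1" and A: "residue_matrices m a D (Ymat n w (\<phi> n) (\<phi>b n)) A"
    and x: "x \<in> - sphere 0 1 - a ` {1..m}"
  defines "M \<equiv> (\<lambda>i k x. \<Sum>j=1..m. A j $ i $ k / (x - a j))"
  shows "deriv (poly (\<phi> n)) x = M 1 1 x * poly (\<phi> n) x + M 1 2 x * poly (reflect_poly (\<phi>b n)) x"
    and "deriv (poly (reflect_poly (\<phi>b n))) x = M 2 1 x * poly (\<phi> n) x + M 2 2 x * poly (reflect_poly (\<phi>b n)) x"
    and "deriv (eps w (\<phi> n)) x = (logderiv x + M 1 1 x) * eps w (\<phi> n) x - M 1 2 x * eps_star n w (\<phi>b n) x"
    and "deriv (eps_star n w (\<phi>b n)) x = (logderiv x + M 2 2 x) * eps_star n w (\<phi>b n) x - M 2 1 x * eps w (\<phi> n) x"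
proof -
  let ?f = "poly (\<phi> n)" and ?fs = "poly (reflect_poly (\<phi>b n))"
  let ?e = "eps w (\<phi> n)" and ?es = "eps_star n w (\<phi>b n)"
  let ?Y = "Ymat n w (\<phi> n) (\<phi>b n)"
  let ?S = "- sphere 0 1 - a ` {1..m}"
  have oS: "open ?S"
    by (intro open_Diff open_Compl finite_imp_closed[of "a ` {1..m}"]) auto
  have hol: "?e holomorphic_on - sphere 0 1" "?es holomorphic_on - sphere 0 1"
    using eps_holomorphic[OF n] eps_star_holomorphic[OF n] by auto
  have ode: "((\<lambda>x. ?Y x $ i $ k) has_field_derivative M i 1 y * ?Y y $ 1 $ k + M i 2 y * ?Y y $ 2 $ k) (at y)"
    if y: "y \<in> D" "y \<notin> sphere 0 1" for y i k
    using A y unfolding residue_matrices_def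
    by (simp only: matrix_mult_entry_2 matrix_sum_entry M_def) (simp only: mult.commute[of "1 / _"] times_divide_eq_right mult_1_right Diff_iff simp_thms)
  have e': "deriv ?e y = (logderiv y + M 1 1 y) * ?e y - M 1 2 y * ?es y"
    and es': "deriv ?es y = (logderiv y + M 2 2 y) * ?es y - M 2 1 y * ?e y"
    if y: "y \<in> D" "y \<notin> sphere 0 1" for y
  proof -
    have w0: "w y \<noteq> 0" using w_nonzero y by auto
    have 1: "((\<lambda>x. ?e x / w x) has_field_derivative M 1 1 y * (?e y / w y) + M 1 2 y * (- ?es y / w y)) (at y)"
      using ode[OF y, of 1 2] by (simp add: Ymat_entries)
    have "((\<lambda>x. ?e x / w x * w x) has_field_derivative
        (M 1 1 y * (?e y / w y) + M 1 2 y * (- ?es y / w y)) * w y + (logderiv y * w y) * (?e y / w y)) (at y)"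
      by (rule DERIV_mult[OF 1 w_has_field_derivative[OF y(1)]])
    then have "(?e has_field_derivative
        (M 1 1 y * (?e y / w y) + M 1 2 y * (- ?es y / w y)) * w y + (logderiv y * w y) * (?e y / w y)) (at y)"
      by (rule has_field_derivative_transform_within_open[OF _ D_open y(1)]) (simp add: w_nonzero)
    then show "deriv ?e y = (logderiv y + M 1 1 y) * ?e y - M 1 2 y * ?es y"
      using w0 by (simp add: DERIV_imp_deriv algebra_simps)
    have 1: "((\<lambda>x. - ?es x / w x) has_field_derivative M 2 1 y * (?e y / w y) + M 2 2 y * (- ?es y / w y)) (at y)"
      using ode[OF y, of 2 2] by (simp add: Ymat_entries)
    have "((\<lambda>x. - ?es x / w x * (- w x)) has_field_derivative
        (M 2 1 y * (?e y / w y) + M 2 2 y * (- ?es y / w y)) * (- w y) + (- (logderiv y * w y)) * (- ?es y / w y)) (at y)"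
      by (rule DERIV_mult[OF 1 DERIV_minus[OF w_has_field_derivative[OF y(1)]]])
    then have "(?es has_field_derivative
        (M 2 1 y * (?e y / w y) + M 2 2 y * (- ?es y / w y)) * (- w y) + (- (logderiv y * w y)) * (- ?es y / w y)) (at y)"
      by (rule has_field_derivative_transform_within_open[OF _ D_open y(1)]) (simp add: w_nonzero)
    then show "deriv ?es y = (logderiv y + M 2 2 y) * ?es y - M 2 1 y * ?e y"
      using w0 by (simp add: DERIV_imp_deriv algebra_simps)
  qed
  have cM: "continuous_on ?S (M i k)" for i k
    unfolding M_def by (intro continuous_intros) auto
  have cl: "continuous_on ?S logderiv"
    unfolding logderiv_def by (intro continuous_intros) auto
  have ce: "continuous_on ?S ?e" "continuous_on ?S ?es"
    using hol by (meson holomorphic_on_imp_continuous_on continuous_on_subset Diff_subset)+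
  have cd: "continuous_on ?S (deriv ?e)" "continuous_on ?S (deriv ?es)"
    by (intro holomorphic_on_imp_continuous_on holomorphic_on_subset[OF holomorphic_deriv[OF hol(1)]]
         holomorphic_on_subset[OF holomorphic_deriv[OF hol(2)]]; simp add: open_Compl)+
  have dp: "deriv (poly p) = poly (pderiv p)" for p :: "complex poly"
    by (intro ext DERIV_imp_deriv poly_DERIV)
  show "deriv ?f x = M 1 1 x * ?f x + M 1 2 x * ?fs x"
  proof (rule equal_on_dense_imp_equal[OF oS x D_dense])
    show "deriv ?f y = M 1 1 y * ?f y + M 1 2 y * ?fs y" if "y \<in> ?S" "y \<in> D" for y
      using ode[of y 1 1] that by (simp add: Ymat_entries DERIV_imp_deriv)
  qed (unfold dp, intro continuous_intros cM, intro continuous_intros cM)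
  show "deriv ?fs x = M 2 1 x * ?f x + M 2 2 x * ?fs x"
  proof (rule equal_on_dense_imp_equal[OF oS x D_dense])
    show "deriv ?fs y = M 2 1 y * ?f y + M 2 2 y * ?fs y" if "y \<in> ?S" "y \<in> D" for y
      using ode[of y 2 1] that by (simp add: Ymat_entries DERIV_imp_deriv)
  qed (unfold dp, intro continuous_intros cM, intro continuous_intros cM)
  show "deriv ?e x = (logderiv x + M 1 1 x) * ?e x - M 1 2 x * ?es x"
    by (rule equal_on_dense_imp_equal[OF oS x D_dense cd(1)])
      (intro continuous_intros cM cl ce, rule e', auto)
  show "deriv ?es x = (logderiv x + M 2 2 x) * ?es x - M 2 1 x * ?e x"
    by (rule equal_on_dense_imp_equal[OF oS x D_dense cd(2)])
      (intro continuous_intros cM cl ce, rule es', auto)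
qed

text \<open>
  The relations collected at \<open>a j\<close> are \<open>A j (f, fs) = 0\<close>, \<open>(\<rho> j + A j) (e, - es) = 0\<close> and
  \<open>f es + fs e = 2 a j ^ n\<close>; the third makes the two vectors independent, so they determine \<open>A j\<close>.
\<close>

lemma residue_matrix_entries:
  assumes n: "n \<ge> 1" and A: "residue_matrices m a D (Ymat n w (\<phi> n) (\<phi>b n)) A"
    and j: "j \<in> {1..m}" "a j \<noteq> 0"
  defines "f \<equiv> poly (\<phi> n) (a j)" and "fs \<equiv> poly (reflect_poly (\<phi>b n)) (a j)"
    and "e \<equiv> limiting_value (eps w (\<phi> n)) (a j)" and "es \<equiv> limiting_value (eps_star n w (\<phi>b n)) (a j)"
  shows "2 * a j ^ n * A j $ 1 $ 1 = - \<rho> j * e * fs" "2 * a j ^ n * A j $ 1 $ 2 = \<rho> j * e * f"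
    "2 * a j ^ n * A j $ 2 $ 1 = \<rho> j * es * fs" "2 * a j ^ n * A j $ 2 $ 2 = - \<rho> j * es * f"
    "f * es + fs * e = 2 * a j ^ n"
proof -
  define c where "c = a j"
  let ?F = "poly (\<phi> n)" and ?Fs = "poly (reflect_poly (\<phi>b n))"
  let ?E = "eps w (\<phi> n)" and ?Es = "eps_star n w (\<phi>b n)"
  define M where "M = (\<lambda>i k x. \<Sum>j=1..m. A j $ i $ k / (x - a j))"
  have sys:
    "deriv ?F x = M 1 1 x * ?F x + M 1 2 x * ?Fs x"
    "deriv ?Fs x = M 2 1 x * ?F x + M 2 2 x * ?Fs x"
    "deriv ?E x = (logderiv x + M 1 1 x) * ?E x - M 1 2 x * ?Es x"
    "deriv ?Es x = (logderiv x + M 2 2 x) * ?Es x - M 2 1 x * ?E x"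
    if "x \<in> - sphere 0 1 - a ` {1..m}" for x
    unfolding M_def using residue_linear_system[OF n A that] by blast+
  have ev: "\<forall>\<^sub>F r::real in at 1. of_real r * c \<in> - sphere 0 1 - a ` {1..m}"
    unfolding c_def by (rule eventually_on_ray[OF j])
  have M: "((\<lambda>r::real. (of_real r * c - c) * M i k (of_real r * c)) \<longlongrightarrow> A j $ i $ k) (at 1)" for i k
    unfolding M_def c_def by (rule simple_poles_radial_limit[OF j])
  have l: "((\<lambda>r::real. (of_real r * c - c) * logderiv (of_real r * c)) \<longlongrightarrow> \<rho> j) (at 1)"
    unfolding logderiv_def c_def by (rule simple_poles_radial_limit[OF j])
  have E: "((\<lambda>r::real. ?E (of_real r * c)) \<longlongrightarrow> e) (at 1)"
    unfolding e_def c_def by (rule eps_limiting_value[OF n j])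
  have Es: "((\<lambda>r::real. ?Es (of_real r * c)) \<longlongrightarrow> es) (at 1)"
    unfolding es_def c_def by (rule eps_star_limiting_value[OF n j])
  have P: "((\<lambda>r::real. poly p (of_real r * c)) \<longlongrightarrow> poly p c) (at 1)" for p
    by (intro tendsto_intros ray_tendsto)
  \<comment> \<open>the polynomial column has no pole at \<open>c\<close>\<close>
  have pol0: "A j $ i $ 1 * f + A j $ i $ 2 * fs = 0"
    if "\<And>x. x \<in> - sphere 0 1 - a ` {1..m} \<Longrightarrow> poly p x = M i 1 x * ?F x + M i 2 x * ?Fs x" for p i
  proof -
    have "((\<lambda>r::real. (of_real r * c - c) * M i 1 (of_real r * c) * ?F (of_real r * c)
           + (of_real r * c - c) * M i 2 (of_real r * c) * ?Fs (of_real r * c)) \<longlongrightarrow> A j $ i $ 1 * f + A j $ i $ 2 * fs) (at 1)"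
      unfolding f_def fs_def c_def[symmetric] by (intro tendsto_intros M P)
    moreover have "\<forall>\<^sub>F r::real in at 1. (of_real r * c - c) * M i 1 (of_real r * c) * ?F (of_real r * c)
           + (of_real r * c - c) * M i 2 (of_real r * c) * ?Fs (of_real r * c) = (of_real r * c - c) * poly p (of_real r * c)"
      using ev by eventually_elim (simp only: that ring_distribs mult.assoc)
    ultimately have "((\<lambda>r::real. (of_real r * c - c) * poly p (of_real r * c)) \<longlongrightarrow> A j $ i $ 1 * f + A j $ i $ 2 * fs) (at 1)"
      by (rule Lim_transform_eventually)
    moreover have "((\<lambda>r::real. (of_real r * c - c) * poly p (of_real r * c)) \<longlongrightarrow> (c - c) * poly p c) (at 1)"
      by (intro tendsto_intros ray_tendsto P)
    ultimately have "A j $ i $ 1 * f + A j $ i $ 2 * fs = (c - c) * poly p c" by (rule LIM_unique)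
    then show ?thesis by simp
  qed
  have dp: "deriv (poly p) y = poly (pderiv p) y" for p :: "complex poly" and y
    by (rule DERIV_imp_deriv) (rule poly_DERIV)
  have col1: "A j $ 1 $ 1 * f + A j $ 1 $ 2 * fs = 0" "A j $ 2 $ 1 * f + A j $ 2 $ 2 * fs = 0"
    by (rule pol0[where p = "pderiv (\<phi> n)"], metis dp sys(1))
       (rule pol0[where p = "pderiv (reflect_poly (\<phi>b n))"], metis dp sys(2))
  \<comment> \<open>a nonzero limit of \<open>(x - c) F'(x)\<close> would make \<open>F\<close> diverge logarithmically\<close>
  have col2: "q = 0" if hol: "G holomorphic_on - sphere 0 1" and G: "((\<lambda>r::real. G (of_real r * c)) \<longlongrightarrow> g) (at 1)"
    and q: "((\<lambda>r::real. (of_real r * c - c) * deriv G (of_real r * c)) \<longlongrightarrow> q) (at 1)" for G g q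
  proof (rule log_derivative_limit[OF _ G])
    show "\<forall>\<^sub>F r in at 1. ((\<lambda>r::real. G (of_real r * c)) has_vector_derivative c * deriv G (of_real r * c)) (at r)"
      using ev
    proof eventually_elim
      case (elim r)
      then have "(G has_field_derivative deriv G (of_real r * c)) (at (of_real r * c))"
        using holomorphic_derivI[OF hol] by (simp add: open_Compl)
      moreover have "((\<lambda>r::real. of_real r * c) has_vector_derivative c) (at r)"
        by (rule has_vector_derivative_real_field[where f = "\<lambda>x. x * c"]) (auto intro!: derivative_eq_intros)
      ultimately have "(G \<circ> (\<lambda>r. of_real r * c) has_vector_derivative c * deriv G (of_real r * c)) (at r)"
        by (rule field_vector_diff_chain_at[rotated])
      then show ?case by (simp add: comp_def)
    qed
    show "((\<lambda>r::real. of_real (r - 1) * (c * deriv G (of_real r * c))) \<longlongrightarrow> q) (at 1)"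
      using q by (simp add: algebra_simps)
  qed
  have "\<rho> j * e + A j $ 1 $ 1 * e - A j $ 1 $ 2 * es = 0"
  proof (rule col2[OF eps_holomorphic[OF n] E])
    have "((\<lambda>r::real. (of_real r * c - c) * logderiv (of_real r * c) * ?E (of_real r * c)
         + (of_real r * c - c) * M 1 1 (of_real r * c) * ?E (of_real r * c)
         - (of_real r * c - c) * M 1 2 (of_real r * c) * ?Es (of_real r * c)) \<longlongrightarrow> \<rho> j * e + A j $ 1 $ 1 * e - A j $ 1 $ 2 * es) (at 1)"
      by (intro tendsto_intros M l E Es)
    moreover have "\<forall>\<^sub>F r::real in at 1. (of_real r * c - c) * logderiv (of_real r * c) * ?E (of_real r * c)
         + (of_real r * c - c) * M 1 1 (of_real r * c) * ?E (of_real r * c)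
         - (of_real r * c - c) * M 1 2 (of_real r * c) * ?Es (of_real r * c)
         = (of_real r * c - c) * deriv ?E (of_real r * c)"
      using ev by eventually_elim (simp only: sys ring_distribs mult.assoc)
    ultimately show "((\<lambda>r::real. (of_real r * c - c) * deriv ?E (of_real r * c)) \<longlongrightarrow>
        \<rho> j * e + A j $ 1 $ 1 * e - A j $ 1 $ 2 * es) (at 1)"
      by (rule Lim_transform_eventually)
  qed
  then have e1: "A j $ 1 $ 2 * es = (\<rho> j + A j $ 1 $ 1) * e" by (simp add: algebra_simps)
  have "\<rho> j * es + A j $ 2 $ 2 * es - A j $ 2 $ 1 * e = 0"
  proof (rule col2[OF eps_star_holomorphic[OF n] Es])
    have "((\<lambda>r::real. (of_real r * c - c) * logderiv (of_real r * c) * ?Es (of_real r * c)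
         + (of_real r * c - c) * M 2 2 (of_real r * c) * ?Es (of_real r * c)
         - (of_real r * c - c) * M 2 1 (of_real r * c) * ?E (of_real r * c)) \<longlongrightarrow> \<rho> j * es + A j $ 2 $ 2 * es - A j $ 2 $ 1 * e) (at 1)"
      by (intro tendsto_intros M l E Es)
    moreover have "\<forall>\<^sub>F r::real in at 1. (of_real r * c - c) * logderiv (of_real r * c) * ?Es (of_real r * c)
         + (of_real r * c - c) * M 2 2 (of_real r * c) * ?Es (of_real r * c)
         - (of_real r * c - c) * M 2 1 (of_real r * c) * ?E (of_real r * c)
         = (of_real r * c - c) * deriv ?Es (of_real r * c)"
      using ev by eventually_elim (simp only: sys ring_distribs mult.assoc)
    ultimately show "((\<lambda>r::real. (of_real r * c - c) * deriv ?Es (of_real r * c)) \<longlongrightarrow>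
        \<rho> j * es + A j $ 2 $ 2 * es - A j $ 2 $ 1 * e) (at 1)"
      by (rule Lim_transform_eventually)
  qed
  then have e2: "A j $ 2 $ 1 * e = (\<rho> j + A j $ 2 $ 2) * es" by (simp add: algebra_simps)
  show W: "f * es + fs * e = 2 * a j ^ n"
  proof -
    have "((\<lambda>r::real. ?F (of_real r * c) * ?Es (of_real r * c) + ?Fs (of_real r * c) * ?E (of_real r * c)) \<longlongrightarrow> f * es + fs * e) (at 1)"
      unfolding f_def fs_def c_def[symmetric] by (intro tendsto_intros P E Es)
    moreover have "\<forall>\<^sub>F r::real in at 1. ?F (of_real r * c) * ?Es (of_real r * c) + ?Fs (of_real r * c) * ?E (of_real r * c) = 2 * (of_real r * c) ^ n"
      using ev
    proof eventually_elim
      case (elim r)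
      then have "of_real r * c \<noteq> 0" using image_eqI[of 0 a 1, OF origin[symmetric] one_mem] by auto
      then show ?case using wronskian[OF n] elim by simp
    qed
    ultimately have "((\<lambda>r::real. 2 * (of_real r * c) ^ n) \<longlongrightarrow> f * es + fs * e) (at 1)"
      by (rule Lim_transform_eventually)
    moreover have "((\<lambda>r::real. 2 * (of_real r * c) ^ n) \<longlongrightarrow> 2 * c ^ n) (at 1)"
      by (intro tendsto_intros ray_tendsto)
    ultimately show ?thesis unfolding c_def by (rule LIM_unique)
  qed
  have c1: "A j $ 1 $ 2 * fs = - (A j $ 1 $ 1 * f)" "A j $ 2 $ 2 * fs = - (A j $ 2 $ 1 * f)"
    using col1 by (simp_all add: eq_neg_iff_add_eq_0 add.commute)
  have "2 * a j ^ n * A j $ 1 $ 1 = (A j $ 1 $ 1 * f) * es + A j $ 1 $ 1 * fs * e"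
    by (simp add: algebra_simps flip: W)
  also have "A j $ 1 $ 1 * f = - (A j $ 1 $ 2 * fs)" using c1 by simp
  also have "- (A j $ 1 $ 2 * fs) * es + A j $ 1 $ 1 * fs * e = - fs * (A j $ 1 $ 2 * es) + A j $ 1 $ 1 * fs * e"
    by (simp add: algebra_simps)
  also have "\<dots> = - \<rho> j * e * fs" unfolding e1 by (simp add: algebra_simps)
  finally show "2 * a j ^ n * A j $ 1 $ 1 = - \<rho> j * e * fs" .
  have "2 * a j ^ n * A j $ 1 $ 2 = f * (A j $ 1 $ 2 * es) + (A j $ 1 $ 2 * fs) * e"
    by (simp add: algebra_simps flip: W)
  also have "\<dots> = \<rho> j * e * f" unfolding e1 c1 by (simp add: algebra_simps)
  finally show "2 * a j ^ n * A j $ 1 $ 2 = \<rho> j * e * f" .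
  have "2 * a j ^ n * A j $ 2 $ 1 = (A j $ 2 $ 1 * f) * es + fs * (A j $ 2 $ 1 * e)"
    by (simp add: algebra_simps flip: W)
  also have "A j $ 2 $ 1 * f = - (A j $ 2 $ 2 * fs)" using c1 by simp
  also have "- (A j $ 2 $ 2 * fs) * es + fs * (A j $ 2 $ 1 * e) = \<rho> j * es * fs" unfolding e2 by (simp add: algebra_simps)
  finally show "2 * a j ^ n * A j $ 2 $ 1 = \<rho> j * es * fs" .
  have "2 * a j ^ n * A j $ 2 $ 2 = f * (A j $ 2 $ 2 * es) + (A j $ 2 $ 2 * fs) * e"
    by (simp add: algebra_simps flip: W)
  also have "\<dots> = f * (A j $ 2 $ 2 * es) - f * (A j $ 2 $ 1 * e)" unfolding c1 by (simp add: algebra_simps)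
  also have "\<dots> = - \<rho> j * es * f" unfolding e2 by (simp add: algebra_simps)
  finally show "2 * a j ^ n * A j $ 2 $ 2 = - \<rho> j * es * f" .
qed

end

section \<open>Locally uniform Lipschitz dependence on the deformation variable\<close>

text \<open>
  The bound on \<open>h t\<close> itself is included to make the notion stable under products.
\<close>

definition lips :: "complex set \<Rightarrow> complex \<Rightarrow> (complex \<Rightarrow> complex \<Rightarrow> complex) \<Rightarrow> complex \<Rightarrow> bool" where
  "lips U t h x \<longleftrightarrow> (\<exists>r>0. \<exists>C\<ge>0. (\<forall>y\<in>ball x r. cmod (h t y) \<le> C) \<and>
     (\<forall>\<^sub>F s in at t within U. \<forall>y\<in>ball x r. cmod (h s y - h t y) \<le> C * cmod (s - t)))"

lemma lipsE:
  assumes "lips U t h x"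
  obtains r C where "r > 0" "C \<ge> 0" "\<And>y. y \<in> ball x r \<Longrightarrow> cmod (h t y) \<le> C"
    "\<forall>\<^sub>F s in at t within U. \<forall>y\<in>ball x r. cmod (h s y - h t y) \<le> C * cmod (s - t)"
  using assms unfolding lips_def by blast

lemma lipsI:
  assumes "r > 0" "\<And>y. y \<in> ball x r \<Longrightarrow> cmod (h t y) \<le> C1"
    "\<forall>\<^sub>F s in at t within U. \<forall>y\<in>ball x r. cmod (h s y - h t y) \<le> C2 * cmod (s - t)"
  shows "lips U t h x"
  unfolding lips_def
proof (rule exI[of _ r], rule conjI[OF assms(1)], rule exI[of _ "max 0 (max C1 C2)"], intro conjI ballI)
  show "cmod (h t y) \<le> max 0 (max C1 C2)" if "y \<in> ball x r" for y
    using assms(2)[OF that] by linarith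
  show "\<forall>\<^sub>F s in at t within U. \<forall>y\<in>ball x r. cmod (h s y - h t y) \<le> max 0 (max C1 C2) * cmod (s - t)"
    using assms(3)
  proof eventually_elim
    case (elim s)
    have "C2 * cmod (s - t) \<le> max 0 (max C1 C2) * cmod (s - t)" by (intro mult_right_mono) auto
    then show ?case using elim by fastforce
  qed
qed simp

lemma zero_less_one_real: "(0::real) < 1" by simp

lemma eventually_close: "\<epsilon> > 0 \<Longrightarrow> \<forall>\<^sub>F s in at t within U. cmod (s - t) < \<epsilon>"
  unfolding eventually_at by (auto simp: dist_norm)

lemma lips_add:
  assumes "lips U t h x" "lips U t k x"
  shows "lips U t (\<lambda>s y. h s y + k s y) x"
proof -
  obtain r1 C1 where 1: "r1 > 0" "C1 \<ge> 0" "\<And>y. y \<in> ball x r1 \<Longrightarrow> cmod (h t y) \<le> C1"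
    "\<forall>\<^sub>F s in at t within U. \<forall>y\<in>ball x r1. cmod (h s y - h t y) \<le> C1 * cmod (s - t)"
    using assms(1) by (rule lipsE) (rule that)
  obtain r2 C2 where 2: "r2 > 0" "C2 \<ge> 0" "\<And>y. y \<in> ball x r2 \<Longrightarrow> cmod (k t y) \<le> C2"
    "\<forall>\<^sub>F s in at t within U. \<forall>y\<in>ball x r2. cmod (k s y - k t y) \<le> C2 * cmod (s - t)"
    using assms(2) by (rule lipsE) (rule that)
  show ?thesis
  proof (rule lipsI[where r = "min r1 r2" and ?C1.0 = "C1 + C2" and ?C2.0 = "C1 + C2"])
    show "cmod (h t y + k t y) \<le> C1 + C2" if "y \<in> ball x (min r1 r2)" for y
      using 1(3)[of y] 2(3)[of y] that norm_triangle_ineq[of "h t y" "k t y"] by simp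
    show "\<forall>\<^sub>F s in at t within U. \<forall>y\<in>ball x (min r1 r2). cmod (h s y + k s y - (h t y + k t y)) \<le> (C1 + C2) * cmod (s - t)"
      using 1(4) 2(4)
    proof (eventually_elim, intro ballI)
      fix s y assume H: "\<forall>y\<in>ball x r1. cmod (h s y - h t y) \<le> C1 * cmod (s - t)"
        "\<forall>y\<in>ball x r2. cmod (k s y - k t y) \<le> C2 * cmod (s - t)" "y \<in> ball x (min r1 r2)"
      have "cmod (h s y + k s y - (h t y + k t y)) \<le> cmod (h s y - h t y) + cmod (k s y - k t y)"
        using norm_triangle_ineq[of "h s y - h t y" "k s y - k t y"] by (simp add: algebra_simps)
      also have "\<dots> \<le> C1 * cmod (s - t) + C2 * cmod (s - t)"
        using H by (intro add_mono) auto
      finally show "cmod (h s y + k s y - (h t y + k t y)) \<le> (C1 + C2) * cmod (s - t)"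
        by (simp add: distrib_right)
    qed
  qed (use 1 2 in auto)
qed

lemma lips_mult:
  assumes "lips U t h x" "lips U t k x"
  shows "lips U t (\<lambda>s y. h s y * k s y) x"
proof -
  obtain r1 C1 where 1: "r1 > 0" "C1 \<ge> 0" "\<And>y. y \<in> ball x r1 \<Longrightarrow> cmod (h t y) \<le> C1"
    "\<forall>\<^sub>F s in at t within U. \<forall>y\<in>ball x r1. cmod (h s y - h t y) \<le> C1 * cmod (s - t)"
    using assms(1) by (rule lipsE) (rule that)
  obtain r2 C2 where 2: "r2 > 0" "C2 \<ge> 0" "\<And>y. y \<in> ball x r2 \<Longrightarrow> cmod (k t y) \<le> C2"
    "\<forall>\<^sub>F s in at t within U. \<forall>y\<in>ball x r2. cmod (k s y - k t y) \<le> C2 * cmod (s - t)"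
    using assms(2) by (rule lipsE) (rule that)
  show ?thesis
  proof (rule lipsI[where r = "min r1 r2" and ?C1.0 = "C1 * C2" and ?C2.0 = "C1 * (2 * C2) + C1 * C2"])
    show "cmod (h t y * k t y) \<le> C1 * C2" if "y \<in> ball x (min r1 r2)" for y
      using 1(2) 1(3)[of y] 2(2) 2(3)[of y] that by (auto simp: norm_mult intro!: mult_mono)
    show "\<forall>\<^sub>F s in at t within U. \<forall>y\<in>ball x (min r1 r2). cmod (h s y * k s y - h t y * k t y) \<le> (C1 * (2 * C2) + C1 * C2) * cmod (s - t)"
      using 1(4) 2(4) eventually_close[OF zero_less_one_real]
    proof (eventually_elim, intro ballI)
      fix s y assume H: "\<forall>y\<in>ball x r1. cmod (h s y - h t y) \<le> C1 * cmod (s - t)"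
        "\<forall>y\<in>ball x r2. cmod (k s y - k t y) \<le> C2 * cmod (s - t)" "cmod (s - t) < 1" and y: "y \<in> ball x (min r1 r2)"
      have y': "y \<in> ball x r1" "y \<in> ball x r2" using y by auto
      have k: "cmod (k s y - k t y) \<le> C2 * cmod (s - t)" and h: "cmod (h s y - h t y) \<le> C1 * cmod (s - t)"
        using H y' by auto
      have "C2 * cmod (s - t) \<le> C2 * 1" using H(3) 2(2) by (intro mult_left_mono) auto
      then have ks: "cmod (k s y) \<le> 2 * C2"
        using k 2(3)[OF y'(2)] norm_triangle_sub[of "k s y" "k t y"] by linarith
      have "cmod (h s y * k s y - h t y * k t y) = cmod ((h s y - h t y) * k s y + h t y * (k s y - k t y))"
        by (simp add: algebra_simps)
      also have "\<dots> \<le> cmod (h s y - h t y) * cmod (k s y) + cmod (h t y) * cmod (k s y - k t y)"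
        unfolding norm_mult[symmetric] by (rule norm_triangle_ineq)
      also have "\<dots> \<le> (C1 * cmod (s - t)) * (2 * C2) + C1 * (C2 * cmod (s - t))"
        using h k ks 1(2) 1(3)[OF y'(1)] by (intro add_mono mult_mono) auto
      finally show "cmod (h s y * k s y - h t y * k t y) \<le> (C1 * (2 * C2) + C1 * C2) * cmod (s - t)"
        by (simp add: algebra_simps)
    qed
  qed (use 1 2 in auto)
qed

lemma isCont_locally_bounded:
  fixes k :: "complex \<Rightarrow> complex"
  assumes "isCont k x"
  obtains r where "r > 0" "\<And>y. y \<in> ball x r \<Longrightarrow> cmod (k y) \<le> cmod (k x) + 1"
proof -
  have "\<forall>\<^sub>F y in at x. dist (k y) (k x) < 1"
    using assms unfolding isCont_def by (rule tendstoD) simp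
  then have "\<forall>\<^sub>F y in nhds x. dist (k y) (k x) < 1"
    by (simp add: eventually_nhds_conv_at)
  then obtain r where r: "r > 0" "\<And>y. dist y x < r \<Longrightarrow> dist (k y) (k x) < 1"
    unfolding eventually_nhds_metric by metis
  have "cmod (k y) \<le> cmod (k x) + 1" if "y \<in> ball x r" for y
    using r(2)[of y] that norm_triangle_sub[of "k y" "k x"] by (simp add: dist_norm norm_minus_commute)
  then show ?thesis using r(1) that by blast
qed

lemma lips_time_independent: "isCont k x \<Longrightarrow> lips U t (\<lambda>s. k) x"
proof -
  assume "isCont k x"
  then obtain r where "r > 0" "\<And>y. y \<in> ball x r \<Longrightarrow> cmod (k y) \<le> cmod (k x) + 1"
    by (rule isCont_locally_bounded) blast
  then show ?thesis by (intro lipsI[where r = r and ?C1.0 = "cmod (k x) + 1" and ?C2.0 = 0]) auto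
qed

lemma differentiable_imp_lipschitz:
  fixes c :: "complex \<Rightarrow> complex"
  assumes "c field_differentiable (at t within U)"
  obtains C where "C \<ge> 0" "\<forall>\<^sub>F s in at t within U. cmod (c s - c t) \<le> C * cmod (s - t)"
proof -
  obtain d where "(c has_field_derivative d) (at t within U)" using assms by (auto simp: field_differentiable_def)
  then have "((\<lambda>s. (c s - c t) / (s - t)) \<longlongrightarrow> d) (at t within U)"
    by (simp add: has_field_derivative_iff)
  then have "\<forall>\<^sub>F s in at t within U. dist ((c s - c t) / (s - t)) d < 1"
    by (rule tendstoD) simp
  then have "\<forall>\<^sub>F s in at t within U. cmod (c s - c t) \<le> (cmod d + 1) * cmod (s - t)"
    using eventually_neq_at_within[of t t U]
  proof eventually_elim
    case (elim s)
    then have "cmod ((c s - c t) / (s - t)) \<le> cmod d + 1"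
      using norm_triangle_sub[of "(c s - c t) / (s - t)" d] by (simp add: dist_norm)
    then show ?case using elim by (simp add: norm_divide divide_le_eq)
  qed
  then show ?thesis using that[of "cmod d + 1"] by simp
qed

lemma lips_space_independent:
  assumes "c field_differentiable (at t within U)"
  shows "lips U t (\<lambda>s y. c s) x"
proof -
  obtain C where "\<forall>\<^sub>F s in at t within U. cmod (c s - c t) \<le> C * cmod (s - t)"
    using assms by (rule differentiable_imp_lipschitz)
  then show ?thesis by (intro lipsI[where r = 1 and ?C1.0 = "cmod (c t)" and ?C2.0 = C]) auto
qed

lemma lips_sum:
  assumes "\<And>i. i \<in> I \<Longrightarrow> lips U t (h i) x"
  shows "lips U t (\<lambda>s y. \<Sum>i\<in>I. h i s y) x"
proof (cases "finite I")
  case True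
  then show ?thesis using assms
    by (induction I rule: finite_induct) (auto intro: lips_add lips_time_independent)
qed (simp add: lips_time_independent)

lemma lips_cong:
  assumes "lips U t h x" and t: "t \<in> U" and e: "e > 0"
    and eq: "\<And>s y. s \<in> U \<Longrightarrow> y \<in> ball x e \<Longrightarrow> h s y = k s y"
  shows "lips U t k x"
proof -
  obtain r C where 1: "r > 0" "C \<ge> 0" "\<And>y. y \<in> ball x r \<Longrightarrow> cmod (h t y) \<le> C"
    "\<forall>\<^sub>F s in at t within U. \<forall>y\<in>ball x r. cmod (h s y - h t y) \<le> C * cmod (s - t)"
    using assms(1) by (rule lipsE) (rule that)
  have ev: "\<forall>\<^sub>F s in at t within U. s \<in> U" by (simp add: eventually_at_filter)
  show ?thesis
  proof (rule lipsI[where r = "min r e" and ?C1.0 = C and ?C2.0 = C])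
    show "cmod (k t y) \<le> C" if "y \<in> ball x (min r e)" for y
      using 1(3)[of y] that eq[OF t, of y] by simp
    show "\<forall>\<^sub>F s in at t within U. \<forall>y\<in>ball x (min r e). cmod (k s y - k t y) \<le> C * cmod (s - t)"
      using 1(4) ev
    proof eventually_elim
      case (elim s)
      show ?case
      proof
        fix y assume y: "y \<in> ball x (min r e)"
        then have "cmod (h s y - h t y) \<le> C * cmod (s - t)" using elim(1) by simp
        then show "cmod (k s y - k t y) \<le> C * cmod (s - t)"
          using eq[OF t, of y] eq[OF elim(2), of y] y by simp
      qed
    qed
  qed (use 1 e in auto)
qed

lemma lips_poly:
  assumes t: "t \<in> U" and deg: "\<And>s. s \<in> U \<Longrightarrow> degree (P s) \<le> N"
    and P: "\<And>i. (\<lambda>s. coeff (P s) i) field_differentiable (at t within U)"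
  shows "lips U t (\<lambda>s. poly (P s)) x"
proof (rule lips_cong[OF _ t zero_less_one_real])
  show "lips U t (\<lambda>s y. \<Sum>i\<le>N. coeff (P s) i * y ^ i) x"
    by (intro lips_sum lips_mult lips_space_independent P lips_time_independent) (intro continuous_intros)
qed (simp add: poly_bounded_sum[OF deg])

lemma lips_pole:
  assumes c: "c field_differentiable (at t within U)" and x: "x \<noteq> c t"
  shows "lips U t (\<lambda>s y. 1 / (y - c s)) x"
proof -
  obtain C where C: "C \<ge> 0" "\<forall>\<^sub>F s in at t within U. cmod (c s - c t) \<le> C * cmod (s - t)"
    using c by (rule differentiable_imp_lipschitz)
  define d where "d = cmod (x - c t) / 3"
  have d: "d > 0" using x by (simp add: d_def)
  have "(c \<longlongrightarrow> c t) (at t within U)"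
    using c field_differentiable_imp_continuous_at continuous_within by blast
  then have ev: "\<forall>\<^sub>F s in at t within U. dist (c s) (c t) < d" using d by (rule tendstoD)
  have far: "cmod (y - c t) \<ge> 2 * d" if "y \<in> ball x d" for y
  proof -
    have "cmod (x - c t) \<le> cmod (x - y) + cmod (y - c t)"
      using norm_triangle_ineq[of "x - y" "y - c t"] by simp
    then show ?thesis using that by (simp add: dist_norm d_def)
  qed
  show ?thesis
  proof (rule lipsI[where r = d and ?C1.0 = "1 / d" and ?C2.0 = "C / (d * d)"])
    show "cmod (1 / (y - c t)) \<le> 1 / d" if "y \<in> ball x d" for y
      using far[OF that] d by (auto simp: norm_divide intro!: divide_left_mono mult_pos_pos)
    show "\<forall>\<^sub>F s in at t within U. \<forall>y\<in>ball x d. cmod (1 / (y - c s) - 1 / (y - c t)) \<le> C / (d * d) * cmod (s - t)"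
      using C(2) ev
    proof (eventually_elim, intro ballI)
      fix s y assume s: "cmod (c s - c t) \<le> C * cmod (s - t)" "dist (c s) (c t) < d" and y: "y \<in> ball x d"
      have 1: "cmod (y - c t) \<ge> 2 * d" using far[OF y] .
      have "cmod (y - c t) \<le> cmod (y - c s) + cmod (c s - c t)"
        using norm_triangle_ineq[of "y - c s" "c s - c t"] by simp
      then have 2: "cmod (y - c s) \<ge> d" using 1 s by (simp add: dist_norm)
      have ne: "y - c s \<noteq> 0" "y - c t \<noteq> 0" using 1 2 d by auto
      have "1 / (y - c s) - 1 / (y - c t) = (c s - c t) / ((y - c s) * (y - c t))"
        using ne by (simp add: field_simps)
      then have "cmod (1 / (y - c s) - 1 / (y - c t)) = cmod (c s - c t) / (cmod (y - c s) * cmod (y - c t))"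
        by (simp add: norm_divide norm_mult)
      also have "\<dots> \<le> (C * cmod (s - t)) / (d * d)"
        using s 1 2 d C(1) by (intro frac_le mult_mono) auto
      finally show "cmod (1 / (y - c s) - 1 / (y - c t)) \<le> C / (d * d) * cmod (s - t)" by simp
    qed
  qed (use d in auto)
qed

lemma holomorphic_lipschitz_half_ball:
  assumes h: "h holomorphic_on ball x r" and r: "r > 0"
    and B: "\<And>y. y \<in> ball x r \<Longrightarrow> cmod (h y) \<le> B" and y: "y \<in> ball x (r / 2)"
  shows "cmod (h y - h x) \<le> 4 * B / r * cmod (y - x)"
proof (rule field_differentiable_bound[where S = "ball x (r / 2)" and f' = "deriv h"])
  fix \<xi> assume \<xi>: "\<xi> \<in> ball x (r / 2)"
  have sub: "cball \<xi> (r / 4) \<subseteq> ball x r"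
  proof
    fix v assume "v \<in> cball \<xi> (r / 4)"
    then show "v \<in> ball x r" using \<xi> r dist_triangle[of x v \<xi>] by simp
  qed
  have "\<xi> \<in> ball x r" using \<xi> r by simp
  then show "(h has_field_derivative deriv h \<xi>) (at \<xi> within ball x (r / 2))"
    using holomorphic_derivI[OF h open_ball] has_field_derivative_at_within by blast
  have "cmod ((deriv ^^ 1) h \<xi>) \<le> fact 1 * B / (r / 4) ^ 1"
  proof (rule Cauchy_inequality)
    show "h holomorphic_on ball \<xi> (r / 4)"
      using h sub ball_subset_cball holomorphic_on_subset by blast
    show "continuous_on (cball \<xi> (r / 4)) h"
      using h sub holomorphic_on_imp_continuous_on holomorphic_on_subset by blast
    fix v assume "cmod (\<xi> - v) = r / 4"
    then have "v \<in> cball \<xi> (r / 4)" by (simp add: dist_norm)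
    then show "cmod (h v) \<le> B" using B sub by blast
  qed (use r in simp)
  then show "cmod (deriv h \<xi>) \<le> 4 * B / r" by (simp add: mult.commute)
qed (use y r in auto)

text \<open>
  By the Cauchy estimate the difference quotients in \<open>s\<close> are Lipschitz in the space variable, with
  one constant for all \<open>s\<close>.  Hence differentiability at \<open>x\<close> follows from differentiability at points
  near \<open>x\<close>, and the derivative is the limit of the derivatives.
\<close>

lemma lips_derivative_extends:
  assumes lips: "lips U t h x" and t: "t \<in> U"
    and S: "open S" "x \<in> S" and hol: "\<And>s. s \<in> U \<Longrightarrow> h s holomorphic_on S"
    and x: "x islimpt E" and g: "(g \<longlongrightarrow> l) (at x within E)"
    and d: "\<And>y. y \<in> E \<Longrightarrow> y \<in> S \<Longrightarrow> ((\<lambda>s. h s y) has_field_derivative g y) (at t within U)"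
  shows "((\<lambda>s. h s x) has_field_derivative l) (at t within U)"
proof -
  obtain r0 C where C: "r0 > 0" "C \<ge> 0"
    "\<forall>\<^sub>F s in at t within U. \<forall>y\<in>ball x r0. cmod (h s y - h t y) \<le> C * cmod (s - t)"
    using lips by (rule lipsE) (rule that)
  obtain r1 where r1: "r1 > 0" "ball x r1 \<subseteq> S" using S openE by blast
  define r where "r = min r0 r1"
  have r: "r > 0" "ball x r \<subseteq> S" "ball x r \<subseteq> ball x r0" using C r1 by (auto simp: r_def)
  have ev: "\<forall>\<^sub>F s in at t within U. s \<in> U" by (simp add: eventually_at_filter)
  have lip: "\<forall>\<^sub>F s in at t within U. \<forall>y\<in>ball x (r/2).
      cmod ((h s y - h t y) / (s - t) - (h s x - h t x) / (s - t)) \<le> 4 * C / r * cmod (y - x)"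
    using C(3) ev eventually_neq_at_within[of t t U]
  proof (eventually_elim, intro ballI)
    fix s y assume s: "\<forall>y\<in>ball x r0. cmod (h s y - h t y) \<le> C * cmod (s - t)" "s \<in> U" "s \<noteq> t" and y: "y \<in> ball x (r/2)"
    have "cmod ((h s y - h t y) - (h s x - h t x)) \<le> 4 * (C * cmod (s - t)) / r * cmod (y - x)"
    proof (rule holomorphic_lipschitz_half_ball[OF _ r(1) _ y])
      show "(\<lambda>y. h s y - h t y) holomorphic_on ball x r"
        by (intro holomorphic_intros holomorphic_on_subset[OF hol r(2)] s t)
    qed (use s r in blast)
    then have "cmod ((h s y - h t y) - (h s x - h t x)) / cmod (s - t) \<le> 4 * C / r * cmod (y - x)"
      using s(3) by (simp add: divide_le_eq) (simp add: mult_ac)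
    then show "cmod ((h s y - h t y) / (s - t) - (h s x - h t x) / (s - t)) \<le> 4 * C / r * cmod (y - x)"
      by (metis norm_divide diff_divide_distrib)
  qed
  show ?thesis
    unfolding has_field_derivative_iff
  proof (rule tendstoI)
    fix \<epsilon> :: real assume \<epsilon>: "\<epsilon> > 0"
    (* the Lipschitz constant of the difference quotients is 4 C / r *)
    define \<delta> where "\<delta> = \<epsilon> / 3 / (4 * C / r + 1)"
    have K: "4 * C / r + 1 > 0" using C r by (intro add_nonneg_pos) auto
    have \<delta>: "\<delta> > 0" using \<epsilon> K by (simp add: \<delta>_def)
    have "\<forall>\<^sub>F y in at x within E. dist (g y) l < \<epsilon> / 3"
      using g \<epsilon> by (intro tendstoD) auto
    moreover have "\<forall>\<^sub>F y in at x within E. y \<in> E" by (simp add: eventually_at_filter)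
    moreover have "\<forall>\<^sub>F y in at x within E. cmod (y - x) < min \<delta> (r / 2)"
      using \<delta> r by (intro eventually_close) auto
    ultimately have "\<forall>\<^sub>F y in at x within E. y \<in> E \<and> dist (g y) l < \<epsilon> / 3 \<and> cmod (y - x) < min \<delta> (r / 2)"
      by eventually_elim auto
    moreover have "at x within E \<noteq> bot" using x trivial_limit_within by blast
    ultimately obtain y where y: "y \<in> E" "dist (g y) l < \<epsilon> / 3" "cmod (y - x) < min \<delta> (r / 2)"
      using eventually_happens' by blast
    have yb: "y \<in> ball x (r / 2)" using y(3) by (simp add: dist_norm norm_minus_commute)
    then have "y \<in> S" using r by (auto simp: subset_iff)
    have dy: "((\<lambda>s. (h s y - h t y) / (s - t)) \<longlongrightarrow> g y) (at t within U)"
      using d[OF y(1) \<open>y \<in> S\<close>] by (simp add: has_field_derivative_iff)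
    have "\<forall>\<^sub>F s in at t within U. dist ((h s y - h t y) / (s - t)) (g y) < \<epsilon> / 3"
      using dy \<epsilon> by (intro tendstoD) auto
    then show "\<forall>\<^sub>F s in at t within U. dist ((h s x - h t x) / (s - t)) l < \<epsilon>"
      using lip
    proof eventually_elim
      case (elim s)
      have "4 * C / r * cmod (y - x) \<le> (4 * C / r + 1) * \<delta>"
        using C r y(3) \<delta> by (intro mult_mono) auto
      also have "\<dots> = \<epsilon> / 3"
      proof -
        have "X * (\<epsilon> / 3 / X) = \<epsilon> / 3" if "X > 0" for X :: real using that by simp
        then show ?thesis unfolding \<delta>_def using K by blast
      qed
      finally have "dist ((h s y - h t y) / (s - t)) ((h s x - h t x) / (s - t)) \<le> \<epsilon> / 3"
        using elim(2) yb unfolding dist_norm by (meson order.trans)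
      then show ?case using elim(1) y(2)
        by (metric)
    qed
  qed
qed

subsection \<open>Propagation along a linear differential equation\<close>

text \<open>
  The difference \<open>h s - h t\<close> satisfies a linear equation whose source is of order \<open>s - t\<close>.  On a ball
  so small that the homogeneous term contributes at most half of the maximum, a bound at a single
  point gives a bound on the whole ball.
\<close>

lemma ode_propagates_lipschitz_bound:
  assumes p: "lips U t p c" and q: "lips U t q c" and t: "t \<in> U"
    and r0: "r0 > 0" and bd: "\<And>y. y \<in> ball c r0 \<Longrightarrow> cmod (h t y) \<le> B"
    and ode_t: "\<And>y. y \<in> ball c r0 \<Longrightarrow> (h t has_field_derivative p t y * h t y + q t y) (at y)"
    and ode: "\<forall>\<^sub>F s in at t within U. \<forall>y\<in>ball c r0. (h s has_field_derivative p s y * h s y + q s y) (at y)"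
  obtains r where "r > 0" "\<And>K x0. x0 \<in> ball c r \<Longrightarrow> \<forall>\<^sub>F s in at t within U. cmod (h s x0 - h t x0) \<le> K * cmod (s - t)
     \<Longrightarrow> \<exists>K'. \<forall>\<^sub>F s in at t within U. \<forall>y\<in>ball c r. cmod (h s y - h t y) \<le> K' * cmod (s - t)"
proof -
  obtain r1 C1 where 1: "r1 > 0" "C1 \<ge> 0" "\<And>y. y \<in> ball c r1 \<Longrightarrow> cmod (p t y) \<le> C1"
    "\<forall>\<^sub>F s in at t within U. \<forall>y\<in>ball c r1. cmod (p s y - p t y) \<le> C1 * cmod (s - t)"
    using p by (rule lipsE) (rule that)
  obtain r2 C2 where 2: "r2 > 0" "C2 \<ge> 0" 
    "\<forall>\<^sub>F s in at t within U. \<forall>y\<in>ball c r2. cmod (q s y - q t y) \<le> C2 * cmod (s - t)"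
    using q by (rule lipsE) (rule that)
  (* the second bound makes the homogeneous term at most half of the maximum on the ball; C1 + 1 avoids a division by 0 *)
  define r where "r = min (min r0 (min r1 r2) / 2) (1 / (8 * (C1 + 1)))"
  have r: "r > 0" "r < r0" "r < r1" "r < r2" using r0 1 2 by (auto simp: r_def)
  have "r * (8 * (C1 + 1)) \<le> 1 / (8 * (C1 + 1)) * (8 * (C1 + 1))"
    using 1 by (intro mult_right_mono) (auto simp: r_def)
  then have rC: "8 * C1 * r \<le> 1" using 1 r by (simp add: algebra_simps)
  have B: "B \<ge> 0" using order.trans[OF norm_ge_zero bd[of c]] r0 by simp
  have main: "\<exists>K'. \<forall>\<^sub>F s in at t within U. \<forall>y\<in>ball c r. cmod (h s y - h t y) \<le> K' * cmod (s - t)"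
    if x0: "x0 \<in> ball c r" and K: "\<forall>\<^sub>F s in at t within U. cmod (h s x0 - h t x0) \<le> K * cmod (s - t)" for K x0
  proof (intro exI)
    show "\<forall>\<^sub>F s in at t within U. \<forall>y\<in>ball c r. cmod (h s y - h t y) \<le> (2 * (K + (C1 * B + C2) * (2 * r))) * cmod (s - t)"
      using K 1(4) 2(3) ode eventually_close[OF zero_less_one_real]
    proof eventually_elim
      case (elim s)
      define D where "D = (\<lambda>y. h s y - h t y)"
      have dD: "(D has_field_derivative p s y * D y + (p s y - p t y) * h t y + (q s y - q t y)) (at y)"
        if "y \<in> cball c r" for y
      proof -
        have y: "y \<in> ball c r0" using that r by auto
        have "((\<lambda>y. h s y - h t y) has_field_derivative (p s y * h s y + q s y) - (p t y * h t y + q t y)) (at y)"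
          using elim y ode_t by (intro DERIV_diff) auto
        then show ?thesis unfolding D_def by (simp add: algebra_simps)
      qed
      have cD: "continuous_on (cball c r) (\<lambda>y. cmod (D y))"
        using dD DERIV_isCont by (intro continuous_intros continuous_at_imp_continuous_on) blast
      obtain y1 where y1: "y1 \<in> cball c r" "\<And>y. y \<in> cball c r \<Longrightarrow> cmod (D y) \<le> cmod (D y1)"
        using continuous_attains_sup[OF compact_cball _ cD] r by auto
      define M where "M = cmod (D y1)"
      define R where "R = 2 * C1 * M + (C1 * B + C2) * cmod (s - t)"
      have bdd: "cmod (p s y * D y + (p s y - p t y) * h t y + (q s y - q t y)) \<le> R" if y: "y \<in> cball c r" for y
      proof -
        have yb: "y \<in> ball c r0" "y \<in> ball c r1" "y \<in> ball c r2" using y r by auto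
        have p1: "cmod (p s y - p t y) \<le> C1 * cmod (s - t)" using elim yb by auto
        have "C1 * cmod (s - t) \<le> C1 * 1" using elim 1 by (intro mult_left_mono) auto
        then have p2: "cmod (p s y) \<le> 2 * C1"
          using p1 1(3)[OF yb(2)] norm_triangle_sub[of "p s y" "p t y"] by linarith
        have "cmod (p s y * D y + (p s y - p t y) * h t y + (q s y - q t y))
           \<le> cmod (p s y) * cmod (D y) + cmod (p s y - p t y) * cmod (h t y) + cmod (q s y - q t y)"
          unfolding norm_mult[symmetric] by (intro order.trans[OF norm_triangle_ineq] add_mono norm_triangle_ineq order_refl)
        also have "\<dots> \<le> (2 * C1) * M + (C1 * cmod (s - t)) * B + C2 * cmod (s - t)"
          using p1 p2 bd[OF yb(1)] y1(2)[OF y] elim(3) yb(3) 1(2) B unfolding M_def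
          by (intro add_mono mult_mono) auto
        finally show ?thesis by (simp add: R_def algebra_simps)
      qed
      have inc: "cmod (D y - D x0) \<le> R * (2 * r)" if y: "y \<in> cball c r" for y
      proof -
        have "cmod (D y - D x0) \<le> R * cmod (y - x0)"
          by (rule field_differentiable_bound[where S = "cball c r", OF convex_cball has_field_derivative_at_within[OF dD] bdd])
             (use y x0 in auto)
        also have "\<dots> \<le> R * (2 * r)"
        proof (rule mult_left_mono)
          show "cmod (y - x0) \<le> 2 * r"
            using y x0 dist_triangle[of y x0 c] by (simp add: dist_norm norm_minus_commute)
          show "R \<ge> 0" using norm_ge_zero order.trans bdd[OF y1(1)] by blast
        qed
        finally show ?thesis .
      qed
      have "M \<le> cmod (D x0) + R * (2 * r)"
        using inc[OF y1(1)] norm_triangle_sub[of "D y1" "D x0"] by (simp add: M_def)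
      also have "\<dots> = cmod (D x0) + (4 * C1 * r) * M + (C1 * B + C2) * cmod (s - t) * (2 * r)"
        by (simp add: R_def algebra_simps)
      also have "\<dots> \<le> K * cmod (s - t) + 1 / 2 * M + (C1 * B + C2) * cmod (s - t) * (2 * r)"
      proof -
        have "(4 * C1 * r) * M \<le> 1 / 2 * M" using rC by (intro mult_right_mono) (auto simp: M_def)
        then show ?thesis using elim(1) by (simp add: D_def)
      qed
      finally have "M \<le> (2 * (K + (C1 * B + C2) * (2 * r))) * cmod (s - t)"
        by (simp add: algebra_simps)
      then show ?case using y1(2) unfolding M_def D_def by (meson ball_subset_cball order.trans subsetD)
    qed
  qed
  show ?thesis by (rule that[OF r(1)]) (rule main)
qed

subsection \<open>Sequences defined by linear recurrences\<close>

text \<open>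
  The increments satisfy the same recurrence with a bounded source, so they grow at most
  geometrically, at a rate that is uniform in \<open>s\<close>.
\<close>

lemma recurrence_lipschitz_growth:
  fixes u :: "complex \<Rightarrow> nat \<Rightarrow> complex" and \<beta> \<gamma> :: "nat \<Rightarrow> complex \<Rightarrow> complex" and X Y :: "nat \<Rightarrow> nat \<Rightarrow> complex"
  assumes t: "t \<in> U" and diff: "\<And>l. (\<lambda>s. u s l) field_differentiable (at t within U)"
    and bd: "\<And>l. cmod (u t l) \<le> C0"
    and \<beta>: "\<And>i. \<beta> i field_differentiable (at t within U)" and \<gamma>: "\<And>i. \<gamma> i field_differentiable (at t within U)"
    and XY: "\<And>i l. i \<in> {1..d} \<Longrightarrow> l \<ge> N \<Longrightarrow> cmod (X i l) \<le> L \<and> cmod (Y i l) \<le> L" and N: "N \<ge> d"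
    and rec: "\<And>s l. s \<in> U \<Longrightarrow> l \<ge> N \<Longrightarrow> u s l = (\<Sum>i=1..d. (X i l * \<beta> i s + Y i l * \<gamma> i s) * u s (l - i))"
  obtains C R where "C \<ge> 0" "R \<ge> 1" "\<forall>\<^sub>F s in at t within U. \<forall>l. cmod (u s l - u t l) \<le> C * R ^ l * cmod (s - t)"
proof -
  define L' where "L' = max L 0"
  have XY': "cmod (X i l) \<le> L'" "cmod (Y i l) \<le> L'" if "i \<in> {1..d}" "l \<ge> N" for i l
    using XY[OF that] by (auto simp: L'_def)
  have L': "L' \<ge> 0" by (simp add: L'_def)
  have ex: "\<exists>c\<ge>0. \<forall>\<^sub>F s in at t within U. cmod (f s - f t) \<le> c * cmod (s - t)"
    if "f field_differentiable (at t within U)" for f :: "complex \<Rightarrow> complex"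
    using differentiable_imp_lipschitz[OF that] by metis
  obtain cb where cb: "\<And>i. cb i \<ge> 0" "\<And>i. \<forall>\<^sub>F s in at t within U. cmod (\<beta> i s - \<beta> i t) \<le> cb i * cmod (s - t)"
    using ex[OF \<beta>] by metis
  obtain cg where cg: "\<And>i. cg i \<ge> 0" "\<And>i. \<forall>\<^sub>F s in at t within U. cmod (\<gamma> i s - \<gamma> i t) \<le> cg i * cmod (s - t)"
    using ex[OF \<gamma>] by metis
  obtain cu where cu: "\<And>l. cu l \<ge> 0" "\<And>l. \<forall>\<^sub>F s in at t within U. cmod (u s l - u t l) \<le> cu l * cmod (s - t)"
    using ex[OF diff] by metis
  define K where "K = (\<Sum>i=1..d. L' * (cmod (\<beta> i t) + cb i) + L' * (cmod (\<gamma> i t) + cg i))"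
  have K0: "K \<ge> 0" unfolding K_def using L' cb(1) cg(1) by (intro sum_nonneg add_nonneg_nonneg mult_nonneg_nonneg) auto
  have C0: "C0 \<ge> 0" using bd norm_ge_zero order.trans by blast
  (* K bounds the sum of the coefficients of the recurrence near t; the 1 absorbs their variation *)
  define R where "R = K + 1"
  have R: "R \<ge> 1" using K0 by (simp add: R_def)
  define C where "C = (\<Sum>l<N. cu l) + K * C0"
  have Csum: "(\<Sum>l<N. cu l) \<ge> 0" using cu(1) by (intro sum_nonneg) auto
  have C: "C \<ge> 0" using Csum K0 C0 by (simp add: C_def)
  have ev: "\<forall>\<^sub>F s in at t within U. s \<in> U" by (simp add: eventually_at_filter)
  have evb: "\<forall>\<^sub>F s in at t within U. \<forall>i\<in>{1..d}. cmod (\<beta> i s - \<beta> i t) \<le> cb i * cmod (s - t)"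
    using cb(2) by (intro eventually_ball_finite) auto
  have evg: "\<forall>\<^sub>F s in at t within U. \<forall>i\<in>{1..d}. cmod (\<gamma> i s - \<gamma> i t) \<le> cg i * cmod (s - t)"
    using cg(2) by (intro eventually_ball_finite) auto
  have evu: "\<forall>\<^sub>F s in at t within U. \<forall>l\<in>{..<N}. cmod (u s l - u t l) \<le> cu l * cmod (s - t)"
    using cu(2) by (intro eventually_ball_finite) auto
  have "\<forall>\<^sub>F s in at t within U. \<forall>l. cmod (u s l - u t l) \<le> C * R ^ l * cmod (s - t)"
    using ev evb evg evu eventually_close[OF zero_less_one_real]
  proof eventually_elim
    case (elim s)
    let ?\<tau> = "cmod (s - t)"
    have \<tau>: "?\<tau> < 1" by fact
    show ?case
    proof
      fix l show "cmod (u s l - u t l) \<le> C * R ^ l * ?\<tau>"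
      proof (induction l rule: less_induct)
        case (less l)
        have R1: "R ^ l \<ge> 1" using R by (rule one_le_power)
        show ?case
        proof (cases "l < N")
          case True
          then have "cmod (u s l - u t l) \<le> cu l * ?\<tau>" using elim(4) by auto
          also have "\<dots> \<le> C * R ^ l * ?\<tau>"
          proof (rule mult_right_mono)
            have "cu l \<le> (\<Sum>l<N. cu l)" using True cu(1) by (intro member_le_sum) auto
            also have "\<dots> \<le> C * 1" using K0 C0 by (simp add: C_def)
            also have "\<dots> \<le> C * R ^ l" using R1 C by (intro mult_left_mono)
            finally show "cu l \<le> C * R ^ l" .
          qed simp
          finally show ?thesis .
        next
          case False
          then have l: "l \<ge> N" by simp
          define \<alpha> where "\<alpha> = (\<lambda>s i. X i l * \<beta> i s + Y i l * \<gamma> i s)"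
          define \<kappa> where "\<kappa> = (\<lambda>i. L' * (cmod (\<beta> i t) + cb i) + L' * (cmod (\<gamma> i t) + cg i))"
          have tm: "cmod (\<alpha> s i * u s (l - i) - \<alpha> t i * u t (l - i)) \<le> \<kappa> i * (C * R ^ (l - 1) * ?\<tau> + C0 * ?\<tau>)"
            if i: "i \<in> {1..d}" for i
          proof -
            have b: "cmod (\<beta> i s - \<beta> i t) \<le> cb i * ?\<tau>" and g: "cmod (\<gamma> i s - \<gamma> i t) \<le> cg i * ?\<tau>"
              using elim i by auto
            have "cb i * ?\<tau> \<le> cb i * 1" "cg i * ?\<tau> \<le> cg i * 1" using \<tau> cb(1) cg(1) by (intro mult_left_mono; simp)+
            then have bs: "cmod (\<beta> i s) \<le> cmod (\<beta> i t) + cb i" and gs: "cmod (\<gamma> i s) \<le> cmod (\<gamma> i t) + cg i"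
              using b g norm_triangle_sub[of "\<beta> i s" "\<beta> i t"] norm_triangle_sub[of "\<gamma> i s" "\<gamma> i t"] by linarith+
            have "cmod (\<alpha> s i) \<le> cmod (X i l) * cmod (\<beta> i s) + cmod (Y i l) * cmod (\<gamma> i s)"
              unfolding \<alpha>_def norm_mult[symmetric] by (rule norm_triangle_ineq)
            also have "\<dots> \<le> \<kappa> i"
              unfolding \<kappa>_def using XY'[OF i l] bs gs L' by (intro add_mono mult_mono) auto
            finally have as: "cmod (\<alpha> s i) \<le> \<kappa> i" .
            have "\<alpha> s i - \<alpha> t i = X i l * (\<beta> i s - \<beta> i t) + Y i l * (\<gamma> i s - \<gamma> i t)"
              by (simp add: \<alpha>_def algebra_simps)
            moreover have "cmod (X i l * (\<beta> i s - \<beta> i t) + Y i l * (\<gamma> i s - \<gamma> i t)) \<le> cmod (X i l) * cmod (\<beta> i s - \<beta> i t) + cmod (Y i l) * cmod (\<gamma> i s - \<gamma> i t)"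
              unfolding norm_mult[symmetric] by (rule norm_triangle_ineq)
            ultimately have "cmod (\<alpha> s i - \<alpha> t i) \<le> cmod (X i l) * cmod (\<beta> i s - \<beta> i t) + cmod (Y i l) * cmod (\<gamma> i s - \<gamma> i t)"
              by (simp only:)
            also have "\<dots> \<le> L' * (cb i * ?\<tau>) + L' * (cg i * ?\<tau>)"
              using XY'[OF i l] b g L' by (intro add_mono mult_mono) auto
            also have "\<dots> = (L' * cb i + L' * cg i) * ?\<tau>" by (simp add: algebra_simps)
            also have "\<dots> \<le> \<kappa> i * ?\<tau>"
              unfolding \<kappa>_def using L' by (intro mult_right_mono add_mono mult_left_mono) auto
            finally have ad: "cmod (\<alpha> s i - \<alpha> t i) \<le> \<kappa> i * ?\<tau>" .
            have \<kappa>0: "\<kappa> i \<ge> 0" using as norm_ge_zero order.trans by blast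
            have "l - i < l" using i l N by auto
            then have "cmod (u s (l - i) - u t (l - i)) \<le> C * R ^ (l - i) * ?\<tau>" by (rule less.IH)
            also have "\<dots> \<le> C * R ^ (l - 1) * ?\<tau>"
              using i R C by (intro mult_right_mono mult_left_mono power_increasing) auto
            finally have us: "cmod (u s (l - i) - u t (l - i)) \<le> C * R ^ (l - 1) * ?\<tau>" .
            have "\<alpha> s i * u s (l - i) - \<alpha> t i * u t (l - i)
               = \<alpha> s i * (u s (l - i) - u t (l - i)) + (\<alpha> s i - \<alpha> t i) * u t (l - i)"
              by (simp add: algebra_simps)
            moreover have "cmod (\<alpha> s i * (u s (l - i) - u t (l - i)) + (\<alpha> s i - \<alpha> t i) * u t (l - i))
               \<le> cmod (\<alpha> s i) * cmod (u s (l - i) - u t (l - i)) + cmod (\<alpha> s i - \<alpha> t i) * cmod (u t (l - i))"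
              unfolding norm_mult[symmetric] by (rule norm_triangle_ineq)
            ultimately have "cmod (\<alpha> s i * u s (l - i) - \<alpha> t i * u t (l - i))
               \<le> cmod (\<alpha> s i) * cmod (u s (l - i) - u t (l - i)) + cmod (\<alpha> s i - \<alpha> t i) * cmod (u t (l - i))"
              by (simp only:)
            also have "\<dots> \<le> \<kappa> i * (C * R ^ (l - 1) * ?\<tau>) + (\<kappa> i * ?\<tau>) * C0"
              using as us ad bd[of "l - i"] \<kappa>0 by (intro add_mono mult_mono) auto
            finally show ?thesis by (simp add: algebra_simps)
          qed
          have "u s l - u t l = (\<Sum>i=1..d. \<alpha> s i * u s (l - i) - \<alpha> t i * u t (l - i))"
            unfolding sum_subtractf \<alpha>_def using rec[OF elim(1) l] rec[OF t l] by simp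
          then have "cmod (u s l - u t l) \<le> (\<Sum>i=1..d. \<kappa> i * (C * R ^ (l - 1) * ?\<tau> + C0 * ?\<tau>))"
            using sum_norm_le[of "{1..d}", OF tm] by simp
          also have "\<dots> = K * (C * R ^ (l - 1) * ?\<tau> + C0 * ?\<tau>)"
            by (simp add: K_def \<kappa>_def sum_distrib_right)
          also have "\<dots> = (K * C * R ^ (l - 1) + K * C0) * ?\<tau>" by (simp add: algebra_simps)
          also have "\<dots> \<le> C * R ^ l * ?\<tau>"
          proof (rule mult_right_mono)
            show "K * C * R ^ (l - 1) + K * C0 \<le> C * R ^ l"
            proof (cases "d = 0")
              case True
              then show ?thesis using C R by (simp add: K_def)
            next
              case False
              then have "l = Suc (l - 1)" using l N by simp
              then have "C * R ^ l = C * (K + 1) * R ^ (l - 1)" by (metis R_def power_Suc mult.assoc)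
              moreover have "K * C0 * 1 \<le> C * R ^ (l - 1)"
                using one_le_power[OF R, of "l - 1"] Csum C K0 C0 by (intro mult_mono) (auto simp: C_def)
              ultimately show ?thesis by (simp add: algebra_simps)
            qed
          qed simp
          finally show ?thesis .
        qed
      qed
    qed
  qed
  then show ?thesis using that[OF C R] by blast
qed

subsection \<open>Polynomials with differentiable coefficients\<close>

definition coeffs_differentiable :: "complex set \<Rightarrow> complex \<Rightarrow> (complex \<Rightarrow> complex poly) \<Rightarrow> bool" where
  "coeffs_differentiable U t P \<longleftrightarrow> (\<forall>i. (\<lambda>s. coeff (P s) i) field_differentiable (at t within U))"

lemma coeffs_differentiable_const: "coeffs_differentiable U t (\<lambda>s. p)"
  by (simp add: coeffs_differentiable_def)

lemma coeffs_differentiable_add: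
  "coeffs_differentiable U t P \<Longrightarrow> coeffs_differentiable U t Q \<Longrightarrow> coeffs_differentiable U t (\<lambda>s. P s + Q s)"
  by (simp add: coeffs_differentiable_def field_differentiable_add)

lemma coeffs_differentiable_diff:
  "coeffs_differentiable U t P \<Longrightarrow> coeffs_differentiable U t Q \<Longrightarrow> coeffs_differentiable U t (\<lambda>s. P s - Q s)"
  by (simp add: coeffs_differentiable_def field_differentiable_diff)

lemma coeffs_differentiable_smult:
  "c field_differentiable (at t within U) \<Longrightarrow> coeffs_differentiable U t P \<Longrightarrow> coeffs_differentiable U t (\<lambda>s. smult (c s) (P s))"
  by (simp add: coeffs_differentiable_def field_differentiable_mult)

lemma coeffs_differentiable_mult:
  "coeffs_differentiable U t P \<Longrightarrow> coeffs_differentiable U t Q \<Longrightarrow> coeffs_differentiable U t (\<lambda>s. P s * Q s)"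
  unfolding coeffs_differentiable_def coeff_mult
  by (intro allI field_differentiable_sum field_differentiable_mult) auto

lemma coeffs_differentiable_pCons:
  "c field_differentiable (at t within U) \<Longrightarrow> coeffs_differentiable U t P \<Longrightarrow> coeffs_differentiable U t (\<lambda>s. pCons (c s) (P s))"
  unfolding coeffs_differentiable_def
proof
  fix i assume "c field_differentiable at t within U" "\<forall>i. (\<lambda>s. coeff (P s) i) field_differentiable at t within U"
  then show "(\<lambda>s. coeff (pCons (c s) (P s)) i) field_differentiable at t within U" by (cases i) auto
qed

lemma coeffs_differentiable_pderiv:
  "coeffs_differentiable U t P \<Longrightarrow> coeffs_differentiable U t (\<lambda>s. pderiv (P s))"
  by (simp add: coeffs_differentiable_def coeff_pderiv field_differentiable_mult)

lemma coeffs_differentiable_sum: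
  "(\<And>i. i \<in> I \<Longrightarrow> coeffs_differentiable U t (P i)) \<Longrightarrow> coeffs_differentiable U t (\<lambda>s. \<Sum>i\<in>I. P i s)"
  unfolding coeffs_differentiable_def coeff_sum by (intro allI field_differentiable_sum) auto

lemma coeffs_differentiable_prod:
  assumes "\<And>i. i \<in> I \<Longrightarrow> coeffs_differentiable U t (P i)"
  shows "coeffs_differentiable U t (\<lambda>s. \<Prod>i\<in>I. P i s)"
proof (cases "finite I")
  case True
  then show ?thesis using assms
    by (induction I rule: finite_induct) (auto intro: coeffs_differentiable_mult coeffs_differentiable_const)
qed (simp add: coeffs_differentiable_const)

lemma lips_prod:
  assumes "\<And>i. i \<in> I \<Longrightarrow> lips U t (h i) x"
  shows "lips U t (\<lambda>s y. \<Prod>i\<in>I. h i s y) x"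
proof (cases "finite I")
  case True
  then show ?thesis using assms
    by (induction I rule: finite_induct) (auto intro: lips_mult lips_time_independent)
qed (simp add: lips_time_independent)

lemma field_differentiable_cong_on:
  assumes "f field_differentiable (at t within U)" "t \<in> U" "\<And>s. s \<in> U \<Longrightarrow> f s = g s"
  shows "g field_differentiable (at t within U)"
  by (rule field_differentiable_transform_within[OF zero_less_one_real assms(2) _ assms(1)]) (use assms(3) in auto)

lemma degree_moment_poly: "degree (moment_poly u k) \<le> k"
  by (induction k) (auto intro: order.trans[OF degree_pCons_le])

lemma cmod_of_nat_diff:
  assumes "i \<le> l"
  shows "cmod (of_nat i - of_nat l) = real l - real i"
proof -
  have "(of_nat i - of_nat l :: complex) = of_real (real i - real l)" by simp
  then show ?thesis using assms by (simp only: norm_of_real)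
qed

section \<open>The deformed weight\<close>

context semiclassical_deformation
begin

lemma system:
  assumes t: "t \<in> U"
  shows "semiclassical_system m (\<lambda>j. z j t) \<rho> (\<Omega> t) (w t) (\<lambda>n. \<kappa> n t) (\<lambda>n. \<phi> n t) (\<lambda>n. \<phi>b n t)"
proof unfold_locales
  show "2 \<le> m" by (rule m_ge_2)
  show "z 1 t = 0" by (rule z_1[OF t])
  show "inj_on (\<lambda>j. z j t) {1..m}" by (rule distinct_points[OF t])
  show "\<rho> j \<noteq> 0" if "j \<in> {1..m}" for j using exponents[OF that] by auto
  show "open (\<Omega> t)" "closure (\<Omega> t) = UNIV" using cut_plane[OF t] by auto
  show "sphere 0 1 - {- 1} - (\<lambda>j. z j t) ` {1..m} \<subseteq> \<Omega> t" by (rule cuts_on_circle[OF t])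
  show "is_branch m (\<lambda>j. z j t) \<rho> (\<Omega> t) (w t)" by (rule branch[OF t])
  show "\<exists>L. ((\<lambda>\<theta>. w t (cis \<theta>)) \<longlongrightarrow> L) (at_left pi) \<and> ((\<lambda>\<theta>. w t (cis \<theta>)) \<longlongrightarrow> L) (at_right (- pi))"
    by (rule periodic[OF t])
  show "circle_integrable (w t)" using w_integrable[OF t, of 0] by (simp add: circle_integrable_def)
  show "circle_integrable (deriv (w t))" using w'_integrable[OF t, of 0] by (simp add: circle_integrable_def)
qed (use t \<kappa>_nonzero degrees leading_coeffs biorthonormal in auto)

lemma w_circle_integrable: "t \<in> U \<Longrightarrow> circle_integrable (w t)"
  using w_integrable[of t 0] by (simp add: circle_integrable_def)

text \<open>
  The deformation domain is an open subset of the plane or of the real line, and in both cases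
  small balls are connected.
\<close>

lemma connected_neighbourhood:
  assumes t: "t \<in> U" and P: "\<forall>\<^sub>F s in at t within U. P s" "P t"
  obtains X where "connected X" "t \<in> X" "X \<subseteq> U" "\<And>s. s \<in> X \<Longrightarrow> P s" "\<forall>\<^sub>F s in at t within U. s \<in> X"
proof -
  obtain d where d: "d > 0" "\<And>s. s \<in> U \<Longrightarrow> dist s t < d \<Longrightarrow> P s"
    using P unfolding eventually_at by metis
  show ?thesis using deformation_domain
  proof
    assume "open U"
    then obtain e where e: "e > 0" "ball t e \<subseteq> U" using t openE by blast
    show ?thesis
    proof (rule that[of "ball t (min d e)"])
      show "\<forall>\<^sub>F s in at t within U. s \<in> ball t (min d e)"
        unfolding eventually_at using d e by (intro exI[of _ "min d e"]) (auto simp: dist_commute)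
      show "P s" if "s \<in> ball t (min d e)" for s
      proof (rule d(2))
        show "s \<in> U" using e(2) that by (simp add: subset_iff)
        show "dist s t < d" using that by (simp add: dist_commute)
      qed
      show "ball t (min d e) \<subseteq> U" using e(2) by (simp add: subset_iff)
    qed (use d e in auto)
  next
    assume "\<exists>I :: real set. open I \<and> U = complex_of_real ` I"
    then obtain I where I: "open I" "U = complex_of_real ` I" by blast
    then obtain r where r: "r \<in> I" "t = of_real r" using t by blast
    obtain e where e: "e > 0" "ball r e \<subseteq> I" using I r openE by blast
    have dist: "dist (complex_of_real a) (complex_of_real b) = dist a b" for a b
      by (simp add: dist_norm flip: of_real_diff)
    show ?thesis
    proof (rule that[of "complex_of_real ` ball r (min d e)"])
      show "connected (complex_of_real ` ball r (min d e))"
        by (intro connected_continuous_image continuous_intros connected_ball)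
      show "\<forall>\<^sub>F s in at t within U. s \<in> complex_of_real ` ball r (min d e)"
        unfolding eventually_at using d e I r
        by (intro exI[of _ "min d e"]) (auto simp: dist dist_commute)
      show "P s" if s: "s \<in> complex_of_real ` ball r (min d e)" for s
      proof -
        obtain q where q: "q \<in> ball r (min d e)" "s = of_real q" using s by blast
        show ?thesis
        proof (rule d(2))
          have "q \<in> I" using e(2) q(1) by (simp add: subset_iff)
          then show "s \<in> U" using q(2) I(2) by blast
          show "dist s t < d" using q by (simp add: r(2) dist dist_commute)
        qed
      qed
      have "ball r (min d e) \<subseteq> I" using e(2) by (simp add: subset_iff)
      then show "complex_of_real ` ball r (min d e) \<subseteq> U" using I(2) by blast
      show "t \<in> complex_of_real ` ball r (min d e)"
        unfolding r(2) using d e by (intro imageI) simp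
    qed
  qed
qed

lemma at_within_nontrivial:
  assumes t: "t \<in> U"
  shows "at t within U \<noteq> bot"
  using deformation_domain
proof
  assume U: "open U"
  show ?thesis unfolding at_within_open[OF t U] by (rule trivial_limit_at)
next
  assume "\<exists>I :: real set. open I \<and> U = complex_of_real ` I"
  then obtain I where I: "open I" "U = complex_of_real ` I" by blast
  then obtain r where r: "r \<in> I" "t = of_real r" using t by blast
  obtain e where e: "e > 0" "ball r e \<subseteq> I" using I r openE by blast
  have "t islimpt U"
    unfolding islimpt_approachable
  proof (intro allI impI)
    fix d :: real assume d: "d > 0"
    define q where "q = r + min d e / 2"
    have q: "q \<noteq> r" "dist q r < d" "dist q r < e" using d e by (auto simp: q_def dist_norm)
    then have "q \<in> I" using e by (auto simp: dist_commute subset_iff)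
    moreover have "dist (complex_of_real q) t = dist q r"
      by (simp add: r dist_norm flip: of_real_diff)
    ultimately show "\<exists>x'\<in>U. x' \<noteq> t \<and> dist x' t < d"
      using q I r by (intro bexI[of _ "of_real q"]) auto
  qed
  then show ?thesis using trivial_limit_within by blast
qed

lemma derivative_unique:
  assumes t: "t \<in> U" and "(f has_field_derivative d1) (at t within U)" "(f has_field_derivative d2) (at t within U)"
  shows "d1 = d2"
  using assms(2,3) tendsto_unique[OF at_within_nontrivial[OF t]] unfolding has_field_derivative_iff by blast

lemma ddt_eqI:
  assumes "t \<in> U" "(f has_field_derivative d) (at t within U)"
  shows "ddt U f t = d"
  unfolding ddt_def using assms derivative_unique by blast

lemma ddt_has_field_derivative:
  assumes t: "t \<in> U" and f: "f field_differentiable (at t within U)"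
  shows "(f has_field_derivative ddt U f t) (at t within U)"
  using f ddt_eqI[OF t] unfolding field_differentiable_def by blast

lemma z_continuous:
  assumes "j \<in> {1..m}" "t \<in> U"
  shows "continuous (at t within U) (z j)"
  using points_differentiable[OF assms] by (rule field_differentiable_imp_continuous_at)

subsection \<open>The derivative of the branch\<close>

lemma w_deformation_derivative:
  assumes t: "t \<in> U" and x: "x \<in> \<Omega> t"
  shows "((\<lambda>s. w s x) has_field_derivative - (\<Sum>j=1..m. \<rho> j * (ddt U (z j) t / (x - z j t))) * w t x) (at t within U)"
proof -
  have xz: "x - z j s \<noteq> 0" if "j \<in> {1..m}" "s \<in> U" "x \<in> \<Omega> s" for j s
  proof -
    interpret S: semiclassical_system m "\<lambda>j. z j s" \<rho> "\<Omega> s" "w s" "\<lambda>n. \<kappa> n s" "\<lambda>n. \<phi> n s" "\<lambda>n. \<phi>b n s"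
      by (rule system[OF that(2)])
    show ?thesis using S.D_avoids_points[OF that(3)] that(1) by auto
  qed
  have "\<forall>\<^sub>F s in at t within U. \<forall>j\<in>{1..m}. Re ((x - z j s) / (x - z j t)) > 0"
  proof (intro eventually_ball_finite ballI)
    fix j assume j: "j \<in> {1..m}"
    have "(z j \<longlongrightarrow> z j t) (at t within U)" using z_continuous[OF j t] by (simp add: continuous_within)
    then have "((\<lambda>s. Re ((x - z j s) / (x - z j t))) \<longlongrightarrow> Re ((x - z j t) / (x - z j t))) (at t within U)"
      by (intro tendsto_intros xz[OF j t x]) 
    moreover have "(x - z j t) / (x - z j t) = 1" using xz[OF j t x] by simp
    ultimately show "\<forall>\<^sub>F s in at t within U. Re ((x - z j s) / (x - z j t)) > 0"
      by (intro order_tendstoD(1)) auto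
  qed simp
  then have ev: "\<forall>\<^sub>F s in at t within U. x \<in> \<Omega> s \<and> (\<forall>j\<in>{1..m}. Re ((x - z j s) / (x - z j t)) > 0)"
    using cuts_move[OF t x] by eventually_elim auto
  have "x \<in> \<Omega> t \<and> (\<forall>j\<in>{1..m}. Re ((x - z j t) / (x - z j t)) > 0)"
    using x xz[OF _ t x] by simp
  then obtain X where X: "connected X" "t \<in> X" "X \<subseteq> U"
    "\<And>s. s \<in> X \<Longrightarrow> x \<in> \<Omega> s \<and> (\<forall>j\<in>{1..m}. Re ((x - z j s) / (x - z j t)) > 0)"
    "\<forall>\<^sub>F s in at t within U. s \<in> X"
    using connected_neighbourhood[OF t ev] by metis
  have eq: "w s x = w t x * exp (\<Sum>j=1..m. \<rho> j * Ln ((x - z j s) / (x - z j t)))" if "s \<in> X" for s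
  proof (rule branch_continuation[where X = X and b = "\<lambda>j s. x - z j s" and f = "\<lambda>s. w s x"])
    show "continuous_on X (\<lambda>s. w s x)"
      unfolding continuous_on_eq_continuous_within
    proof
      fix s assume s: "s \<in> X"
      then have "continuous (at s within U) (\<lambda>s. w s x)" using X by (intro branch_continued) auto
      then show "continuous (at s within X) (\<lambda>s. w s x)" using X(3) continuous_within_subset by blast
    qed
    show "continuous_on X (\<lambda>s. x - z j s)" if j: "j \<in> {1..m}" for j
      unfolding continuous_on_eq_continuous_within
    proof
      fix s assume s: "s \<in> X"
      then have "continuous (at s within U) (z j)" using X j by (intro z_continuous) auto
      then have "continuous (at s within X) (z j)" using X(3) continuous_within_subset by blast
      then show "continuous (at s within X) (\<lambda>s. x - z j s)" by (intro continuous_intros)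
    qed
    show "\<exists>l. (\<forall>j\<in>{1..m}. exp (l j) = x - z j s) \<and> w s x = exp (\<Sum>j=1..m. \<rho> j * l j)" if "s \<in> X" for s
      using branch[of s] X(3,4) that unfolding is_branch_def by blast
  qed (use X that in auto)
  have ne: "(x - z j t) / (x - z j t) = 1" if "j \<in> {1..m}" for j using xz[OF that t x] by simp
  have dz: "((\<lambda>s. Ln ((x - z j s) / (x - z j t))) has_field_derivative - (ddt U (z j) t / (x - z j t))) (at t within U)"
    if j: "j \<in> {1..m}" for j
  proof -
    have z: "(z j has_field_derivative ddt U (z j) t) (at t within U)"
      by (rule ddt_has_field_derivative[OF t points_differentiable[OF j t]])
    have "(Ln has_field_derivative inverse ((x - z j t) / (x - z j t))) (at ((x - z j t) / (x - z j t)))"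
      by (rule has_field_derivative_Ln) (unfold ne[OF j], simp)
    from DERIV_chain2[OF this DERIV_cdivide[OF DERIV_diff[OF DERIV_const z]]]
    show ?thesis using xz[OF j t x] by (simp add: ne[OF j])
  qed
  have "((\<lambda>s. w t x * exp (\<Sum>j=1..m. \<rho> j * Ln ((x - z j s) / (x - z j t)))) has_field_derivative
     w t x * (exp (\<Sum>j=1..m. \<rho> j * Ln ((x - z j t) / (x - z j t))) * (\<Sum>j=1..m. \<rho> j * - (ddt U (z j) t / (x - z j t))))) (at t within U)"
    by (intro DERIV_cmult DERIV_chain2[OF DERIV_exp] DERIV_sum dz)
  moreover have "(\<Sum>j=1..m. \<rho> j * Ln ((x - z j t) / (x - z j t))) = 0"
    by (intro sum.neutral ballI) (simp only: ne Ln_1 mult_zero_right)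
  ultimately have d: "((\<lambda>s. w t x * exp (\<Sum>j=1..m. \<rho> j * Ln ((x - z j s) / (x - z j t)))) has_field_derivative
     - (\<Sum>j=1..m. \<rho> j * (ddt U (z j) t / (x - z j t))) * w t x) (at t within U)"
    by (simp add: sum_negf mult.commute)
  have ev: "\<forall>\<^sub>F s in at t within U. w s x = w t x * exp (\<Sum>j=1..m. \<rho> j * Ln ((x - z j s) / (x - z j t)))"
    using X(5) by eventually_elim (rule eq)
  show ?thesis
    unfolding has_field_derivative_cong_eventually[where f = "\<lambda>s. w s x", OF ev eq[OF X(2)]] by (rule d)
qed

subsection \<open>Differentiability of the moments\<close>

lemma kappa_differentiable: "t \<in> U \<Longrightarrow> \<kappa> n field_differentiable (at t within U)"
  using field_differentiable_cong_on[of "\<lambda>s. coeff (\<phi> n s) n"] coeffs_differentiable leading_coeffs by blast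

lemma inverse_kappa_differentiable: "t \<in> U \<Longrightarrow> (\<lambda>s. 1 / \<kappa> n s) field_differentiable (at t within U)"
  by (intro field_differentiable_divide kappa_differentiable \<kappa>_nonzero field_differentiable_const)

text \<open>
  Orthogonality to constants expresses the \<open>k\<close>-th moment by lower ones and the coefficients of
  the polynomials, which are differentiable.
\<close>

lemma triangular_moments_differentiable:
  assumes t: "t \<in> U"
    and p: "\<And>k i. (\<lambda>s. coeff (p k s) i) field_differentiable (at t within U)"
    and lead: "\<And>s k. s \<in> U \<Longrightarrow> coeff (p k s) k = \<kappa> k s"
    and rel: "\<And>s k. s \<in> U \<Longrightarrow> (\<Sum>i\<le>k. coeff (p k s) i * L i s) = (if k = 0 then 1 / \<kappa> 0 s else 0)"
  shows "L k field_differentiable (at t within U)"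
proof (induction k rule: less_induct)
  case (less k)
  have "(\<lambda>s. ((if k = 0 then 1 / \<kappa> 0 s else 0) - (\<Sum>i<k. coeff (p k s) i * L i s)) * (1 / \<kappa> k s)) field_differentiable (at t within U)"
  proof (intro field_differentiable_mult field_differentiable_diff field_differentiable_sum p less.IH inverse_kappa_differentiable[OF t])
    show "(\<lambda>s. if k = 0 then 1 / \<kappa> 0 s else 0) field_differentiable (at t within U)"
      using inverse_kappa_differentiable[OF t] by (cases "k = 0") auto
  qed auto
  then show ?case
  proof (rule field_differentiable_cong_on[OF _ t])
    fix s assume s: "s \<in> U"
    have "(\<Sum>i\<le>k. coeff (p k s) i * L i s) = (\<Sum>i<k. coeff (p k s) i * L i s) + \<kappa> k s * L k s"
      using lead[OF s] by (simp add: lessThan_Suc_atMost[symmetric])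
    then show "((if k = 0 then 1 / \<kappa> 0 s else 0) - (\<Sum>i<k. coeff (p k s) i * L i s)) * (1 / \<kappa> k s) = L k s"
      using rel[OF s, of k] \<kappa>_nonzero[OF s, of k] by simp
  qed
qed

lemma moment_differentiable:
  assumes t: "t \<in> U"
  shows "(\<lambda>s. moment (w s) k) field_differentiable (at t within U)"
proof (cases "k \<le> 0")
  case True
  have "(\<lambda>s. moment (w s) (- int (nat (- k)))) field_differentiable (at t within U)"
  proof (rule triangular_moments_differentiable[where p = \<phi> and L = "\<lambda>i s. moment (w s) (- int i)", OF t])
    fix s n assume s: "s \<in> U"
    interpret S: semiclassical_system m "\<lambda>j. z j s" \<rho> "\<Omega> s" "w s" "\<lambda>n. \<kappa> n s" "\<lambda>n. \<phi> n s" "\<lambda>n. \<phi>b n s"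
      by (rule system[OF s])
    have "circle_mean (\<lambda>\<zeta>. poly (\<phi> n s) \<zeta> * w s \<zeta>) = (if n = 0 then 1 / \<kappa> 0 s else 0)"
      using S.moment_u[of 0 n] by (auto simp: moment_def mult.commute)
    then show "(\<Sum>i\<le>n. coeff (\<phi> n s) i * moment (w s) (- int i)) = (if n = 0 then 1 / \<kappa> 0 s else 0)"
      using circle_mean_poly_mult[OF S.w_integrable, of "\<phi> n s" n] S.degree_phi by simp
  qed (use coeffs_differentiable[OF t] leading_coeffs in auto)
  then show ?thesis using True by simp
next
  case False
  have "(\<lambda>s. moment (w s) (int (nat k))) field_differentiable (at t within U)"
  proof (rule triangular_moments_differentiable[where p = \<phi>b and L = "\<lambda>i s. moment (w s) (int i)", OF t])
    fix s n assume s: "s \<in> U"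
    interpret S: semiclassical_system m "\<lambda>j. z j s" \<rho> "\<Omega> s" "w s" "\<lambda>n. \<kappa> n s" "\<lambda>n. \<phi> n s" "\<lambda>n. \<phi>b n s"
      by (rule system[OF s])
    have "circle_mean (\<lambda>\<zeta>. w s \<zeta> * poly (\<phi>b n s) (1 / \<zeta>)) = (if n = 0 then 1 / \<kappa> 0 s else 0)"
      using S.moment_v[of 0 n] by (auto simp: moment_def)
    then show "(\<Sum>i\<le>n. coeff (\<phi>b n s) i * moment (w s) (int i)) = (if n = 0 then 1 / \<kappa> 0 s else 0)"
      using circle_mean_reflect_poly_mult[OF S.w_integrable, of "\<phi>b n s" n] S.degree_phib by simp
  qed (use coeffs_differentiable[OF t] leading_coeffs in auto)
  then show ?thesis using False by simp
qed

abbreviation "Wd s \<equiv> pearson_W m (\<lambda>j. z j s)"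
abbreviation "Vd s \<equiv> pearson_V m (\<lambda>j. z j s) \<rho>"
abbreviation "Qd s \<equiv> pearson_source m (\<lambda>j. z j s) \<rho> (w s)"

lemma linear_factor_differentiable:
  "t \<in> U \<Longrightarrow> j \<in> {1..m} \<Longrightarrow> coeffs_differentiable U t (\<lambda>s. [:- z j s, 1:])"
  by (intro coeffs_differentiable_pCons coeffs_differentiable_const field_differentiable_minus points_differentiable)

lemma Wd_differentiable: "t \<in> U \<Longrightarrow> coeffs_differentiable U t Wd"
  unfolding pearson_W_def by (intro coeffs_differentiable_prod linear_factor_differentiable)

lemma Vd_differentiable: "t \<in> U \<Longrightarrow> coeffs_differentiable U t Vd"
  unfolding pearson_V_def
  by (intro coeffs_differentiable_sum coeffs_differentiable_smult field_differentiable_const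
      coeffs_differentiable_prod linear_factor_differentiable) auto

lemma moment_poly_differentiable:
  assumes "t \<in> U"
  shows "coeffs_differentiable U t (\<lambda>s. moment_poly (w s) k)"
  by (induction k)
    (simp_all add: coeffs_differentiable_const coeffs_differentiable_pCons moment_differentiable[OF assms])

lemma coeff_differentiableD: "coeffs_differentiable U t P \<Longrightarrow> (\<lambda>s. coeff (P s) i) field_differentiable (at t within U)"
  by (simp add: coeffs_differentiable_def)

lemma Qd_differentiable: "t \<in> U \<Longrightarrow> coeffs_differentiable U t Qd"
  unfolding pearson_source_def
  by (intro coeffs_differentiable_sum coeffs_differentiable_diff coeffs_differentiable_smult
      coeff_differentiableD coeffs_differentiable_add coeffs_differentiable_pderiv
      moment_poly_differentiable Wd_differentiable Vd_differentiable)

lemma degree_Qd: "degree (Qd s) \<le> m"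
  unfolding pearson_source_def
proof (intro degree_sum_le)
  fix i assume i: "i \<in> {..m}"
  have "degree (moment_poly (w s) i) \<le> m" "degree (pderiv (moment_poly (w s) i)) \<le> m"
    using degree_moment_poly[of "w s" i] i by (auto simp: degree_pderiv)
  then show "degree (smult (coeff (pderiv (Wd s) + Vd s) i) (moment_poly (w s) i) - smult (coeff (Wd s) i) (pderiv (moment_poly (w s) i))) \<le> m"
    by (intro degree_diff_le order.trans[OF degree_smult_le])
qed simp

subsection \<open>Geometric growth of the increments of the moments\<close>

text \<open>
  The lowest coefficient of \<open>W\<close> vanishes because the origin is a singular point; the next one gives
  the factor \<open>l - \<rho> 1\<close>, and the recurrence can be solved for the moment of largest index when \<open>l\<close> is
  large.
\<close>

lemma positive_moments_growth:
  assumes t: "t \<in> U"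
  obtains C R where "C \<ge> 0" "R \<ge> 1"
    "\<forall>\<^sub>F s in at t within U. \<forall>l. cmod (moment (w s) (int l) - moment (w t) (int l)) \<le> C * R ^ l * cmod (s - t)"
proof -
  (* from N on, the divisor l - \<rho> 1 is at least l / 2 *)
  define N where "N = nat \<lceil>2 * cmod (\<rho> 1)\<rceil> + m + 2"
  have N: "real N \<ge> 2 * cmod (\<rho> 1) + 2" "N \<ge> m + 2" unfolding N_def by linarith+
  have big: "cmod (of_nat l - \<rho> 1) \<ge> real l / 2" if "l \<ge> N" for l
  proof -
    have "cmod (of_nat l - \<rho> 1) \<ge> real l - cmod (\<rho> 1)"
      using norm_triangle_ineq2[of "of_nat l" "\<rho> 1"] by simp
    then show ?thesis using N that by linarith
  qed
  have "\<exists>C R. C \<ge> 0 \<and> R \<ge> 1 \<and> (\<forall>\<^sub>F s in at t within U. \<forall>l. cmod (moment (w s) (int l) - moment (w t) (int l)) \<le> C * R ^ l * cmod (s - t))"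
  proof (rule recurrence_lipschitz_growth[where u = "\<lambda>s l. moment (w s) (int l)" and d = "m - 1" and N = N and L = 2
      and \<beta> = "\<lambda>i s. coeff (Wd s) (Suc i) / coeff (Wd s) 1" and \<gamma> = "\<lambda>i s. coeff (Vd s) i / coeff (Wd s) 1"
      and X = "\<lambda>i l. (of_nat i - of_nat l) / (of_nat l - \<rho> 1)" and Y = "\<lambda>i l. 1 / (of_nat l - \<rho> 1)", OF t])
    show "(\<lambda>s. moment (w s) (int l)) field_differentiable at t within U" for l by (rule moment_differentiable[OF t])
    show "cmod (moment (w t) (int l)) \<le> circle_norm (w t)" for l by (rule moment_le[OF w_circle_integrable[OF t]])
    interpret S0: semiclassical_system m "\<lambda>j. z j t" \<rho> "\<Omega> t" "w t" "\<lambda>n. \<kappa> n t" "\<lambda>n. \<phi> n t" "\<lambda>n. \<phi>b n t"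
      by (rule system[OF t])
    show "(\<lambda>s. coeff (Wd s) (Suc i) / coeff (Wd s) 1) field_differentiable at t within U" for i
      by (intro field_differentiable_divide coeff_differentiableD Wd_differentiable t S0.coeff_Wp_1_nonzero)
    show "(\<lambda>s. coeff (Vd s) i / coeff (Wd s) 1) field_differentiable at t within U" for i
      by (intro field_differentiable_divide coeff_differentiableD Wd_differentiable Vd_differentiable t S0.coeff_Wp_1_nonzero)
    show "cmod ((of_nat i - of_nat l) / (of_nat l - \<rho> 1)) \<le> 2 \<and> cmod (1 / (of_nat l - \<rho> 1)) \<le> 2"
      if i: "i \<in> {1..m - 1}" and l: "l \<ge> N" for i l
    proof -
      have pos: "cmod (of_nat l - \<rho> 1) > 0" "real l \<ge> 1" using big[OF l] N(2) l by auto
      have "cmod (of_nat i - of_nat l) = real l - real i"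
        using i l N by (intro cmod_of_nat_diff) auto
      then have "cmod (of_nat i - of_nat l) \<le> 2 * cmod (of_nat l - \<rho> 1)" using big[OF l] by simp
      moreover have "1 \<le> 2 * cmod (of_nat l - \<rho> 1)" using big[OF l] pos by linarith
      ultimately show ?thesis using pos by (simp add: norm_divide divide_le_eq)
    qed
    show "N \<ge> m - 1" using N by simp
    show "moment (w s) (int l) = (\<Sum>i = 1..m - 1.
            ((of_nat i - of_nat l) / (of_nat l - \<rho> 1) * (coeff (Wd s) (Suc i) / coeff (Wd s) 1) +
             1 / (of_nat l - \<rho> 1) * (coeff (Vd s) i / coeff (Wd s) 1)) * moment (w s) (int (l - i)))"
      if s: "s \<in> U" and l: "l \<ge> N" for s l
    proof -
      interpret S: semiclassical_system m "\<lambda>j. z j s" \<rho> "\<Omega> s" "w s" "\<lambda>n. \<kappa> n s" "\<lambda>n. \<phi> n s" "\<lambda>n. \<phi>b n s"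
        by (rule system[OF s])
      let ?W = "coeff (Wd s)" and ?V = "coeff (Vd s)"
      let ?T = "\<lambda>i. ((of_nat i - of_int (int l + 1)) * ?W i + coeff (pCons 0 (Vd s)) i) * moment (w s) (int l + 1 - int i)"
      have "(0::nat) \<in> {..m}" "1 \<in> {..m} - {0}" using m_ge_2 by auto
      then have "(\<Sum>i\<le>m. ?T i) = ?T 0 + (?T 1 + (\<Sum>i\<in>{..m} - {0} - {1}. ?T i))"
        by (subst sum.remove[of _ 0], simp, simp, subst sum.remove[of _ 1]) auto
      moreover have "(\<Sum>i\<in>{..m} - {0} - {1}. ?T i) = (\<Sum>i=1..m - 1. ?T (Suc i))"
      proof -
        have "{..m} - {0} - {1} = Suc ` {1..m - 1}"
          using m_ge_2 by (auto simp: image_iff intro!: bexI[of _ "_ - 1"])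
        then show ?thesis by (simp only: sum.reindex[OF inj_on_subset[OF inj_Suc subset_UNIV]] comp_def)
      qed
      moreover have "?T 0 = 0" using S.coeff_Wp_0 by simp
      moreover have "?T 1 = - (of_nat l - \<rho> 1) * ?W 1 * moment (w s) (int l)"
        using S.coeff_Vp_0 by (simp add: algebra_simps)
      ultimately have "0 + (- (of_nat l - \<rho> 1) * ?W 1 * moment (w s) (int l) + (\<Sum>i=1..m - 1. ?T (Suc i))) = 0"
        using S.moment_recurrence[of "int l + 1"] by (simp only:)
      then have eq: "(of_nat l - \<rho> 1) * ?W 1 * moment (w s) (int l) = (\<Sum>i=1..m - 1. ?T (Suc i))"
        by (simp only: add_0_left mult_minus_left add.commute[of "- _"] diff_conv_add_uminus[symmetric] right_minus_eq)
      have ne: "of_nat l - \<rho> 1 \<noteq> 0" "?W 1 \<noteq> 0"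
        using big[OF l] N l S.coeff_Wp_1_nonzero by auto
      then have "moment (w s) (int l) = (\<Sum>i=1..m - 1. ?T (Suc i)) / ((of_nat l - \<rho> 1) * ?W 1)"
        unfolding eq[symmetric] by simp
      also have "\<dots> = (\<Sum>i = 1..m - 1. ((of_nat i - of_nat l) / (of_nat l - \<rho> 1) * (?W (Suc i) / ?W 1) +
             1 / (of_nat l - \<rho> 1) * (?V i / ?W 1)) * moment (w s) (int (l - i)))"
        unfolding sum_divide_distrib
      proof (intro sum.cong refl)
        fix i assume "i \<in> {1..m - 1}"
        then have "int l + 1 - int (Suc i) = int (l - i)" using l N by auto
        moreover have "of_nat (Suc i) - of_int (int l + 1) = (of_nat i - of_nat l :: complex)" by simp
        ultimately have T: "?T (Suc i) = ((of_nat i - of_nat l) * ?W (Suc i) + ?V i) * moment (w s) (int (l - i))"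
          by (simp only: coeff_pCons_Suc)
        show "?T (Suc i) / ((of_nat l - \<rho> 1) * ?W 1) = ((of_nat i - of_nat l) / (of_nat l - \<rho> 1) * (?W (Suc i) / ?W 1) +
             1 / (of_nat l - \<rho> 1) * (?V i / ?W 1)) * moment (w s) (int (l - i))"
          unfolding T using ne by (simp add: divide_simps)
      qed
      finally show ?thesis .
    qed
  qed blast
  then show ?thesis using that by blast
qed

text \<open>
  Here the top coefficient 1 of \<open>W\<close> is used; it comes with the factor \<open>l + \<Sum>\<rho> j\<close>.
\<close>

lemma negative_moments_growth:
  assumes t: "t \<in> U"
  obtains C R where "C \<ge> 0" "R \<ge> 1"
    "\<forall>\<^sub>F s in at t within U. \<forall>l. cmod (moment (w s) (- int l) - moment (w t) (- int l)) \<le> C * R ^ l * cmod (s - t)"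
proof -
  define \<sigma> where "\<sigma> = (\<Sum>j=1..m. \<rho> j)"
  (* from N on, the divisor l + \<sigma> is at least l / 2 *)
  define N where "N = nat \<lceil>2 * cmod \<sigma>\<rceil> + m + 2"
  have N: "real N \<ge> 2 * cmod \<sigma> + 2" "N \<ge> m + 2" unfolding N_def by linarith+
  have big: "cmod (of_nat l + \<sigma>) \<ge> real l / 2" if "l \<ge> N" for l
  proof -
    have "cmod (of_nat l + \<sigma>) \<ge> real l - cmod \<sigma>"
      using norm_diff_ineq[of "of_nat l" \<sigma>] by simp
    then show ?thesis using N that by linarith
  qed
  have "\<exists>C R. C \<ge> 0 \<and> R \<ge> 1 \<and> (\<forall>\<^sub>F s in at t within U. \<forall>l. cmod (moment (w s) (- int l) - moment (w t) (- int l)) \<le> C * R ^ l * cmod (s - t))"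
  proof (rule recurrence_lipschitz_growth[where u = "\<lambda>s l. moment (w s) (- int l)" and d = m and N = N and L = 2
      and \<beta> = "\<lambda>i s. coeff (Wd s) (m - i)" and \<gamma> = "\<lambda>i s. coeff (pCons 0 (Vd s)) (m - i)"
      and X = "\<lambda>i l. (of_nat i - of_nat l) / (of_nat l + \<sigma>)" and Y = "\<lambda>i l. - 1 / (of_nat l + \<sigma>)", OF t])
    show "(\<lambda>s. moment (w s) (- int l)) field_differentiable at t within U" for l by (rule moment_differentiable[OF t])
    show "cmod (moment (w t) (- int l)) \<le> circle_norm (w t)" for l by (rule moment_le[OF w_circle_integrable[OF t]])
    show "(\<lambda>s. coeff (Wd s) (m - i)) field_differentiable at t within U" for i
      by (intro coeff_differentiableD Wd_differentiable t)
    show "(\<lambda>s. coeff (pCons 0 (Vd s)) (m - i)) field_differentiable at t within U" for i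
      by (intro coeff_differentiableD[of _ "\<lambda>s. pCons 0 (Vd s)"] coeffs_differentiable_pCons Vd_differentiable t field_differentiable_const)
    show "cmod ((of_nat i - of_nat l) / (of_nat l + \<sigma>)) \<le> 2 \<and> cmod (- 1 / (of_nat l + \<sigma>)) \<le> 2"
      if i: "i \<in> {1..m}" and l: "l \<ge> N" for i l
    proof -
      have pos: "cmod (of_nat l + \<sigma>) > 0" "real l \<ge> 1" using big[OF l] N(2) l by auto
      have "cmod (of_nat i - of_nat l) = real l - real i"
        using i l N by (intro cmod_of_nat_diff) auto
      then have "cmod (of_nat i - of_nat l) \<le> 2 * cmod (of_nat l + \<sigma>)" using big[OF l] by simp
      moreover have "1 \<le> 2 * cmod (of_nat l + \<sigma>)" using big[OF l] pos by linarith
      ultimately show ?thesis using pos by (simp add: norm_divide divide_le_eq)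
    qed
    show "N \<ge> m" using N by simp
    show "moment (w s) (- int l) = (\<Sum>i = 1..m.
            ((of_nat i - of_nat l) / (of_nat l + \<sigma>) * coeff (Wd s) (m - i) +
             - 1 / (of_nat l + \<sigma>) * coeff (pCons 0 (Vd s)) (m - i)) * moment (w s) (- int (l - i)))"
      if s: "s \<in> U" and l: "l \<ge> N" for s l
    proof -
      interpret S: semiclassical_system m "\<lambda>j. z j s" \<rho> "\<Omega> s" "w s" "\<lambda>n. \<kappa> n s" "\<lambda>n. \<phi> n s" "\<lambda>n. \<phi>b n s"
        by (rule system[OF s])
      let ?W = "coeff (Wd s)" and ?V = "coeff (pCons 0 (Vd s))"
      let ?T = "\<lambda>i. ((of_nat i - of_int (int m - int l)) * ?W i + ?V i) * moment (w s) (int m - int l - int i)"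
      have ne: "of_nat l + \<sigma> \<noteq> 0" using big[OF l] N l by auto
      have "(\<Sum>i\<le>m. ?T i) = ?T m + (\<Sum>i\<in>{..m} - {m}. ?T i)"
        by (subst sum.remove[of _ m]) auto
      moreover have "(\<Sum>i\<in>{..m} - {m}. ?T i) = (\<Sum>i=1..m. ?T (m - i))"
        by (rule sum.reindex_bij_witness[of _ "\<lambda>i. m - i" "\<lambda>i. m - i"]) auto
      moreover have "?T m = (of_nat l + \<sigma>) * moment (w s) (- int l)"
      proof -
        have "?V m = \<sigma>" using S.coeff_Vp m_ge_2 by (cases m) (auto simp: \<sigma>_def)
        then show ?thesis using S.coeff_Wp_m by simp
      qed
      ultimately have "(of_nat l + \<sigma>) * moment (w s) (- int l) + (\<Sum>i=1..m. ?T (m - i)) = 0"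
        using S.moment_recurrence[of "int m - int l"] by (simp only:)
      then have eq: "(of_nat l + \<sigma>) * moment (w s) (- int l) = - (\<Sum>i=1..m. ?T (m - i))"
        by (simp only: eq_neg_iff_add_eq_0)
      have "moment (w s) (- int l) = (of_nat l + \<sigma>) * moment (w s) (- int l) / (of_nat l + \<sigma>)"
        using ne by simp
      also have "\<dots> = (\<Sum>i=1..m. - ?T (m - i) / (of_nat l + \<sigma>))"
        unfolding eq by (simp add: sum_negf sum_divide_distrib)
      also have "\<dots> = (\<Sum>i = 1..m. ((of_nat i - of_nat l) / (of_nat l + \<sigma>) * ?W (m - i) +
             - 1 / (of_nat l + \<sigma>) * ?V (m - i)) * moment (w s) (- int (l - i)))"
      proof (intro sum.cong refl)
        fix i assume i: "i \<in> {1..m}"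
        then have "int m - int l - int (m - i) = - int (l - i)" using l N by auto
        moreover have "of_nat (m - i) - of_int (int m - int l) = (of_nat l - of_nat i :: complex)"
          using i by (simp add: of_nat_diff)
        ultimately have T: "?T (m - i) = ((of_nat l - of_nat i) * ?W (m - i) + ?V (m - i)) * moment (w s) (- int (l - i))"
          by (simp only:)
        show "- ?T (m - i) / (of_nat l + \<sigma>) = ((of_nat i - of_nat l) / (of_nat l + \<sigma>) * ?W (m - i) +
             - 1 / (of_nat l + \<sigma>) * ?V (m - i)) * moment (w s) (- int (l - i))"
          unfolding T using ne by (simp add: divide_simps) (simp add: algebra_simps)
      qed
      finally show ?thesis .
    qed
  qed blast
  then show ?thesis using that by blast
qed

end

section \<open>Lipschitz dependence of the associated functions\<close>

lemma dense_open_minus_nowhere_dense: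
  fixes E N :: "complex set"
  assumes "open E" "closure E = UNIV" "interior N = {}"
  shows "closure (E - N) = UNIV"
proof -
  have "closure (- N) = UNIV" using assms(3) by (simp add: closure_complement)
  then have "E \<subseteq> closure (E \<inter> - N)" using open_Int_closure_subset[OF assms(1), of "- N"] by simp
  then have "closure E \<subseteq> closure (E \<inter> - N)" by (rule closure_minimal) simp
  then show ?thesis using assms(2) by (auto simp: Diff_eq)
qed

lemma interior_circle_union_finite:
  assumes "finite F"
  shows "interior (sphere 0 1 \<union> F :: complex set) = {}"
proof -
  have "negligible (sphere 0 1 \<union> F :: complex set)"
    using assms by (intro negligible_Un negligible_sphere negligible_finite)
  then have "negligible (interior (sphere 0 1 \<union> F))"
    using interior_subset by (rule negligible_subset)
  then show ?thesis using open_not_negligible[OF open_interior] by metis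
qed

context semiclassical_deformation
begin

abbreviation transform_bounded :: "complex \<Rightarrow> complex \<Rightarrow> bool" where
  "transform_bounded t x \<equiv> (\<exists>K. \<forall>\<^sub>F s in at t within U.
     cmod (cauchy_moment (w s) 1 x - cauchy_moment (w t) 1 x) \<le> K * cmod (s - t))"

lemma eventually_in_domain: "\<forall>\<^sub>F s in at t within U. s \<in> U"
  by (simp add: eventually_at_filter)

text \<open>
  For \<open>k \<le> 1\<close> the Taylor coefficients at 0 are moments of nonnegative index, whose increments grow
  geometrically.
\<close>

lemma cauchy_moment_lips_at_0:
  assumes t: "t \<in> U" and k: "k \<le> 1"
  shows "lips U t (\<lambda>s. cauchy_moment (w s) k) 0"
proof -
  obtain C R where CR: "C \<ge> 0" "R \<ge> 1"
    "\<forall>\<^sub>F s in at t within U. \<forall>l. cmod (moment (w s) (int l) - moment (w t) (int l)) \<le> C * R ^ l * cmod (s - t)"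
    by (rule positive_moments_growth[OF t]) (rule that)
  define p where "p = nat (1 - k)"
  have p: "int p = 1 - k" using k by (simp add: p_def)
  have "isCont (cauchy_moment (w t) k) 0"
    by (rule DERIV_isCont[OF cauchy_moment_has_field_derivative[OF w_circle_integrable[OF t]]]) simp
  then obtain r0 where r0: "r0 > 0" "\<And>y. y \<in> ball 0 r0 \<Longrightarrow> cmod (cauchy_moment (w t) k y) \<le> cmod (cauchy_moment (w t) k 0) + 1"
    by (rule isCont_locally_bounded) (rule that)
  (* makes the series of increments a geometric series of ratio 1/2 *)
  define r where "r = min r0 (1 / (2 * R))"
  have rpos: "r > 0" using r0 CR by (simp add: r_def)
  show ?thesis
  proof (rule lipsI[where r = r and ?C1.0 = "cmod (cauchy_moment (w t) k 0) + 1" and ?C2.0 = "2 * C * R ^ p"])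
    show "0 < r" by (rule rpos)
    show "cmod (cauchy_moment (w t) k y) \<le> cmod (cauchy_moment (w t) k 0) + 1" if "y \<in> ball 0 r" for y
      using r0(2) that by (simp add: r_def)
    show "\<forall>\<^sub>F s in at t within U. \<forall>y\<in>ball 0 r. cmod (cauchy_moment (w s) k y - cauchy_moment (w t) k y) \<le> 2 * C * R ^ p * cmod (s - t)"
      using CR(3) eventually_in_domain
    proof (eventually_elim, intro ballI)
      fix s y :: complex assume s: "\<forall>l. cmod (moment (w s) (int l) - moment (w t) (int l)) \<le> C * R ^ l * cmod (s - t)" "s \<in> U"
        and y: "y \<in> ball 0 r"
      have "cmod y < 1 / (2 * R)" using y by (simp add: r_def)
      then have yR: "cmod y * R \<le> 1 / 2" using CR(2) by (simp add: field_simps)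
      have "1 / (2 * R) \<le> 1" using CR(2) by (simp add: field_simps)
      then have y1: "cmod y < 1" using \<open>cmod y < 1 / (2 * R)\<close> by linarith
      have "(\<lambda>l. y ^ l * moment (w s) (int l + 1 - k) - y ^ l * moment (w t) (int l + 1 - k)) sums
            (cauchy_moment (w s) k y - cauchy_moment (w t) k y)"
        by (intro sums_diff cauchy_moment_sums_at_0 w_circle_integrable s t y1)
      moreover have "(\<lambda>l. C * R ^ p * cmod (s - t) * (1 / 2) ^ l) sums (C * R ^ p * cmod (s - t) * (1 / (1 - 1 / 2)))"
        by (intro sums_mult geometric_sums) simp
      moreover have "cmod (y ^ l * moment (w s) (int l + 1 - k) - y ^ l * moment (w t) (int l + 1 - k))
          \<le> C * R ^ p * cmod (s - t) * (1 / 2) ^ l" for l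
      proof -
        have e: "int l + 1 - k = int (l + p)" using p by simp
        have "cmod (y ^ l * moment (w s) (int l + 1 - k) - y ^ l * moment (w t) (int l + 1 - k))
          = cmod y ^ l * cmod (moment (w s) (int (l + p)) - moment (w t) (int (l + p)))"
          unfolding e by (simp add: norm_mult norm_power flip: right_diff_distrib)
        also have "\<dots> \<le> cmod y ^ l * (C * R ^ (l + p) * cmod (s - t))"
          using s(1) by (intro mult_left_mono) (blast, simp)
        also have "\<dots> = C * R ^ p * cmod (s - t) * (cmod y * R) ^ l"
          by (simp add: power_add power_mult_distrib)
        also have "\<dots> \<le> C * R ^ p * cmod (s - t) * (1 / 2) ^ l"
          using yR CR by (intro mult_left_mono power_mono) auto
        finally show ?thesis .
      qed
      ultimately have "cmod (cauchy_moment (w s) k y - cauchy_moment (w t) k y) \<le> C * R ^ p * cmod (s - t) * (1 / (1 - 1 / 2))"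
        by (rule norm_sums_le)
      then show "cmod (cauchy_moment (w s) k y - cauchy_moment (w t) k y) \<le> 2 * C * R ^ p * cmod (s - t)" by simp
    qed
  qed
qed

lemma transform_bounded_near_infinity:
  assumes t: "t \<in> U"
  obtains R where "\<And>x. cmod x \<ge> R \<Longrightarrow> transform_bounded t x"
proof -
  obtain C R where CR: "C \<ge> 0" "R \<ge> 1"
    "\<forall>\<^sub>F s in at t within U. \<forall>l. cmod (moment (w s) (- int l) - moment (w t) (- int l)) \<le> C * R ^ l * cmod (s - t)"
    by (rule negative_moments_growth[OF t]) (rule that)
  have "transform_bounded t x" if x: "cmod x \<ge> 2 * R" for x
  proof (rule exI[of _ "C * (1 / (1 - 1 / 2))"])
    show "\<forall>\<^sub>F s in at t within U. cmod (cauchy_moment (w s) 1 x - cauchy_moment (w t) 1 x) \<le> C * (1 / (1 - 1 / 2)) * cmod (s - t)"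
      using CR(3) eventually_in_domain
    proof eventually_elim
      case (elim s)
      have x1: "cmod x > 1" using x CR by linarith
      have "R / cmod x \<le> 1 / 2" using x x1 by (subst pos_divide_le_eq) auto
      then have xR: "1 / cmod x * R \<le> 1 / 2" by simp
      have "(\<lambda>l. - ((1 / x) ^ Suc l * moment (w s) (- 1 - int l)) - - ((1 / x) ^ Suc l * moment (w t) (- 1 - int l))) sums
            (cauchy_moment (w s) 1 x - cauchy_moment (w t) 1 x)"
        by (intro sums_diff cauchy_moment_sums_at_infinity w_circle_integrable elim t x1)
      moreover have "(\<lambda>l. C * cmod (s - t) * (1 / 2) ^ l) sums (C * cmod (s - t) * (1 / (1 - 1 / 2)))"
        by (intro sums_mult geometric_sums) simp
      moreover have "cmod (- ((1 / x) ^ Suc l * moment (w s) (- 1 - int l)) - - ((1 / x) ^ Suc l * moment (w t) (- 1 - int l)))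
          \<le> C * cmod (s - t) * (1 / 2) ^ l" for l
      proof -
        have e: "- 1 - int l = - int (Suc l)" by simp
        have "- ((1 / x) ^ Suc l * moment (w s) (- 1 - int l)) - - ((1 / x) ^ Suc l * moment (w t) (- 1 - int l))
            = - ((1 / x) ^ Suc l * (moment (w s) (- int (Suc l)) - moment (w t) (- int (Suc l))))"
          unfolding e by (simp only: right_diff_distrib) simp
        then have "cmod (- ((1 / x) ^ Suc l * moment (w s) (- 1 - int l)) - - ((1 / x) ^ Suc l * moment (w t) (- 1 - int l)))
          = (1 / cmod x) ^ Suc l * cmod (moment (w s) (- int (Suc l)) - moment (w t) (- int (Suc l)))"
          by (simp only: norm_minus_cancel norm_mult norm_power norm_divide norm_one)
        also have "\<dots> \<le> (1 / cmod x) ^ Suc l * (C * R ^ Suc l * cmod (s - t))"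
          using elim(1) by (intro mult_left_mono) (blast, simp)
        also have "\<dots> = C * cmod (s - t) * (1 / cmod x * R) ^ Suc l"
          by (simp only: power_mult_distrib mult_ac)
        also have "\<dots> \<le> C * cmod (s - t) * (1 / 2) ^ Suc l"
          using xR CR by (intro mult_left_mono power_mono) auto
        also have "\<dots> \<le> C * cmod (s - t) * (1 / 2) ^ l"
          using CR by (intro mult_left_mono power_decreasing) auto
        finally show ?thesis .
      qed
      ultimately have "cmod (cauchy_moment (w s) 1 x - cauchy_moment (w t) 1 x) \<le> C * cmod (s - t) * (1 / (1 - 1 / 2))"
        by (rule norm_sums_le)
      then show ?case by simp
    qed
  qed
  then show ?thesis using that by blast
qed

lemma transform_ode:
  assumes s: "s \<in> U" and x: "x \<notin> sphere 0 1" "\<And>j. j \<in> {1..m} \<Longrightarrow> x \<noteq> z j s"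
  shows "(cauchy_moment (w s) 1 has_field_derivative
     (\<Sum>j=1..m. \<rho> j * (1 / (x - z j s))) * cauchy_moment (w s) 1 x + poly (Qd s) x * (\<Prod>j=1..m. 1 / (x - z j s))) (at x)"
proof -
  interpret S: semiclassical_system m "\<lambda>j. z j s" \<rho> "\<Omega> s" "w s" "\<lambda>n. \<kappa> n s" "\<lambda>n. \<phi> n s" "\<lambda>n. \<phi>b n s"
    by (rule system[OF s])
  have xa: "x \<notin> (\<lambda>j. z j s) ` {1..m}" using x(2) by blast
  obtain d where d: "(cauchy_moment (w s) 1 has_field_derivative d) (at x)"
    "poly (Wd s) x * d = poly (Vd s) x * cauchy_moment (w s) 1 x + poly (Qd s) x"
    using S.cauchy_moment_ode[OF x(1)] by blast
  have W: "poly (Wd s) x \<noteq> 0" using S.poly_Wp_eq_0_iff xa by blast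
  have inv: "(\<Prod>j=1..m. 1 / (x - z j s)) = 1 / poly (Wd s) x"
    by (simp add: S.poly_Wp prod_dividef)
  have "poly (Wd s) x * d = poly (Wd s) x * (S.logderiv x * cauchy_moment (w s) 1 x + poly (Qd s) x * (1 / poly (Wd s) x))"
    unfolding d(2) S.Wp_mult_logderiv[OF xa, symmetric] using W by (simp add: distrib_left)
  then have "d = S.logderiv x * cauchy_moment (w s) 1 x + poly (Qd s) x * (\<Prod>j=1..m. 1 / (x - z j s))"
    using W unfolding inv by simp
  then show ?thesis using d(1) by (simp add: S.logderiv_def)
qed

text \<open>
  The ball is chosen so small that the singular points stay outside for all \<open>s\<close> near \<open>t\<close>.
\<close>

lemma transform_bounded_propagates:
  assumes t: "t \<in> U" and c: "c \<notin> sphere 0 1" "c \<notin> (\<lambda>j. z j t) ` {1..m}"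
  obtains r where "r > 0" "ball c r \<subseteq> - sphere 0 1 - (\<lambda>j. z j t) ` {1..m}"
   "\<And>x. x \<in> ball c r \<Longrightarrow> transform_bounded t x \<Longrightarrow>
     \<exists>K. \<forall>\<^sub>F s in at t within U. \<forall>y\<in>ball c r. cmod (cauchy_moment (w s) 1 y - cauchy_moment (w t) 1 y) \<le> K * cmod (s - t)"
proof -
  let ?h = "\<lambda>s. cauchy_moment (w s) 1"
  let ?p = "\<lambda>s x. \<Sum>j=1..m. \<rho> j * (1 / (x - z j s))"
  let ?q = "\<lambda>s x. poly (Qd s) x * (\<Prod>j=1..m. 1 / (x - z j s))"
  have pole: "lips U t (\<lambda>s x. 1 / (x - z j s)) c" if "j \<in> {1..m}" for j
    using c that by (intro lips_pole points_differentiable t) auto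
  have p: "lips U t ?p c"
    by (intro lips_sum lips_mult lips_space_independent field_differentiable_const pole)
  have q: "lips U t ?q c"
  proof (intro lips_mult lips_prod pole lips_poly[OF t])
    show "degree (Qd s) \<le> m" for s by (rule degree_Qd)
    show "(\<lambda>s. coeff (Qd s) i) field_differentiable at t within U" for i
      by (intro coeff_differentiableD Qd_differentiable t)
  qed
  have "open (- sphere 0 1 - (\<lambda>j. z j t) ` {1..m})"
    by (intro open_Diff open_Compl finite_imp_closed[of "(\<lambda>j. z j t) ` {1..m}"]) auto
  moreover have "c \<in> - sphere 0 1 - (\<lambda>j. z j t) ` {1..m}" using c by auto
  ultimately obtain r1 where r1: "r1 > 0" "ball c r1 \<subseteq> - sphere 0 1 - (\<lambda>j. z j t) ` {1..m}"
    by (meson openE)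
  have hc: "isCont (?h t) c"
    by (rule DERIV_isCont[OF cauchy_moment_has_field_derivative[OF w_circle_integrable[OF t] c(1)]])
  obtain r2 where r2: "r2 > 0" "\<And>y. y \<in> ball c r2 \<Longrightarrow> cmod (?h t y) \<le> cmod (?h t c) + 1"
    by (rule isCont_locally_bounded[OF hc]) (rule that)
  define r0 where "r0 = min r1 r2 / 2"
  have r0: "r0 > 0" "r0 < r1" "r0 < r2" using r1 r2 by (auto simp: r0_def)
  have "\<forall>\<^sub>F s in at t within U. \<forall>j\<in>{1..m}. dist (z j s) (z j t) < r1 - r0"
  proof (intro eventually_ball_finite ballI)
    fix j assume "j \<in> {1..m}"
    then have "(z j \<longlongrightarrow> z j t) (at t within U)" using z_continuous[OF _ t] by (simp add: continuous_within)
    then show "\<forall>\<^sub>F s in at t within U. dist (z j s) (z j t) < r1 - r0" using r0 by (intro tendstoD) auto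
  qed simp
  then have ode: "\<forall>\<^sub>F s in at t within U. \<forall>y\<in>ball c r0. (?h s has_field_derivative ?p s y * ?h s y + ?q s y) (at y)"
    using eventually_in_domain
  proof (eventually_elim, intro ballI)
    fix s y assume s: "\<forall>j\<in>{1..m}. dist (z j s) (z j t) < r1 - r0" "s \<in> U" and y: "y \<in> ball c r0"
    show "(?h s has_field_derivative ?p s y * ?h s y + ?q s y) (at y)"
    proof (rule transform_ode[OF s(2)])
      have "y \<in> ball c r1" using y r0(2) by simp
      then show "y \<notin> sphere 0 1" using r1(2) by blast
      fix j assume j: "j \<in> {1..m}"
      have "z j t \<notin> ball c r1" using r1(2) j by blast
      then have "dist c (z j t) \<ge> r1" by simp
      moreover have "dist (z j s) (z j t) < r1 - r0" "dist c y < r0" using s(1) j y by auto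
      ultimately show "y \<noteq> z j s" using dist_triangle[of c "z j t" y] by auto
    qed
  qed
  have odet: "(?h t has_field_derivative ?p t y * ?h t y + ?q t y) (at y)" if y: "y \<in> ball c r0" for y
  proof -
    have "y \<in> ball c r1" using y r0(2) by simp
    then have "y \<in> - sphere 0 1 - (\<lambda>j. z j t) ` {1..m}" using r1(2) by blast
    then show ?thesis by (intro transform_ode[OF t]) blast+
  qed
  obtain r where r: "r > 0" "\<And>K x0. x0 \<in> ball c r \<Longrightarrow> \<forall>\<^sub>F s in at t within U. cmod (?h s x0 - ?h t x0) \<le> K * cmod (s - t)
     \<Longrightarrow> \<exists>K'. \<forall>\<^sub>F s in at t within U. \<forall>y\<in>ball c r. cmod (?h s y - ?h t y) \<le> K' * cmod (s - t)"
    by (rule ode_propagates_lipschitz_bound[OF p q t r0(1) _ odet ode, where B = "cmod (?h t c) + 1"])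
      (use r2(2) r0 in auto)
  show ?thesis
  proof (rule that[of "min r r1"])
    show "min r r1 > 0" using r r1 by simp
    show "ball c (min r r1) \<subseteq> - sphere 0 1 - (\<lambda>j. z j t) ` {1..m}" using r1(2) by (simp add: subset_iff)
    fix x assume x: "x \<in> ball c (min r r1)" and "transform_bounded t x"
    then obtain K where K: "\<forall>\<^sub>F s in at t within U. cmod (?h s x - ?h t x) \<le> K * cmod (s - t)" by blast
    have "x \<in> ball c r" using x by simp
    from r(2)[OF this K] obtain K' where "\<forall>\<^sub>F s in at t within U. \<forall>y\<in>ball c r. cmod (?h s y - ?h t y) \<le> K' * cmod (s - t)" by blast
    then have "\<forall>\<^sub>F s in at t within U. \<forall>y\<in>ball c (min r r1). cmod (?h s y - ?h t y) \<le> K' * cmod (s - t)"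
      by eventually_elim simp
    then show "\<exists>K. \<forall>\<^sub>F s in at t within U. \<forall>y\<in>ball c (min r r1). cmod (?h s y - ?h t y) \<le> K * cmod (s - t)" by blast
  qed
qed

lemma transform_bounded_connected:
  assumes t: "t \<in> U" and S: "connected S" "open S" "S \<subseteq> - sphere 0 1 - (\<lambda>j. z j t) ` {1..m}"
    and x: "x \<in> S" "y \<in> S" "transform_bounded t x"
  shows "transform_bounded t y"
proof (rule connected_induction_simple[OF S(1), where P = "transform_bounded t" and a = x and b = y])
  fix c assume c: "c \<in> S"
  then have "c \<notin> sphere 0 1" "c \<notin> (\<lambda>j. z j t) ` {1..m}" using S(3) by auto
  then obtain r where r: "r > 0" "\<And>x. x \<in> ball c r \<Longrightarrow> transform_bounded t x \<Longrightarrow>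
     \<exists>K. \<forall>\<^sub>F s in at t within U. \<forall>y\<in>ball c r. cmod (cauchy_moment (w s) 1 y - cauchy_moment (w t) 1 y) \<le> K * cmod (s - t)"
    by (rule transform_bounded_propagates[OF t]) (rule that)
  have step: "transform_bounded t v" if uv: "u \<in> ball c r" "v \<in> ball c r" "transform_bounded t u" for u v
  proof -
    obtain K where "\<forall>\<^sub>F s in at t within U. \<forall>y\<in>ball c r. cmod (cauchy_moment (w s) 1 y - cauchy_moment (w t) 1 y) \<le> K * cmod (s - t)"
      using r(2)[OF uv(1) uv(3)] by blast
    then have "\<forall>\<^sub>F s in at t within U. cmod (cauchy_moment (w s) 1 v - cauchy_moment (w t) 1 v) \<le> K * cmod (s - t)"
      by eventually_elim (use uv(2) in blast)
    then show ?thesis by blast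
  qed
  show "\<exists>T. openin (top_of_set S) T \<and> c \<in> T \<and> (\<forall>x\<in>T. \<forall>y\<in>T. transform_bounded t x \<longrightarrow> transform_bounded t y)"
  proof (rule exI[of _ "S \<inter> ball c r"], intro conjI ballI impI)
    show "openin (top_of_set S) (S \<inter> ball c r)" by (intro openin_open_Int) simp
    show "c \<in> S \<inter> ball c r" using c r(1) by simp
    show "transform_bounded t v" if "u \<in> S \<inter> ball c r" "v \<in> S \<inter> ball c r" "transform_bounded t u" for u v
      by (rule step[OF _ _ that(3)]) (use that in auto)
  qed
qed (use x in blast)+

text \<open>
  Inside the circle the bound starts near 0, outside it starts near infinity; both components stay
  connected when the singular points are removed.
\<close>

lemma transform_bounded_everywhere:
  assumes t: "t \<in> U" and x: "x \<notin> sphere 0 1" "x \<notin> (\<lambda>j. z j t) ` {1..m}"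
  shows "transform_bounded t x"
proof -
  let ?a = "(\<lambda>j. z j t) ` {1..m}"
  have fin: "finite ?a" by simp
  show ?thesis
  proof (cases "cmod x < 1")
    case True
    obtain r C where r: "r > 0"
      "\<forall>\<^sub>F s in at t within U. \<forall>y\<in>ball 0 r. cmod (cauchy_moment (w s) 1 y - cauchy_moment (w t) 1 y) \<le> C * cmod (s - t)"
      by (rule lipsE[OF cauchy_moment_lips_at_0[OF t order_refl]]) (rule that)
    have "uncountable (ball (0::complex) (min r 1))" using r by (intro uncountable_ball) auto
    then have "infinite (ball (0::complex) (min r 1))" using countable_finite by blast
    then obtain b where b: "b \<in> ball 0 (min r 1)" "b \<notin> ?a" using fin by (meson finite_subset subsetI)
    show ?thesis
    proof (rule transform_bounded_connected[OF t, of "ball 0 1 - ?a" b x])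
      show "connected (ball 0 1 - ?a)" by (intro connected_open_delete_finite fin) auto
      show "open (ball 0 1 - ?a)" by (intro open_Diff finite_imp_closed fin) auto
      have "\<forall>\<^sub>F s in at t within U. cmod (cauchy_moment (w s) 1 b - cauchy_moment (w t) 1 b) \<le> C * cmod (s - t)"
        using r(2) by eventually_elim (use b(1) in simp)
      then show "transform_bounded t b" by blast
    qed (use True x b in auto)
  next
    case False
    then have x1: "cmod x > 1" using x(1) by simp
    obtain R where R: "\<And>x. cmod x \<ge> R \<Longrightarrow> transform_bounded t x"
      using transform_bounded_near_infinity[OF t] by blast
    have "bounded ?a" using fin by (rule finite_imp_bounded)
    then obtain M where M: "\<And>y. y \<in> ?a \<Longrightarrow> cmod y \<le> M" by (meson bounded_iff)
    (* a starting point outside the circle, beyond all singular points, where the expansion at infinity applies *)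
    define b where "b = complex_of_real (max (max R (M + 1)) 2)"
    have bn: "cmod b = max (max R (M + 1)) 2" by (simp add: b_def)
    have b: "b \<notin> ?a" using M[of b] bn by auto
    show ?thesis
    proof (rule transform_bounded_connected[OF t, of "- cball 0 1 - ?a" b x])
      have "connected (- cball (0::complex) 1)"
        by (intro connected_complement_bounded_convex) auto
      then show "connected (- cball 0 1 - ?a)"
        by (intro connected_open_delete_finite fin) (auto simp: open_Compl)
      show "open (- cball 0 1 - ?a)" by (intro open_Diff finite_imp_closed[OF fin] open_Compl) auto
      show "transform_bounded t b" using R bn by simp
    qed (use x1 x b bn in auto)
  qed
qed

lemma cauchy_moment_one_lips:
  assumes t: "t \<in> U" and x: "x \<notin> sphere 0 1" "x \<notin> (\<lambda>j. z j t) ` {1..m}"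
  shows "lips U t (\<lambda>s. cauchy_moment (w s) 1) x"
proof -
  obtain r where r: "r > 0"
   "\<And>v. v \<in> ball x r \<Longrightarrow> transform_bounded t v \<Longrightarrow>
     \<exists>K. \<forall>\<^sub>F s in at t within U. \<forall>y\<in>ball x r. cmod (cauchy_moment (w s) 1 y - cauchy_moment (w t) 1 y) \<le> K * cmod (s - t)"
    by (rule transform_bounded_propagates[OF t x]) (rule that)
  have "x \<in> ball x r" using r(1) by simp
  from r(2)[OF this transform_bounded_everywhere[OF t x]]
  obtain K where K: "\<forall>\<^sub>F s in at t within U. \<forall>y\<in>ball x r. cmod (cauchy_moment (w s) 1 y - cauchy_moment (w t) 1 y) \<le> K * cmod (s - t)"
    by blast
  have hc: "isCont (cauchy_moment (w t) 1) x"
    by (rule DERIV_isCont[OF cauchy_moment_has_field_derivative[OF w_circle_integrable[OF t] x(1)]])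
  obtain r2 where r2: "r2 > 0" "\<And>y. y \<in> ball x r2 \<Longrightarrow> cmod (cauchy_moment (w t) 1 y) \<le> cmod (cauchy_moment (w t) 1 x) + 1"
    by (rule isCont_locally_bounded[OF hc]) (rule that)
  show ?thesis
  proof (rule lipsI[where r = "min r r2" and ?C1.0 = "cmod (cauchy_moment (w t) 1 x) + 1" and ?C2.0 = K])
    show "\<forall>\<^sub>F s in at t within U. \<forall>y\<in>ball x (min r r2). cmod (cauchy_moment (w s) 1 y - cauchy_moment (w t) 1 y) \<le> K * cmod (s - t)"
      using K by eventually_elim simp
  qed (use r r2 in auto)
qed

lemma off_circle_ball:
  assumes "x \<notin> sphere 0 (1::real)"
  obtains e where "e > 0" "ball (x::complex) e \<subseteq> - sphere 0 1"
  using assms openE[of "- sphere 0 1" x] by (auto simp: open_Compl)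

lemma cauchy_moment_lips:
  assumes t: "t \<in> U" and x: "x \<notin> sphere 0 1" "x \<notin> (\<lambda>j. z j t) ` {1..m}"
  shows "lips U t (\<lambda>s. cauchy_moment (w s) k) x"
proof -
  have "z 1 t \<in> (\<lambda>j. z j t) ` {1..m}" using m_ge_2 by auto
  then have x0: "x \<noteq> 0" using x(2) z_1[OF t] by metis
  obtain e where e: "e > 0" "ball x e \<subseteq> - sphere 0 1" using off_circle_ball[OF x(1)] by blast
  have inv: "isCont (\<lambda>y. 1 / y) x" using x0 by (intro continuous_intros) auto
  show ?thesis
  proof (induction k rule: int_induct[where k = 1])
    case base show ?case by (rule cauchy_moment_one_lips[OF t x])
  next
    case (step1 k)
    have "lips U t (\<lambda>s y. y * cauchy_moment (w s) k y + moment (w s) (- k)) x"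
      by (intro lips_add lips_mult step1.IH lips_space_independent moment_differentiable t)
        (rule lips_time_independent, intro continuous_intros)
    then show ?case
    proof (rule lips_cong[OF _ t e(1)])
      fix s y assume "s \<in> U" "y \<in> ball x e"
      then show "y * cauchy_moment (w s) k y + moment (w s) (- k) = cauchy_moment (w s) (k + 1) y"
        using e(2) by (intro cauchy_moment_add_one[symmetric] w_circle_integrable) auto
    qed
  next
    case (step2 k)
    have step: "lips U t (\<lambda>s y. (1 / y) * (cauchy_moment (w s) k y + (- 1) * moment (w s) (- (k - 1)))) x"
      by (intro lips_mult lips_add step2.IH lips_space_independent moment_differentiable t field_differentiable_const
          lips_time_independent[OF inv])
    have "open (- sphere 0 1 - {0::complex})" by (intro open_Diff open_Compl) auto
    then obtain e' where e': "e' > 0" "ball x e' \<subseteq> - sphere 0 1 - {0}"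
      by (rule openE[of _ x]) (use x0 x(1) that in auto)
    show ?case
    proof (rule lips_cong[OF step t e'(1)])
      fix s y assume s: "s \<in> U" and y: "y \<in> ball x e'"
      have "y \<in> - sphere 0 1 - {0}" using e'(2) y by (rule subsetD)
      then have y': "y \<notin> sphere 0 1" "y \<noteq> 0" by auto
      have "cauchy_moment (w s) k y = y * cauchy_moment (w s) (k - 1) y + moment (w s) (- (k - 1))"
        using cauchy_moment_add_one[OF w_circle_integrable[OF s] y'(1), of "k - 1"] by simp
      then show "1 / y * (cauchy_moment (w s) k y + - 1 * moment (w s) (- (k - 1))) = cauchy_moment (w s) (k - 1) y"
        using y'(2) by simp
    qed
  qed
qed

lemma phi_coeff_differentiable:
  "t \<in> U \<Longrightarrow> (\<lambda>s. coeff (\<phi> n s) i) field_differentiable (at t within U)"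
  "t \<in> U \<Longrightarrow> (\<lambda>s. coeff (\<phi>b n s) i) field_differentiable (at t within U)"
  using coeffs_differentiable by auto

lemma eps_expansion:
  assumes s: "s \<in> U" and n: "n \<ge> 1" and y: "y \<notin> sphere 0 1"
  shows "eps (w s) (\<phi> n s) y = 2 * (\<Sum>i\<le>n. coeff (\<phi> n s) i * cauchy_moment (w s) (1 + int i) y)"
    and "eps (w s) (\<phi> n s) y = y ^ n * (2 * (\<Sum>i\<le>n. coeff (\<phi> n s) i * cauchy_moment (w s) (1 - int n + int i) y))"
    and "eps_star n (w s) (\<phi>b n s) y = - 2 * y ^ n * (\<Sum>i\<le>n. coeff (\<phi>b n s) i * cauchy_moment (w s) (1 - int i) y)"
proof -
  interpret S: semiclassical_system m "\<lambda>j. z j s" \<rho> "\<Omega> s" "w s" "\<lambda>n. \<kappa> n s" "\<lambda>n. \<phi> n s" "\<lambda>n. \<phi>b n s"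
    by (rule system[OF s])
  have d: "degree (\<phi> n s) \<le> n" "degree (\<phi>b n s) \<le> n" by (simp_all add: S.degree_phi S.degree_phib)
  show "eps (w s) (\<phi> n s) y = 2 * (\<Sum>i\<le>n. coeff (\<phi> n s) i * cauchy_moment (w s) (1 + int i) y)"
    unfolding S.eps_eq[OF n y] cauchy_moment_poly_mult[OF S.w_integrable y d(1)] ..
  show "eps (w s) (\<phi> n s) y = y ^ n * (2 * (\<Sum>i\<le>n. coeff (\<phi> n s) i * cauchy_moment (w s) (1 - int n + int i) y))"
    unfolding S.eps_zero_of_order_n[OF n y] cauchy_moment_poly_mult[OF S.w_integrable y d(1)] ..
  show "eps_star n (w s) (\<phi>b n s) y = - 2 * y ^ n * (\<Sum>i\<le>n. coeff (\<phi>b n s) i * cauchy_moment (w s) (1 - int i) y)"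
    unfolding S.eps_star_eq[OF n y] cauchy_moment_reflect_poly_mult[OF S.w_integrable y d(2)] ..
qed

lemma eps_lips:
  assumes t: "t \<in> U" and n: "n \<ge> 1" and x: "x \<notin> sphere 0 1" "x \<notin> (\<lambda>j. z j t) ` {1..m}"
  shows "lips U t (\<lambda>s. eps (w s) (\<phi> n s)) x"
proof -
  obtain e where e: "e > 0" "ball x e \<subseteq> - sphere 0 1" using off_circle_ball[OF x(1)] by blast
  have "lips U t (\<lambda>s y. 2 * (\<Sum>i\<le>n. coeff (\<phi> n s) i * cauchy_moment (w s) (1 + int i) y)) x"
    by (intro lips_mult lips_sum lips_space_independent phi_coeff_differentiable t cauchy_moment_lips x field_differentiable_const)
  then show ?thesis
    by (rule lips_cong[OF _ t e(1)]) (use e(2) eps_expansion(1)[OF _ n] in \<open>auto simp: subset_iff\<close>)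
qed

lemma eps_star_lips:
  assumes t: "t \<in> U" and n: "n \<ge> 1" and x: "x \<notin> sphere 0 1" "x \<notin> (\<lambda>j. z j t) ` {1..m}"
  shows "lips U t (\<lambda>s. eps_star n (w s) (\<phi>b n s)) x"
proof -
  obtain e where e: "e > 0" "ball x e \<subseteq> - sphere 0 1" using off_circle_ball[OF x(1)] by blast
  have "lips U t (\<lambda>s y. (- 2 * y ^ n) * (\<Sum>i\<le>n. coeff (\<phi>b n s) i * cauchy_moment (w s) (1 - int i) y)) x"
    by (intro lips_mult lips_sum lips_space_independent phi_coeff_differentiable t cauchy_moment_lips x field_differentiable_const)
      (intro lips_time_independent continuous_intros)
  then show ?thesis
    by (rule lips_cong[OF _ t e(1)]) (use e(2) eps_expansion(3)[OF _ n] in \<open>auto simp: subset_iff\<close>)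
qed

lemma eps_holomorphic:
  assumes s: "s \<in> U" and n: "n \<ge> 1"
  shows "eps (w s) (\<phi> n s) holomorphic_on - sphere 0 1" "eps_star n (w s) (\<phi>b n s) holomorphic_on - sphere 0 1"
proof -
  interpret S: semiclassical_system m "\<lambda>j. z j s" \<rho> "\<Omega> s" "w s" "\<lambda>n. \<kappa> n s" "\<lambda>n. \<phi> n s" "\<lambda>n. \<phi>b n s"
    by (rule system[OF s])
  show "eps (w s) (\<phi> n s) holomorphic_on - sphere 0 1" "eps_star n (w s) (\<phi>b n s) holomorphic_on - sphere 0 1"
    using S.eps_holomorphic[OF n] S.eps_star_holomorphic[OF n] by auto
qed

lemma generic_points_accumulate:
  assumes t: "t \<in> U" and F: "finite F"
  shows "x islimpt (\<Omega> t - sphere 0 1 - F)"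
proof -
  have "closure (\<Omega> t - (sphere 0 1 \<union> insert x F)) = UNIV"
    using cut_plane[OF t] F by (intro dense_open_minus_nowhere_dense interior_circle_union_finite) auto
  moreover have "\<Omega> t - (sphere 0 1 \<union> insert x F) = (\<Omega> t - sphere 0 1 - F) - {x}" by blast
  ultimately have "x \<in> closure ((\<Omega> t - sphere 0 1 - F) - {x})" by simp
  then show ?thesis by (simp add: islimpt_in_closure)
qed

end

section \<open>The deformation equations\<close>

text \<open>
  Passes between the second column of \<open>Y\<close> and \<open>\<epsilon>\<close>, \<open>\<epsilon>\<^sup>*\<close>.
\<close>

lemma has_field_derivative_divide_iff:
  fixes E W :: "complex \<Rightarrow> complex"
  assumes W: "(W has_field_derivative d) (at t within U)" "W t \<noteq> 0"
  shows "((\<lambda>s. E s / W s) has_field_derivative v) (at t within U) \<longleftrightarrow>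
         (E has_field_derivative v * W t + E t / W t * d) (at t within U)"
proof
  assume E: "((\<lambda>s. E s / W s) has_field_derivative v) (at t within U)"
  have "(W \<longlongrightarrow> W t) (at t within U)"
    using has_field_derivative_imp_has_derivative[OF W(1), THEN has_derivative_continuous] by (simp add: continuous_within)
  then have "\<forall>\<^sub>F s in at t within U. W s \<noteq> 0" using W(2) by (rule tendsto_imp_eventually_ne)
  then have ev: "\<forall>\<^sub>F s in at t within U. E s = E s / W s * W s" by eventually_elim simp
  have "((\<lambda>s. E s / W s * W s) has_field_derivative v * W t + d * (E t / W t)) (at t within U)"
    by (rule DERIV_mult'[OF E W(1), THEN DERIV_cong]) simp
  then show "(E has_field_derivative v * W t + E t / W t * d) (at t within U)"
    using W(2) by (subst has_field_derivative_cong_eventually[OF ev]) (auto simp: mult.commute)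
next
  assume E: "(E has_field_derivative v * W t + E t / W t * d) (at t within U)"
  have "((\<lambda>s. E s / W s) has_field_derivative ((v * W t + E t / W t * d) * W t - E t * d) / (W t * W t)) (at t within U)"
    by (rule DERIV_divide[OF E W])
  moreover have "((v * W t + E t / W t * d) * W t - E t * d) / (W t * W t) = v"
    using W(2) by (simp add: field_simps)
  ultimately show "((\<lambda>s. E s / W s) has_field_derivative v) (at t within U)" by simp
qed

lemma poly_over_power_tendsto:
  fixes p :: "complex poly"
  assumes "degree p \<le> n"
  shows "((\<lambda>x. poly p x / x ^ n) \<longlongrightarrow> coeff p n) at_infinity"
proof -
  have inv: "((\<lambda>x::complex. inverse x) \<longlongrightarrow> 0) at_infinity" by (rule tendsto_inverse_0)
  have "((\<lambda>x. \<Sum>i\<le>n. coeff p i * inverse x ^ (n - i)) \<longlongrightarrow> (\<Sum>i\<le>n. coeff p i * 0 ^ (n - i))) at_infinity"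
    by (intro tendsto_intros inv)
  moreover have "(\<Sum>i\<le>n. coeff p i * 0 ^ (n - i)) = coeff p n"
  proof -
    have "(\<Sum>i\<le>n. coeff p i * 0 ^ (n - i)) = (\<Sum>i\<in>{n}. coeff p i * 0 ^ (n - i))"
      by (intro sum.mono_neutral_right) (auto simp: power_0_left)
    then show ?thesis by simp
  qed
  moreover have "\<forall>\<^sub>F x::complex in at_infinity. x \<noteq> 0"
    using eventually_not_equal_at_infinity[of 0] .
  then have "\<forall>\<^sub>F x in at_infinity. (\<Sum>i\<le>n. coeff p i * inverse x ^ (n - i)) = poly p x / x ^ n"
  proof eventually_elim
    case (elim x)
    show ?case unfolding poly_bounded_sum[OF assms] sum_divide_distrib
    proof (intro sum.cong refl)
      fix i assume "i \<in> {..n}"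
      then have "x ^ n = x ^ i * x ^ (n - i)" by (simp flip: power_add)
      then show "coeff p i * inverse x ^ (n - i) = coeff p i * x ^ i / x ^ n"
        using elim by (simp add: field_simps)
    qed
  qed
  ultimately show ?thesis by (simp add: Lim_transform_eventually)
qed

context semiclassical_deformation
begin

lemma ddt_origin: "t \<in> U \<Longrightarrow> ddt U (z 1) t = 0"
proof (rule ddt_eqI)
  assume t: "t \<in> U"
  have "((\<lambda>s. 0) has_field_derivative 0) (at t within U)" by simp
  then show "(z 1 has_field_derivative 0) (at t within U)"
    by (rule has_field_derivative_transform_within[OF _ zero_less_one_real t]) (rule z_1[symmetric])
qed

lemma poly_deformation_derivative:
  assumes t: "t \<in> U" and P: "coeffs_differentiable U t P" and deg: "\<And>s. s \<in> U \<Longrightarrow> degree (P s) \<le> n"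
  obtains D where "degree D \<le> n" "\<And>x. ((\<lambda>s. poly (P s) x) has_field_derivative poly D x) (at t within U)"
    "\<And>i. i \<le> n \<Longrightarrow> coeff D i = ddt U (\<lambda>s. coeff (P s) i) t"
proof -
  define D where "D = (\<Sum>i\<le>n. monom (ddt U (\<lambda>s. coeff (P s) i) t) i)"
  have c: "coeff D i = (if i \<le> n then ddt U (\<lambda>s. coeff (P s) i) t else 0)" for i
    unfolding D_def by (simp add: coeff_sum)
  have dD: "degree D \<le> n" by (rule degree_le) (simp add: c)
  have "((\<lambda>s. poly (P s) x) has_field_derivative poly D x) (at t within U)" for x
  proof -
    have "((\<lambda>s. \<Sum>i\<le>n. coeff (P s) i * x ^ i) has_field_derivative (\<Sum>i\<le>n. ddt U (\<lambda>s. coeff (P s) i) t * x ^ i)) (at t within U)"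
      by (intro DERIV_sum DERIV_cmult_right ddt_has_field_derivative t coeff_differentiableD P)
    moreover have "(\<Sum>i\<le>n. ddt U (\<lambda>s. coeff (P s) i) t * x ^ i) = poly D x"
      unfolding poly_bounded_sum[OF dD] by (intro sum.cong refl) (simp add: c)
    ultimately have "((\<lambda>s. \<Sum>i\<le>n. coeff (P s) i * x ^ i) has_field_derivative poly D x) (at t within U)" by simp
    then show ?thesis
      by (rule has_field_derivative_transform_within[OF _ zero_less_one_real t]) (simp add: poly_bounded_sum[OF deg])
  qed
  then show ?thesis using that[OF dD] c by simp
qed

lemma coeff_reflect_phib:
  assumes "s \<in> U"
  shows "coeff (reflect_poly (\<phi>b n s)) i = (if i \<le> n then coeff (\<phi>b n s) (n - i) else 0)"
  using degrees[OF assms, of n] by (simp add: coeff_reflect_poly)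

lemma reflect_phib_differentiable:
  assumes t: "t \<in> U"
  shows "coeffs_differentiable U t (\<lambda>s. reflect_poly (\<phi>b n s))"
  unfolding coeffs_differentiable_def
proof
  fix i
  have "(\<lambda>s. if i \<le> n then coeff (\<phi>b n s) (n - i) else 0) field_differentiable (at t within U)"
    using phi_coeff_differentiable(2)[OF t] by (cases "i \<le> n") auto
  then show "(\<lambda>s. coeff (reflect_poly (\<phi>b n s)) i) field_differentiable (at t within U)"
    by (rule field_differentiable_cong_on[OF _ t]) (simp add: coeff_reflect_phib)
qed

lemma ddt_cong:
  assumes "t \<in> U" "\<And>s. s \<in> U \<Longrightarrow> f s = g s" "f field_differentiable (at t within U)"
  shows "ddt U g t = ddt U f t"
proof (rule ddt_eqI[OF assms(1)])
  show "(g has_field_derivative ddt U f t) (at t within U)"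
    by (rule has_field_derivative_transform_within[OF ddt_has_field_derivative[OF assms(1,3)] zero_less_one_real assms(1)])
      (simp add: assms(2))
qed

text \<open>
  The matrix system gives derivatives only on the cut plane, the scalar system also claims them on
  the cuts.
\<close>

lemma derivative_extends_to_cuts:
  assumes t: "t \<in> U" and x: "x \<notin> sphere 0 1" "x \<notin> (\<lambda>j. z j t) ` {1..m}"
    and lips: "lips U t h x" and hol: "\<And>s. s \<in> U \<Longrightarrow> h s holomorphic_on - sphere 0 1"
    and g: "isCont g x"
    and d: "\<And>y. y \<in> \<Omega> t - sphere 0 1 \<Longrightarrow> ((\<lambda>s. h s y) has_field_derivative g y) (at t within U)"
  shows "((\<lambda>s. h s x) has_field_derivative g x) (at t within U)"
proof (rule lips_derivative_extends[where S = "- sphere 0 1" and E = "\<Omega> t - sphere 0 1", OF lips t _ _ hol])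
  show "x islimpt (\<Omega> t - sphere 0 1)" using generic_points_accumulate[OF t finite.emptyI] by simp
  show "(g \<longlongrightarrow> g x) (at x within \<Omega> t - sphere 0 1)"
    using g by (meson isCont_def tendsto_within_subset top_greatest)
qed (use x d in \<open>auto simp: open_Compl\<close>)

end

locale deformation_at_time = semiclassical_deformation +
  fixes t :: complex and n :: nat and A :: "nat \<Rightarrow> complex ^ 2 ^ 2"
  assumes t: "t \<in> U" and n: "n \<ge> 1"
    and residues: "residue_matrices m (\<lambda>j. z j t) (\<Omega> t) (Ymat n (w t) (\<phi> n t) (\<phi>b n t)) A"
begin

sublocale now: semiclassical_system m "\<lambda>j. z j t" \<rho> "\<Omega> t" "w t" "\<lambda>n. \<kappa> n t" "\<lambda>n. \<phi> n t" "\<lambda>n. \<phi>b n t"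
  by (rule system[OF t])

abbreviation a :: "nat \<Rightarrow> complex" where "a j \<equiv> z j t"
abbreviation a' :: "nat \<Rightarrow> complex" where "a' j \<equiv> ddt U (z j) t"
abbreviation "points \<equiv> (\<lambda>j. z j t) ` {1..m}"
abbreviation f where "f s \<equiv> poly (\<phi> n s)"
abbreviation fs where "fs s \<equiv> poly (reflect_poly (\<phi>b n s))"
abbreviation e where "e s \<equiv> eps (w s) (\<phi> n s)"
abbreviation es where "es s \<equiv> eps_star n (w s) (\<phi>b n s)"
abbreviation "ea j \<equiv> limiting_value (e t) (a j)"
abbreviation "esa j \<equiv> limiting_value (es t) (a j)"
abbreviation "r \<equiv> ddt U (\<kappa> n) t / \<kappa> n t"
abbreviation "b \<equiv> (\<kappa> n t * ddt U (\<lambda>s. poly (\<phi>b n s) 0) t + ddt U (\<kappa> n) t * poly (\<phi>b n t) 0) / (\<kappa> n t)\<^sup>2"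

definition S :: "2 \<Rightarrow> 2 \<Rightarrow> complex" where "S i k = (\<Sum>j=1..m. a' j / a j * A j $ i $ k)"
definition T :: "2 \<Rightarrow> 2 \<Rightarrow> complex \<Rightarrow> complex" where "T i k x = (\<Sum>j=1..m. a' j / (x - a j) * A j $ i $ k)"

text \<open>
  The singular point at the origin does not move, so the terms in which a division by 0 occurs are
  multiplied by 0.
\<close>

lemma point_cases:
  assumes "j \<in> {1..m}"
  shows "a j \<noteq> 0 \<or> a' j = 0"
proof (cases "j = 1")
  case True
  show ?thesis unfolding True using ddt_origin[OF t] by (rule disjI2)
next
  case False
  show ?thesis using now.nonzero_point[OF assms False] by (rule disjI1)
qed

lemma residue_entries:
  assumes j: "j \<in> {1..m}" "a j \<noteq> 0"
  shows "\<rho> j * a j powi (- int n) * ea j * fs t (a j) = - 2 * A j $ 1 $ 1"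
    "\<rho> j * a j powi (- int n) * ea j * f t (a j) = 2 * A j $ 1 $ 2"
    "\<rho> j * a j powi (- int n) * esa j * fs t (a j) = 2 * A j $ 2 $ 1"
    "\<rho> j * a j powi (- int n) * esa j * f t (a j) = - 2 * A j $ 2 $ 2"
    "A j $ 1 $ 1 + A j $ 2 $ 2 = - \<rho> j"
proof -
  have p: "a j powi (- int n) = 1 / a j ^ n" by (simp add: power_int_minus inverse_eq_divide)
  have nz: "a j ^ n \<noteq> 0" using j(2) by simp
  note entries = now.residue_matrix_entries[OF n residues j]
  show "\<rho> j * a j powi (- int n) * ea j * fs t (a j) = - 2 * A j $ 1 $ 1"
    "\<rho> j * a j powi (- int n) * ea j * f t (a j) = 2 * A j $ 1 $ 2"
    "\<rho> j * a j powi (- int n) * esa j * fs t (a j) = 2 * A j $ 2 $ 1"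
    "\<rho> j * a j powi (- int n) * esa j * f t (a j) = - 2 * A j $ 2 $ 2"
    using entries(1-4) nz unfolding p by (simp_all add: field_simps)
  have "2 * a j ^ n * (A j $ 1 $ 1 + A j $ 2 $ 2) = - \<rho> j * (f t (a j) * esa j + fs t (a j) * ea j)"
    using entries(1,4) by (simp add: algebra_simps)
  also have "\<dots> = 2 * a j ^ n * (- \<rho> j)" using entries(5) by simp
  finally have "2 * a j ^ n * (A j $ 1 $ 1 + A j $ 2 $ 2) = 2 * a j ^ n * (- \<rho> j)" .
  moreover have "x = y" if "2 * a j ^ n * x = 2 * a j ^ n * y" for x y :: complex
    using that j(2) by simp
  ultimately show "A j $ 1 $ 1 + A j $ 2 $ 2 = - \<rho> j" by blast
qed

lemma weighted_term:
  assumes j: "j \<in> {1..m}" and x: "x \<noteq> a j"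
    and q: "a j \<noteq> 0 \<Longrightarrow> \<rho> j * a j powi (- int n) * u * v = 2 * c"
  shows "\<rho> j * (a' j / a j) * a j powi (- int n) * u * v * (x / (x - a j)) = 2 * (a' j / a j * c + a' j / (x - a j) * c)"
    and "\<rho> j * (a' j / a j) * a j powi (1 - int n) * u * v * (1 / (x - a j)) = 2 * (a' j / (x - a j) * c)"
proof -
  have "\<rho> j * (a' j / a j) * a j powi (- int n) * u * v * (x / (x - a j)) = 2 * (a' j / a j * c + a' j / (x - a j) * c) \<and>
        \<rho> j * (a' j / a j) * a j powi (1 - int n) * u * v * (1 / (x - a j)) = 2 * (a' j / (x - a j) * c)"
  proof (cases "a j = 0")
    case True
    then have "a' j = 0" using point_cases[OF j] by simp
    then show ?thesis by simp
  next
    case False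
    have k: "a' j / a j * (x / (x - a j)) = a' j / a j + a' j / (x - a j)"
      using False x by (simp add: divide_simps) (simp add: algebra_simps)
    have p: "a j powi (1 - int n) = a j * a j powi (- int n)"
      using False by (simp add: power_int_diff power_int_minus field_simps)
    have "\<rho> j * (a' j / a j) * a j powi (- int n) * u * v * (x / (x - a j))
       = (\<rho> j * a j powi (- int n) * u * v) * (a' j / a j * (x / (x - a j)))" by (simp add: mult_ac)
    moreover have "\<rho> j * (a' j / a j) * a j powi (1 - int n) * u * v * (1 / (x - a j))
       = (\<rho> j * a j powi (- int n) * u * v) * (a' j / a j * a j / (x - a j))" unfolding p by (simp add: mult_ac)
    ultimately show ?thesis unfolding q[OF False] k using False by (simp add: algebra_simps)
  qed
  then show "\<rho> j * (a' j / a j) * a j powi (- int n) * u * v * (x / (x - a j)) = 2 * (a' j / a j * c + a' j / (x - a j) * c)"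
    "\<rho> j * (a' j / a j) * a j powi (1 - int n) * u * v * (1 / (x - a j)) = 2 * (a' j / (x - a j) * c)"
    by auto
qed

lemma weighted_sums:
  assumes x: "x \<notin> points"
  shows "1/2 * (\<Sum>j=1..m. \<rho> j * (a' j / a j) * a j powi (- int n) * ea j * fs t (a j) * (x / (x - a j))) = - (S 1 1 + T 1 1 x)"
    and "1/2 * (\<Sum>j=1..m. \<rho> j * (a' j / a j) * a j powi (1 - int n) * ea j * f t (a j) * (1 / (x - a j))) = T 1 2 x"
    and "1/2 * (\<Sum>j=1..m. \<rho> j * (a' j / a j) * a j powi (1 - int n) * esa j * f t (a j) * (1 / (x - a j))) = - T 2 2 x"
    and "1/2 * (\<Sum>j=1..m. \<rho> j * (a' j / a j) * a j powi (- int n) * esa j * fs t (a j) * (x / (x - a j))) = S 2 1 + T 2 1 x"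
    and "1/2 * (\<Sum>j=1..m. \<rho> j * (a' j / a j) * a j powi (- int n) * esa j * f t (a j) * (x / (x - a j))) = - (S 2 2 + T 2 2 x)"
    and "1/2 * (\<Sum>j=1..m. \<rho> j * (a' j / a j) * a j powi (1 - int n) * ea j * fs t (a j) * (1 / (x - a j))) = - T 1 1 x"
    and "(\<Sum>j=1..m. \<rho> j * (a' j / a j)) = - (S 1 1 + S 2 2)"
    and "(\<Sum>j=1..m. \<rho> j * (a' j / (x - a j))) = - (T 1 1 x + T 2 2 x)"
proof -
  have xj: "x \<noteq> a j" if "j \<in> {1..m}" for j using x that by auto
  have sum1: "1/2 * (\<Sum>j=1..m. \<rho> j * (a' j / a j) * a j powi (- int n) * u j * v j * (x / (x - a j)))
      = (\<Sum>j=1..m. a' j / a j * c j) + (\<Sum>j=1..m. a' j / (x - a j) * c j)"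
    and sum2: "1/2 * (\<Sum>j=1..m. \<rho> j * (a' j / a j) * a j powi (1 - int n) * u j * v j * (1 / (x - a j)))
      = (\<Sum>j=1..m. a' j / (x - a j) * c j)"
    if q: "\<And>j. j \<in> {1..m} \<Longrightarrow> a j \<noteq> 0 \<Longrightarrow> \<rho> j * a j powi (- int n) * u j * v j = 2 * c j" for u v c
  proof -
    have "(\<Sum>j=1..m. \<rho> j * (a' j / a j) * a j powi (- int n) * u j * v j * (x / (x - a j)))
        = (\<Sum>j=1..m. 2 * (a' j / a j * c j + a' j / (x - a j) * c j))"
      by (intro sum.cong refl weighted_term(1)) (use xj q in auto)
    then show "1/2 * (\<Sum>j=1..m. \<rho> j * (a' j / a j) * a j powi (- int n) * u j * v j * (x / (x - a j)))
      = (\<Sum>j=1..m. a' j / a j * c j) + (\<Sum>j=1..m. a' j / (x - a j) * c j)"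
      by (simp only: sum_distrib_left[symmetric] sum.distrib) simp
    have "(\<Sum>j=1..m. \<rho> j * (a' j / a j) * a j powi (1 - int n) * u j * v j * (1 / (x - a j)))
        = (\<Sum>j=1..m. 2 * (a' j / (x - a j) * c j))"
      by (intro sum.cong refl weighted_term(2)) (use xj q in auto)
    then show "1/2 * (\<Sum>j=1..m. \<rho> j * (a' j / a j) * a j powi (1 - int n) * u j * v j * (1 / (x - a j)))
      = (\<Sum>j=1..m. a' j / (x - a j) * c j)"
      by (simp only: sum_distrib_left[symmetric]) simp
  qed
  have q1: "\<rho> j * a j powi (- int n) * ea j * fs t (a j) = 2 * (- A j $ 1 $ 1)" if "j \<in> {1..m}" "a j \<noteq> 0" for j
    unfolding residue_entries(1)[OF that] by simp
  have q2: "\<rho> j * a j powi (- int n) * ea j * f t (a j) = 2 * (A j $ 1 $ 2)" if "j \<in> {1..m}" "a j \<noteq> 0" for j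
    unfolding residue_entries(2)[OF that] by simp
  have q3: "\<rho> j * a j powi (- int n) * esa j * fs t (a j) = 2 * (A j $ 2 $ 1)" if "j \<in> {1..m}" "a j \<noteq> 0" for j
    unfolding residue_entries(3)[OF that] by simp
  have q4: "\<rho> j * a j powi (- int n) * esa j * f t (a j) = 2 * (- A j $ 2 $ 2)" if "j \<in> {1..m}" "a j \<noteq> 0" for j
    unfolding residue_entries(4)[OF that] by simp
  have negS: "(\<Sum>j=1..m. a' j / a j * - A j $ i $ k) = - S i k" for i k
    unfolding S_def sum_negf[symmetric] by (intro sum.cong refl) simp
  have negT: "(\<Sum>j=1..m. a' j / (x - a j) * - A j $ i $ k) = - T i k x" for i k
    unfolding T_def sum_negf[symmetric] by (intro sum.cong refl) simp
  show "1/2 * (\<Sum>j=1..m. \<rho> j * (a' j / a j) * a j powi (- int n) * ea j * fs t (a j) * (x / (x - a j))) = - (S 1 1 + T 1 1 x)"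
    by (rule trans[OF sum1[where u = "\<lambda>j. ea j" and v = "\<lambda>j. fs t (a j)", OF q1]]) (simp_all add: S_def T_def sum_negf)
  show "1/2 * (\<Sum>j=1..m. \<rho> j * (a' j / a j) * a j powi (1 - int n) * ea j * f t (a j) * (1 / (x - a j))) = T 1 2 x"
    by (rule trans[OF sum2[where u = "\<lambda>j. ea j" and v = "\<lambda>j. f t (a j)", OF q2]]) (simp_all add: S_def T_def sum_negf)
  show "1/2 * (\<Sum>j=1..m. \<rho> j * (a' j / a j) * a j powi (1 - int n) * esa j * f t (a j) * (1 / (x - a j))) = - T 2 2 x"
    by (rule trans[OF sum2[where u = "\<lambda>j. esa j" and v = "\<lambda>j. f t (a j)", OF q4]]) (simp_all add: S_def T_def sum_negf)
  show "1/2 * (\<Sum>j=1..m. \<rho> j * (a' j / a j) * a j powi (- int n) * esa j * fs t (a j) * (x / (x - a j))) = S 2 1 + T 2 1 x"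
    by (rule trans[OF sum1[where u = "\<lambda>j. esa j" and v = "\<lambda>j. fs t (a j)", OF q3]]) (simp_all add: S_def T_def sum_negf)
  show "1/2 * (\<Sum>j=1..m. \<rho> j * (a' j / a j) * a j powi (- int n) * esa j * f t (a j) * (x / (x - a j))) = - (S 2 2 + T 2 2 x)"
    by (rule trans[OF sum1[where u = "\<lambda>j. esa j" and v = "\<lambda>j. f t (a j)", OF q4]]) (simp_all add: S_def T_def sum_negf)
  show "1/2 * (\<Sum>j=1..m. \<rho> j * (a' j / a j) * a j powi (1 - int n) * ea j * fs t (a j) * (1 / (x - a j))) = - T 1 1 x"
    by (rule trans[OF sum2[where u = "\<lambda>j. ea j" and v = "\<lambda>j. fs t (a j)", OF q1]]) (simp_all add: S_def T_def sum_negf)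
  have tr: "\<rho> j * (a' j / y) = - (a' j / y * A j $ 1 $ 1 + a' j / y * A j $ 2 $ 2)" if j: "j \<in> {1..m}" for j y
  proof (cases "a j = 0")
    case True then show ?thesis using point_cases[OF j] by simp
  next
    case False
    then have \<rho>: "\<rho> j = - (A j $ 1 $ 1 + A j $ 2 $ 2)" using residue_entries(5)[OF j] by simp
    have "- (p + q) * c = - (c * p + c * q)" for p q c :: complex by (simp add: algebra_simps)
    then show ?thesis unfolding \<rho> .
  qed
  have trsum: "(\<Sum>j=1..m. \<rho> j * (a' j / y j)) = - ((\<Sum>j=1..m. a' j / y j * A j $ 1 $ 1) + (\<Sum>j=1..m. a' j / y j * A j $ 2 $ 2))" for y
    unfolding sum.distrib[symmetric] sum_negf[symmetric] by (intro sum.cong refl tr)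
  show "(\<Sum>j=1..m. \<rho> j * (a' j / a j)) = - (S 1 1 + S 2 2)" "(\<Sum>j=1..m. \<rho> j * (a' j / (x - a j))) = - (T 1 1 x + T 2 2 x)"
    unfolding S_def T_def by (rule trsum)+
qed

lemma T_continuous: "continuous_on (- points) (T i k)"
  unfolding T_def by (intro continuous_intros) auto

lemma T_isCont: "x \<notin> points \<Longrightarrow> isCont (T i k) x"
  using T_continuous[of i k] continuous_on_eq_continuous_at[of "- points" "T i k"]
    finite_imp_closed[of points] by (auto simp: open_Compl)

lemma T_at_infinity: "(T i k \<longlongrightarrow> 0) at_infinity"
proof -
  have "((\<lambda>x. a' j / (x - a j) * A j $ i $ k) \<longlongrightarrow> 0 * A j $ i $ k) at_infinity" for j
  proof (intro tendsto_mult_right tendsto_divide_0[OF tendsto_const])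
    show "filterlim (\<lambda>x. x - a j) at_infinity at_infinity"
      using tendsto_add_filterlim_at_infinity[OF tendsto_const[of "- a j"] filterlim_ident] by simp
  qed
  then have "((\<lambda>x. \<Sum>j=1..m. a' j / (x - a j) * A j $ i $ k) \<longlongrightarrow> (\<Sum>j=1..m. 0)) at_infinity"
    by (intro tendsto_sum) simp
  then show ?thesis by (simp add: T_def[abs_def])
qed

lemma T_at_0: "(T i k \<longlongrightarrow> - S i k) (at 0)"
proof -
  have "((\<lambda>x. a' j / (x - a j) * A j $ i $ k) \<longlongrightarrow> - (a' j / a j * A j $ i $ k)) (at 0)" if j: "j \<in> {1..m}" for j
  proof (cases "a j = 0")
    case True then show ?thesis using point_cases[OF j] by simp
  next
    case False
    have "((\<lambda>x. a' j / (x - a j) * A j $ i $ k) \<longlongrightarrow> a' j / (0 - a j) * A j $ i $ k) (at 0)"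
      using False by (intro tendsto_intros) auto
    then show ?thesis by simp
  qed
  then have "((\<lambda>x. \<Sum>j=1..m. a' j / (x - a j) * A j $ i $ k) \<longlongrightarrow> (\<Sum>j=1..m. - (a' j / a j * A j $ i $ k))) (at 0)"
    by (rule tendsto_sum)
  then show ?thesis by (simp add: T_def[abs_def] S_def sum_negf)
qed

lemma generic_not_point: "x \<in> \<Omega> t \<Longrightarrow> x \<notin> points"
  by (rule now.D_avoids_points)

end

context deformation_at_time
begin

abbreviation has_ddt :: "(complex \<Rightarrow> complex) \<Rightarrow> complex \<Rightarrow> bool" (infix "has'_ddt" 50) where
  "F has_ddt d \<equiv> (F has_field_derivative d) (at t within U)"

definition scalar_equations :: bool where
  "scalar_equations \<longleftrightarrow>
     (\<forall>x. x \<notin> points \<longrightarrow>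
        (\<lambda>s. f s x) has_ddt ((- r + S 2 2 - T 1 1 x) * f t x - T 1 2 x * fs t x) \<and>
        (\<lambda>s. fs s x) has_ddt ((- r - T 2 2 x) * fs t x - (S 2 1 + T 2 1 x) * f t x)) \<and>
     (\<forall>x. x \<notin> sphere 0 1 \<and> x \<notin> points \<longrightarrow>
        (\<lambda>s. e s x) has_ddt ((- r + S 2 2 + T 2 2 x) * e t x + T 1 2 x * es t x) \<and>
        (\<lambda>s. es s x) has_ddt ((- r + T 1 1 x) * es t x + (S 2 1 + T 2 1 x) * e t x))"

definition matrix_equations :: bool where
  "matrix_equations \<longleftrightarrow> (\<forall>x \<in> \<Omega> t - sphere 0 1.
        (\<lambda>s. f s x) has_ddt ((r - T 1 1 x) * f t x - T 1 2 x * fs t x) \<and>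
        (\<lambda>s. fs s x) has_ddt ((b - T 2 1 x) * f t x + (- r - T 2 2 x) * fs t x) \<and>
        (\<lambda>s. e s x) has_ddt ((r + T 2 2 x) * e t x + T 1 2 x * es t x) \<and>
        (\<lambda>s. es s x) has_ddt ((T 2 1 x - b) * e t x + (- r + T 1 1 x) * es t x))"

lemma kappa_ddt: "ddt U (\<kappa> n) t = r * \<kappa> n t"
  using \<kappa>_nonzero[OF t] by simp

lemma phi_derivative_polynomials:
  obtains Df Dfs where "degree Df \<le> n" "degree Dfs \<le> n"
    "\<And>x. (\<lambda>s. f s x) has_ddt poly Df x" "\<And>x. (\<lambda>s. fs s x) has_ddt poly Dfs x"
    "coeff Df n = r * \<kappa> n t" "coeff Dfs 0 = r * \<kappa> n t" "coeff Dfs n = ddt U (\<lambda>s. poly (\<phi>b n s) 0) t"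
proof -
  obtain Df where Df: "degree Df \<le> n" "\<And>x. (\<lambda>s. f s x) has_ddt poly Df x"
    "\<And>i. i \<le> n \<Longrightarrow> coeff Df i = ddt U (\<lambda>s. coeff (\<phi> n s) i) t"
  proof (rule poly_deformation_derivative[OF t, of "\<phi> n" n])
    show "coeffs_differentiable U t (\<phi> n)" using phi_coeff_differentiable(1)[OF t] by (simp add: coeffs_differentiable_def)
  qed (use degrees in auto)
  obtain Dfs where Dfs: "degree Dfs \<le> n" "\<And>x. (\<lambda>s. fs s x) has_ddt poly Dfs x"
    "\<And>i. i \<le> n \<Longrightarrow> coeff Dfs i = ddt U (\<lambda>s. coeff (reflect_poly (\<phi>b n s)) i) t"
  proof (rule poly_deformation_derivative[OF t reflect_phib_differentiable[OF t], of n n])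
    show "degree (reflect_poly (\<phi>b n s)) \<le> n" if "s \<in> U" for s
      using degree_reflect_poly_le[of "\<phi>b n s"] degrees[OF that, of n] by simp
  qed blast
  have 1: "coeff Df n = r * \<kappa> n t"
    unfolding Df(3)[OF order_refl] kappa_ddt[symmetric]
    by (rule ddt_cong[OF t _ kappa_differentiable[OF t]]) (simp add: leading_coeffs)
  have 2: "coeff Dfs 0 = r * \<kappa> n t"
    unfolding Dfs(3)[OF le0] kappa_ddt[symmetric]
    by (rule ddt_cong[OF t _ kappa_differentiable[OF t]]) (simp add: leading_coeffs coeff_reflect_phib degrees)
  have pd: "(\<lambda>s. poly (\<phi>b n s) 0) field_differentiable (at t within U)"
    using phi_coeff_differentiable(2)[OF t] by (simp add: poly_0_coeff_0)
  have 3: "coeff Dfs n = ddt U (\<lambda>s. poly (\<phi>b n s) 0) t"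
    unfolding Dfs(3)[OF order_refl]
    by (rule ddt_cong[OF t _ pd]) (simp add: poly_0_coeff_0 coeff_reflect_phib)
  show ?thesis using that[OF Df(1) Dfs(1) Df(2) Dfs(2) 1 2 3] .
qed

text \<open>
  Leading coefficients at infinity: both sides of the equations for \<open>\<phi>\<close> and \<open>\<phi>\<^sup>*\<close> are divided by
  \<open>x ^ n\<close>, and \<open>T\<close> vanishes at infinity.
\<close>

lemma scalar_equations_imp_constraints:
  assumes scalar_equations
  shows "2 * r = S 2 2" and "b = - S 2 1"
proof -
  obtain Df Dfs where D: "degree Df \<le> n" "degree Dfs \<le> n"
    "\<And>x. (\<lambda>s. f s x) has_ddt poly Df x" "\<And>x. (\<lambda>s. fs s x) has_ddt poly Dfs x"
    "coeff Df n = r * \<kappa> n t" "coeff Dfs n = ddt U (\<lambda>s. poly (\<phi>b n s) 0) t"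
    by (rule phi_derivative_polynomials) (rule that)
  have degs: "degree (\<phi> n t) \<le> n" "degree (reflect_poly (\<phi>b n t)) \<le> n"
    using degrees[OF t, of n] degree_reflect_poly_le[of "\<phi>b n t"] by auto
  have fin: "\<forall>\<^sub>F x in at_infinity. x \<notin> points"
  proof -
    have "bounded points" by (intro finite_imp_bounded) simp
    then obtain B where "\<And>x. x \<in> points \<Longrightarrow> cmod x \<le> B" by (meson bounded_iff)
    then show ?thesis unfolding eventually_at_infinity by (intro exI[of _ "B + 1"]) fastforce
  qed
  have lim: "l = q" if P: "degree P \<le> n" "coeff P n = l" and eq: "\<And>x. x \<notin> points \<Longrightarrow> poly P x = g x * poly P1 x + h x * poly P2 x"
    and g: "(g \<longlongrightarrow> g0) at_infinity" "(h \<longlongrightarrow> h0) at_infinity"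
    and P12: "degree P1 \<le> n" "degree P2 \<le> n" "q = g0 * coeff P1 n + h0 * coeff P2 n" for P P1 P2 l q g h g0 h0
  proof -
    have "((\<lambda>x. g x * (poly P1 x / x ^ n) + h x * (poly P2 x / x ^ n)) \<longlongrightarrow> q) at_infinity"
      unfolding P12(3) by (intro tendsto_intros g poly_over_power_tendsto P12)
    moreover have "\<forall>\<^sub>F x in at_infinity. g x * (poly P1 x / x ^ n) + h x * (poly P2 x / x ^ n) = poly P x / x ^ n"
      using fin by eventually_elim (simp add: eq add_divide_distrib)
    ultimately have "((\<lambda>x. poly P x / x ^ n) \<longlongrightarrow> q) at_infinity" by (rule Lim_transform_eventually)
    then show ?thesis
      using tendsto_unique[OF trivial_limit_at_infinity poly_over_power_tendsto[OF P(1)]] P(2) by simp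
  qed
  have "r * \<kappa> n t = (- r + S 2 2) * \<kappa> n t"
  proof (rule lim[OF D(1) D(5)])
    show "poly Df x = (- r + S 2 2 - T 1 1 x) * f t x + (- T 1 2 x) * fs t x" if "x \<notin> points" for x
    proof -
      have "(\<lambda>s. f s x) has_ddt ((- r + S 2 2 - T 1 1 x) * f t x - T 1 2 x * fs t x)"
        using assms that unfolding scalar_equations_def by blast
      from derivative_unique[OF t D(3) this] show ?thesis by simp
    qed
    show "((\<lambda>x. - r + S 2 2 - T 1 1 x) \<longlongrightarrow> - r + S 2 2 - 0) at_infinity"
      by (intro tendsto_intros T_at_infinity)
    show "((\<lambda>x. - T 1 2 x) \<longlongrightarrow> - 0) at_infinity" by (intro tendsto_intros T_at_infinity)
  qed (use degs leading_coeffs[OF t] in auto)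
  then have "r = - r + S 2 2" unfolding mult_cancel_right using \<kappa>_nonzero[OF t, of n] by blast
  moreover have "2 * p = q" if "p = - p + q" for p q :: complex
  proof -
    have "p + p = p + (- p + q)" by (simp only: that[symmetric])
    then show ?thesis by simp
  qed
  ultimately show c1: "2 * r = S 2 2" by blast
  let ?\<beta> = "poly (\<phi>b n t) 0"
  have "ddt U (\<lambda>s. poly (\<phi>b n s) 0) t = - r * ?\<beta> + (- S 2 1) * \<kappa> n t"
  proof (rule lim[OF D(2) D(6)])
    show "poly Dfs x = (- r - T 2 2 x) * fs t x + (- (S 2 1 + T 2 1 x)) * f t x" if "x \<notin> points" for x
    proof -
      have "(\<lambda>s. fs s x) has_ddt ((- r - T 2 2 x) * fs t x - (S 2 1 + T 2 1 x) * f t x)"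
        using assms that unfolding scalar_equations_def by blast
      from derivative_unique[OF t D(4) this] show ?thesis by (simp only: mult_minus_left diff_conv_add_uminus)
    qed
    show "((\<lambda>x. - r - T 2 2 x) \<longlongrightarrow> - r - 0) at_infinity"
      by (intro tendsto_intros T_at_infinity)
    show "((\<lambda>x. - (S 2 1 + T 2 1 x)) \<longlongrightarrow> - (S 2 1 + 0)) at_infinity" by (intro tendsto_intros T_at_infinity)
  qed (use degs leading_coeffs[OF t] coeff_reflect_phib[OF t, of n n] in \<open>auto simp: poly_0_coeff_0\<close>)
  moreover have "(k * d' + d * \<beta>) / k\<^sup>2 = - c"
    if "k \<noteq> 0" "d' = - (d / k) * \<beta> + (- c) * k" for k d d' c \<beta> :: complex
    unfolding that(2) using that(1) by (simp add: field_simps power2_eq_square)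
  ultimately show "b = - S 2 1" using \<kappa>_nonzero[OF t, of n] by blast
qed

text \<open>
  The function \<open>h s\<close> below is \<open>\<epsilon> / x ^ n\<close>, continued to 0, where its value \<open>2 / \<kappa>\<close> has a known
  derivative; \<open>\<epsilon>\<^sup>* / x ^ n = - 2 v\<close> vanishes at 0.  The limit \<open>x \<rightarrow> 0\<close> of the equation for \<open>\<epsilon>\<close>, where
  \<open>T\<close> tends to \<open>- S\<close>, gives \<open>2 r = S 2 2\<close>.  The equation for \<open>\<phi>\<^sup>*\<close> at 0 then leaves \<open>(b + S 2 1) \<phi>(0) = 0\<close>.
\<close>

lemma matrix_equations_imp_constraints:
  assumes matrix_equations
  shows "2 * r = S 2 2" and "b = - S 2 1"
proof -
  define E where "E = \<Omega> t - sphere 0 1 - {0}"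
  have E: "0 islimpt E" unfolding E_def by (rule generic_points_accumulate[OF t]) simp
  then have nontriv: "at 0 within E \<noteq> bot" using trivial_limit_within by blast
  have T0: "(T i k \<longlongrightarrow> - S i k) (at 0 within E)" for i k
    using T_at_0 by (meson tendsto_within_subset top_greatest)
  define h where "h = (\<lambda>s x. 2 * (\<Sum>i\<le>n. coeff (\<phi> n s) i * cauchy_moment (w s) (1 - int n + int i) x))"
  define v where "v = cauchy_moment (now.v n) 1"
  have hu: "h s x = 2 * cauchy_moment (\<lambda>\<zeta>. w s \<zeta> * poly (\<phi> n s) \<zeta>) (1 - int n) x"
    if "s \<in> U" "x \<notin> sphere 0 1" for s x
  proof -
    interpret S: semiclassical_system m "\<lambda>j. z j s" \<rho> "\<Omega> s" "w s" "\<lambda>n. \<kappa> n s" "\<lambda>n. \<phi> n s" "\<lambda>n. \<phi>b n s"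
      by (rule system[OF that(1)])
    show ?thesis unfolding h_def
      by (subst cauchy_moment_poly_mult[OF S.w_integrable that(2)]) (auto simp: S.degree_phi)
  qed
  have h0: "h s 0 = 2 * (1 / \<kappa> n s)" if "s \<in> U" for s
  proof -
    interpret S: semiclassical_system m "\<lambda>j. z j s" \<rho> "\<Omega> s" "w s" "\<lambda>n. \<kappa> n s" "\<lambda>n. \<phi> n s" "\<lambda>n. \<phi>b n s"
      by (rule system[OF that])
    show ?thesis using hu[OF that, of 0] S.eps_leading_coefficient[of n] by simp
  qed
  have v0: "v 0 = 0"
    using cauchy_moment_add_one[OF now.v_integrable, of 0 n 0] now.moment_v[of 0 n] n by (simp add: v_def)
  have "isCont v 0"
    unfolding v_def by (rule DERIV_isCont[OF cauchy_moment_has_field_derivative[OF now.v_integrable]]) simp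
  then have vl: "(v \<longlongrightarrow> 0) (at 0 within E)"
    unfolding isCont_def v0 by (meson tendsto_within_subset top_greatest)
  have hol: "h s holomorphic_on ball 0 1" if "s \<in> U" for s
    unfolding h_def
    by (intro holomorphic_intros holomorphic_on_subset[OF cauchy_moment_holomorphic[OF w_circle_integrable[OF that]]]) auto
  have "h t holomorphic_on ball 0 1" by (rule hol[OF t])
  then have "isCont (h t) 0"
    using continuous_on_eq_continuous_at[OF open_ball, of 0 1 "h t"] holomorphic_on_imp_continuous_on by force
  then have hl: "(h t \<longlongrightarrow> h t 0) (at 0 within E)"
    unfolding isCont_def by (meson tendsto_within_subset top_greatest)
  have "(\<lambda>s. h s 0) has_ddt ((r + - S 2 2) * h t 0 + (- S 1 2) * (- 2 * 0))"
  proof (rule lips_derivative_extends[where S = "ball 0 1" and E = E, OF _ t open_ball _ hol E])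
    show "lips U t h 0"
      unfolding h_def
      by (intro lips_mult lips_sum lips_space_independent phi_coeff_differentiable t cauchy_moment_lips_at_0 field_differentiable_const) auto
    show "((\<lambda>x. (r + T 2 2 x) * h t x + T 1 2 x * (- 2 * v x)) \<longlongrightarrow> (r + - S 2 2) * h t 0 + (- S 1 2) * (- 2 * 0)) (at 0 within E)"
      by (intro tendsto_intros T0 hl vl)
    fix x assume x: "x \<in> E"
    then have x': "x \<in> \<Omega> t - sphere 0 1" "x \<notin> sphere 0 1" "x \<noteq> 0" by (auto simp: E_def)
    have "(\<lambda>s. e s x) has_ddt ((r + T 2 2 x) * e t x + T 1 2 x * es t x)"
      using assms x' unfolding matrix_equations_def by blast
    then have "(\<lambda>s. e s x / x ^ n) has_ddt (((r + T 2 2 x) * e t x + T 1 2 x * es t x) / x ^ n)"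
      by (rule DERIV_cdivide)
    moreover have he: "h s x = e s x / x ^ n" if "s \<in> U" for s
      using eps_expansion(2)[OF that n x'(2)] x'(3) by (simp add: h_def)
    moreover have "es t x = - 2 * x ^ n * v x"
      using now.eps_star_eq[OF n x'(2)] by (simp add: v_def)
    then have "((r + T 2 2 x) * e t x + T 1 2 x * es t x) / x ^ n = (r + T 2 2 x) * h t x + T 1 2 x * (- 2 * v x)"
    proof -
      have cancel: "(p * (y * q) + p' * (- 2 * y * q')) / y = p * q + p' * (- 2 * q')" if "y \<noteq> 0" for p p' q q' y :: complex
        using that by (simp add: field_simps)
      have et: "e t x = x ^ n * h t x" using he[OF t] x'(3) by simp
      have "x ^ n \<noteq> 0" using x'(3) by simp
      from cancel[OF this] show ?thesis unfolding et \<open>es t x = - 2 * x ^ n * v x\<close> .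
    qed
    ultimately have "(\<lambda>s. e s x / x ^ n) has_ddt ((r + T 2 2 x) * h t x + T 1 2 x * (- 2 * v x))" by simp
    then show "(\<lambda>s. h s x) has_ddt ((r + T 2 2 x) * h t x + T 1 2 x * (- 2 * v x))"
      by (rule has_field_derivative_transform_within[OF _ zero_less_one_real t]) (simp add: he)
  qed auto
  moreover have "(\<lambda>s. h s 0) has_ddt (2 * (- (1 / \<kappa> n t) * r))"
  proof -
    have k: "(\<kappa> n has_field_derivative r * \<kappa> n t) (at t within U)"
      by (subst kappa_ddt[symmetric]) (rule ddt_has_field_derivative[OF t kappa_differentiable[OF t]])
    have "(\<lambda>s. 2 * (1 / \<kappa> n s)) has_ddt (2 * ((0 * \<kappa> n t - 1 * (r * \<kappa> n t)) / (\<kappa> n t * \<kappa> n t)))"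
      by (intro DERIV_cmult DERIV_divide DERIV_const k \<kappa>_nonzero t)
    moreover have "(0 * \<kappa> n t - 1 * (r * \<kappa> n t)) / (\<kappa> n t * \<kappa> n t) = - (1 / \<kappa> n t) * r"
      using \<kappa>_nonzero[OF t, of n] by (simp add: divide_simps)
    ultimately have "(\<lambda>s. 2 * (1 / \<kappa> n s)) has_ddt (2 * (- (1 / \<kappa> n t) * r))" by (simp only:)
    then show ?thesis
      by (rule has_field_derivative_transform_within[OF _ zero_less_one_real t]) (simp add: h0)
  qed
  ultimately have "(r + - S 2 2) * h t 0 + (- S 1 2) * (- 2 * 0) = 2 * (- (1 / \<kappa> n t) * r)"
    by (rule derivative_unique[OF t])
  moreover have "2 * p = q"
    if "i * k = 1" "(p + - q) * (2 * i) + c * (- 2 * 0) = 2 * (- i * p)" for p q i k c :: complex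
  proof -
    have "(i * k) * (p - q) = (k / 2) * ((p + - q) * (2 * i) + c * (- 2 * 0))" by (simp add: algebra_simps)
    also have "\<dots> = (k / 2) * (2 * (- i * p))" by (simp only: that(2))
    also have "\<dots> = (i * k) * (- p)" by simp
    finally have "p - q = - p" by (simp only: that(1) mult_1_left)
    then have h: "p = - p + q" by (simp only: diff_eq_eq)
    have "p + p = p + (- p + q)" by (simp only: h[symmetric])
    then show ?thesis by simp
  qed
  moreover have "1 / \<kappa> n t * \<kappa> n t = 1" using \<kappa>_nonzero[OF t] by simp
  ultimately show c1: "2 * r = S 2 2" unfolding h0[OF t] by blast
  obtain Df Dfs where D: "\<And>x. (\<lambda>s. fs s x) has_ddt poly Dfs x" "coeff Dfs 0 = r * \<kappa> n t"
    by (rule phi_derivative_polynomials) (rule that)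
  have P: "((\<lambda>x. poly p x) \<longlongrightarrow> poly p 0) (at 0 within E)" for p by (intro tendsto_intros)
  have "((\<lambda>x. (b - T 2 1 x) * f t x + (- r - T 2 2 x) * fs t x) \<longlongrightarrow> (b - - S 2 1) * f t 0 + (- r - - S 2 2) * fs t 0) (at 0 within E)"
    by (intro tendsto_intros T0)
  moreover have "\<forall>\<^sub>F x in at 0 within E. (b - T 2 1 x) * f t x + (- r - T 2 2 x) * fs t x = poly Dfs x"
    unfolding eventually_at_filter
  proof (intro always_eventually allI impI)
    fix x assume "x \<in> E"
    then have "(\<lambda>s. fs s x) has_ddt ((b - T 2 1 x) * f t x + (- r - T 2 2 x) * fs t x)"
      using assms unfolding matrix_equations_def E_def by blast
    from derivative_unique[OF t this D(1)] show "(b - T 2 1 x) * f t x + (- r - T 2 2 x) * fs t x = poly Dfs x" .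
  qed
  ultimately have "((\<lambda>x. poly Dfs x) \<longlongrightarrow> (b - - S 2 1) * f t 0 + (- r - - S 2 2) * fs t 0) (at 0 within E)"
    by (rule Lim_transform_eventually)
  then have "poly Dfs 0 = (b - - S 2 1) * f t 0 + (- r - - S 2 2) * fs t 0"
    using tendsto_unique[OF nontriv P] by blast
  moreover have "fs t 0 = \<kappa> n t"
    using leading_coeffs[OF t, of n] coeff_reflect_phib[OF t, of n 0] by (simp add: poly_0_coeff_0)
  ultimately have "r * \<kappa> n t = (b + S 2 1) * f t 0 + (- r + S 2 2) * \<kappa> n t"
    using D(2) by (simp add: poly_0_coeff_0)
  moreover have "(- r + S 2 2) = r" using c1 by (simp add: algebra_simps)
  ultimately have "(b + S 2 1) * f t 0 = 0" by simp
  then have "b + S 2 1 = 0" using constant_terms[OF t, of n] by simp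
  then show "b = - S 2 1" by (simp add: eq_neg_iff_add_eq_0)
qed

text \<open>
  The constraints turn one right-hand side into the other on the cut plane; density extends the
  equations for the polynomials, and the Lipschitz bounds those for \<open>\<epsilon>\<close> and \<open>\<epsilon>\<^sup>*\<close>.
\<close>

lemma matrix_equations_imp_scalar_equations:
  assumes M: matrix_equations
  shows scalar_equations
proof -
  note c = matrix_equations_imp_constraints[OF M]
  have c1: "- r + S 2 2 = r" using c(1) by (simp add: algebra_simps)
  have c2: "S 2 1 = - b" using c(2) by simp
  obtain Df Dfs where D: "\<And>x. (\<lambda>s. f s x) has_ddt poly Df x" "\<And>x. (\<lambda>s. fs s x) has_ddt poly Dfs x"
    by (rule phi_derivative_polynomials) (rule that)
  have oP: "open (- points)" by (intro open_Compl finite_imp_closed) simp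
  have dense: "closure (\<Omega> t - sphere 0 1) = UNIV"
    using cut_plane[OF t] interior_circle_union_finite[of "{}"] by (intro dense_open_minus_nowhere_dense) auto
  have "(\<lambda>s. f s x) has_ddt ((- r + S 2 2 - T 1 1 x) * f t x - T 1 2 x * fs t x)" if x: "x \<notin> points" for x
  proof -
    have "poly Df x = (r - T 1 1 x) * f t x - T 1 2 x * fs t x"
    proof (rule equal_on_dense_imp_equal[OF oP _ dense, where F = "poly Df" and G = "\<lambda>x. (r - T 1 1 x) * f t x - T 1 2 x * fs t x"])
      show "poly Df y = (r - T 1 1 y) * f t y - T 1 2 y * fs t y" if "y \<in> \<Omega> t - sphere 0 1" for y
        using M that derivative_unique[OF t D(1)] unfolding matrix_equations_def by blast
    qed ((use x in simp), intro continuous_intros, intro continuous_intros T_continuous)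
    then show ?thesis using D(1)[of x] unfolding c1 by simp
  qed
  moreover have "(\<lambda>s. fs s x) has_ddt ((- r - T 2 2 x) * fs t x - (S 2 1 + T 2 1 x) * f t x)" if x: "x \<notin> points" for x
  proof -
    have "poly Dfs x = (b - T 2 1 x) * f t x + (- r - T 2 2 x) * fs t x"
    proof (rule equal_on_dense_imp_equal[OF oP _ dense, where F = "poly Dfs" and G = "\<lambda>x. (b - T 2 1 x) * f t x + (- r - T 2 2 x) * fs t x"])
      show "poly Dfs y = (b - T 2 1 y) * f t y + (- r - T 2 2 y) * fs t y" if "y \<in> \<Omega> t - sphere 0 1" for y
        using M that derivative_unique[OF t D(2)] unfolding matrix_equations_def by blast
    qed ((use x in simp), intro continuous_intros, intro continuous_intros T_continuous)
    also have "\<dots> = (- r - T 2 2 x) * fs t x - (S 2 1 + T 2 1 x) * f t x"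
      unfolding c2 by (simp only: ring_distribs) simp
    finally show ?thesis using D(2)[of x] by simp
  qed
  moreover have ce: "isCont (e t) x" "isCont (es t) x" if "x \<notin> sphere 0 1" for x
    using eps_holomorphic[OF t n] now.holomorphic_off_circle_isCont that by blast+
  have "(\<lambda>s. e s x) has_ddt ((- r + S 2 2 + T 2 2 x) * e t x + T 1 2 x * es t x)"
    if x: "x \<notin> sphere 0 1" "x \<notin> points" for x
    unfolding c1
  proof (rule derivative_extends_to_cuts[OF t x eps_lips[OF t n x] eps_holomorphic(1)[OF _ n],
        where g = "\<lambda>x. (r + T 2 2 x) * e t x + T 1 2 x * es t x"])
    show "isCont (\<lambda>x. (r + T 2 2 x) * e t x + T 1 2 x * es t x) x"
      by (intro continuous_intros T_isCont ce x)
  qed (use M in \<open>auto simp: matrix_equations_def\<close>)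
  moreover have "(\<lambda>s. es s x) has_ddt ((- r + T 1 1 x) * es t x + (S 2 1 + T 2 1 x) * e t x)"
    if x: "x \<notin> sphere 0 1" "x \<notin> points" for x
  proof -
    have "(\<lambda>s. es s x) has_ddt ((T 2 1 x - b) * e t x + (- r + T 1 1 x) * es t x)"
    proof (rule derivative_extends_to_cuts[OF t x eps_star_lips[OF t n x] eps_holomorphic(2)[OF _ n],
          where g = "\<lambda>x. (T 2 1 x - b) * e t x + (- r + T 1 1 x) * es t x"])
      show "isCont (\<lambda>x. (T 2 1 x - b) * e t x + (- r + T 1 1 x) * es t x) x"
        by (intro continuous_intros T_isCont ce x)
    qed (use M in \<open>auto simp: matrix_equations_def\<close>)
    moreover have "(T 2 1 x - b) * e t x + (- r + T 1 1 x) * es t x = (- r + T 1 1 x) * es t x + (S 2 1 + T 2 1 x) * e t x"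
      unfolding c2 by (simp only: ring_distribs) simp
    ultimately show ?thesis by (simp only:)
  qed
  ultimately show ?thesis unfolding scalar_equations_def by blast
qed

lemma scalar_equations_imp_matrix_equations:
  assumes L: scalar_equations
  shows matrix_equations
  unfolding matrix_equations_def
proof
  note c = scalar_equations_imp_constraints[OF L]
  have c1: "- r + S 2 2 = r" using c(1) by (simp add: algebra_simps)
  have c2: "S 2 1 = - b" using c(2) by simp
  fix x assume "x \<in> \<Omega> t - sphere 0 1"
  then have x: "x \<notin> points" "x \<notin> sphere 0 1" using generic_not_point by auto
  have L1: "(\<lambda>s. f s x) has_ddt ((- r + S 2 2 - T 1 1 x) * f t x - T 1 2 x * fs t x)"
    and L2: "(\<lambda>s. fs s x) has_ddt ((- r - T 2 2 x) * fs t x - (S 2 1 + T 2 1 x) * f t x)"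
    and L3: "(\<lambda>s. e s x) has_ddt ((- r + S 2 2 + T 2 2 x) * e t x + T 1 2 x * es t x)"
    and L4: "(\<lambda>s. es s x) has_ddt ((- r + T 1 1 x) * es t x + (S 2 1 + T 2 1 x) * e t x)"
    using L x unfolding scalar_equations_def by blast+
  have q2: "(- r - T 2 2 x) * fs t x - (S 2 1 + T 2 1 x) * f t x = (b - T 2 1 x) * f t x + (- r - T 2 2 x) * fs t x"
    unfolding c2 by (simp only: ring_distribs) simp
  have q4: "(- r + T 1 1 x) * es t x + (S 2 1 + T 2 1 x) * e t x = (T 2 1 x - b) * e t x + (- r + T 1 1 x) * es t x"
    unfolding c2 by (simp only: ring_distribs) simp
  show "(\<lambda>s. f s x) has_ddt ((r - T 1 1 x) * f t x - T 1 2 x * fs t x) \<and>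
        (\<lambda>s. fs s x) has_ddt ((b - T 2 1 x) * f t x + (- r - T 2 2 x) * fs t x) \<and>
        (\<lambda>s. e s x) has_ddt ((r + T 2 2 x) * e t x + T 1 2 x * es t x) \<and>
        (\<lambda>s. es s x) has_ddt ((T 2 1 x - b) * e t x + (- r + T 1 1 x) * es t x)"
    by (intro conjI L1[unfolded c1] L2[unfolded q2] L3[unfolded c1] L4[unfolded q4])
qed

lemma scalar_equations_unfolded:
  "scalar_equations \<longleftrightarrow>
       ((\<forall>x. x \<notin> points \<longrightarrow>
           ((\<lambda>s. f s x) has_field_derivative
              (- r - (\<Sum>j=1..m. \<rho> j * (a' j / a j))
                 + 1/2 * (\<Sum>j=1..m. \<rho> j * (a' j / a j) * a j powi (- int n)
                                       * ea j * fs t (a j) * (x / (x - a j)))) * f t x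
              - (1/2 * (\<Sum>j=1..m. \<rho> j * (a' j / a j) * a j powi (1 - int n)
                                     * ea j * f t (a j) * (1 / (x - a j)))) * fs t x)
             (at t within U)) \<and>
        (\<forall>x. x \<notin> points \<longrightarrow>
           ((\<lambda>s. fs s x) has_field_derivative
              (- r + 1/2 * (\<Sum>j=1..m. \<rho> j * (a' j / a j) * a j powi (1 - int n)
                                         * esa j * f t (a j) * (1 / (x - a j)))) * fs t x
              - (1/2 * (\<Sum>j=1..m. \<rho> j * (a' j / a j) * a j powi (- int n)
                                     * esa j * fs t (a j) * (x / (x - a j)))) * f t x)
             (at t within U)) \<and>
        (\<forall>x. x \<notin> sphere 0 1 \<and> x \<notin> points \<longrightarrow>
           ((\<lambda>s. e s x) has_field_derivative
              (- r - 1/2 * (\<Sum>j=1..m. \<rho> j * (a' j / a j) * a j powi (- int n)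
                                         * esa j * f t (a j) * (x / (x - a j)))) * e t x
              + (1/2 * (\<Sum>j=1..m. \<rho> j * (a' j / a j) * a j powi (1 - int n)
                                     * ea j * f t (a j) * (1 / (x - a j)))) * es t x)
             (at t within U)) \<and>
        (\<forall>x. x \<notin> sphere 0 1 \<and> x \<notin> points \<longrightarrow>
           ((\<lambda>s. es s x) has_field_derivative
              (- r - 1/2 * (\<Sum>j=1..m. \<rho> j * (a' j / a j) * a j powi (1 - int n)
                                         * ea j * fs t (a j) * (1 / (x - a j)))) * es t x
              + (1/2 * (\<Sum>j=1..m. \<rho> j * (a' j / a j) * a j powi (- int n)
                                     * esa j * fs t (a j) * (x / (x - a j)))) * e t x)
             (at t within U)))" (is "_ \<longleftrightarrow> (\<forall>x. _ \<longrightarrow> ?L1 x) \<and> (\<forall>x. _ \<longrightarrow> ?L2 x) \<and> (\<forall>x. _ \<longrightarrow> ?L3 x) \<and> (\<forall>x. _ \<longrightarrow> ?L4 x)")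
proof -
  have e1: "- r - - (S 1 1 + S 2 2) + - (S 1 1 + T 1 1 x) = - r + S 2 2 - T 1 1 x" for x by simp
  have e2: "- r + - T 2 2 x = - r - T 2 2 x" for x by simp
  have e3: "- r - - (S 2 2 + T 2 2 x) = - r + S 2 2 + T 2 2 x" for x by simp
  have e4: "- r - - T 1 1 x = - r + T 1 1 x" for x by simp
  have l1: "?L1 x \<longleftrightarrow> (\<lambda>s. f s x) has_ddt ((- r + S 2 2 - T 1 1 x) * f t x - T 1 2 x * fs t x)"
    and l2: "?L2 x \<longleftrightarrow> (\<lambda>s. fs s x) has_ddt ((- r - T 2 2 x) * fs t x - (S 2 1 + T 2 1 x) * f t x)"
    and l3: "?L3 x \<longleftrightarrow> (\<lambda>s. e s x) has_ddt ((- r + S 2 2 + T 2 2 x) * e t x + T 1 2 x * es t x)"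
    and l4: "?L4 x \<longleftrightarrow> (\<lambda>s. es s x) has_ddt ((- r + T 1 1 x) * es t x + (S 2 1 + T 2 1 x) * e t x)"
    if "x \<notin> points" for x
    unfolding weighted_sums[OF that] e1 e2 e3 e4 by (rule refl)+
  show ?thesis unfolding scalar_equations_def using l1 l2 l3 l4 by blast
qed

lemma matrix_equations_unfolded:
  "matrix_equations \<longleftrightarrow> (\<forall>x \<in> \<Omega> t - sphere 0 1. \<forall>i k.
      ((\<lambda>s. Ymat n (w s) (\<phi> n s) (\<phi>b n s) x $ i $ k) has_field_derivative
         ((Binf U (\<kappa> n) (\<lambda>s. poly (\<phi>b n s) 0) t - (\<Sum>j=1..m. mat (a' j / (x - a j)) ** A j))
            ** Ymat n (w t) (\<phi> n t) (\<phi>b n t) x) $ i $ k) (at t within U))"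
  unfolding matrix_equations_def
proof (rule ball_cong[OF refl])
  fix x assume "x \<in> \<Omega> t - sphere 0 1"
  then have x: "x \<in> \<Omega> t" "x \<notin> sphere 0 1" by auto
  let ?B = "Binf U (\<kappa> n) (\<lambda>s. poly (\<phi>b n s) 0) t - (\<Sum>j=1..m. mat (a' j / (x - a j)) ** A j)"
  have B: "?B $ 1 $ 1 = r - T 1 1 x" "?B $ 1 $ 2 = - T 1 2 x" "?B $ 2 $ 1 = b - T 2 1 x" "?B $ 2 $ 2 = - r - T 2 2 x"
    unfolding vector_minus_component matrix_sum_entry T_def by (simp_all add: Binf_def)
  let ?Y = "\<lambda>s. Ymat n (w s) (\<phi> n s) (\<phi>b n s) x"
  let ?W = "w t x"
  have w0: "?W \<noteq> 0" by (rule now.w_nonzero[OF x(1)])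
  have wd: "(\<lambda>s. w s x) has_ddt ((T 1 1 x + T 2 2 x) * ?W)"
    using w_deformation_derivative[OF t x(1)] by (simp only: weighted_sums(8)[OF generic_not_point[OF x(1)]] minus_minus)
  have y3: "((\<lambda>s. e s x / w s x) has_ddt v) \<longleftrightarrow> (\<lambda>s. e s x) has_ddt (v * ?W + e t x / ?W * ((T 1 1 x + T 2 2 x) * ?W))" for v
    by (rule has_field_derivative_divide_iff[OF wd w0])
  have y4: "((\<lambda>s. - es s x / w s x) has_ddt v) \<longleftrightarrow> (\<lambda>s. es s x) has_ddt (- (v * ?W) + es t x / ?W * ((T 1 1 x + T 2 2 x) * ?W))" for v
  proof -
    have "((\<lambda>s. - es s x / w s x) has_ddt v) \<longleftrightarrow> (\<lambda>s. - es s x) has_ddt (v * ?W + - es t x / ?W * ((T 1 1 x + T 2 2 x) * ?W))"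
      by (rule has_field_derivative_divide_iff[OF wd w0])
    also have "\<dots> \<longleftrightarrow> (\<lambda>s. es s x) has_ddt - (v * ?W + - es t x / ?W * ((T 1 1 x + T 2 2 x) * ?W))"
      using DERIV_minus[of "\<lambda>s. - es s x" _ t U] DERIV_minus[of "\<lambda>s. es s x" _ t U] by fastforce
    finally show ?thesis by simp
  qed
  have v3: "((r - T 1 1 x) * (e t x / ?W) + - T 1 2 x * (- es t x / ?W)) * ?W + e t x / ?W * ((T 1 1 x + T 2 2 x) * ?W)
     = (r + T 2 2 x) * e t x + T 1 2 x * es t x"
    using w0 by (simp add: field_simps)
  have v4: "- (((b - T 2 1 x) * (e t x / ?W) + (- r - T 2 2 x) * (- es t x / ?W)) * ?W) + es t x / ?W * ((T 1 1 x + T 2 2 x) * ?W)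
     = (T 2 1 x - b) * e t x + (- r + T 1 1 x) * es t x"
    using w0 by (simp add: field_simps)
  have v1: "(r - T 1 1 x) * f t x + - T 1 2 x * fs t x = (r - T 1 1 x) * f t x - T 1 2 x * fs t x"
    by (simp only: mult_minus_left diff_conv_add_uminus)
  have "(\<forall>i k. ((\<lambda>s. ?Y s $ i $ k) has_ddt ((?B ** ?Y t) $ i $ k))) \<longleftrightarrow>
      (\<lambda>s. f s x) has_ddt ((r - T 1 1 x) * f t x + - T 1 2 x * fs t x) \<and>
      (\<lambda>s. e s x / w s x) has_ddt ((r - T 1 1 x) * (e t x / ?W) + - T 1 2 x * (- es t x / ?W)) \<and>
      (\<lambda>s. fs s x) has_ddt ((b - T 2 1 x) * f t x + (- r - T 2 2 x) * fs t x) \<and>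
      (\<lambda>s. - es s x / w s x) has_ddt ((b - T 2 1 x) * (e t x / ?W) + (- r - T 2 2 x) * (- es t x / ?W))"
    unfolding forall_2 matrix_mult_entry_2 B Ymat_entries by blast
  also have "\<dots> \<longleftrightarrow>
      (\<lambda>s. f s x) has_ddt ((r - T 1 1 x) * f t x - T 1 2 x * fs t x) \<and>
        (\<lambda>s. fs s x) has_ddt ((b - T 2 1 x) * f t x + (- r - T 2 2 x) * fs t x) \<and>
        (\<lambda>s. e s x) has_ddt ((r + T 2 2 x) * e t x + T 1 2 x * es t x) \<and>
        (\<lambda>s. es s x) has_ddt ((T 2 1 x - b) * e t x + (- r + T 1 1 x) * es t x)"
    unfolding y3 y4 v3 v4 v1 by blast
  finally show "((\<lambda>s. f s x) has_ddt ((r - T 1 1 x) * f t x - T 1 2 x * fs t x) \<and>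
        (\<lambda>s. fs s x) has_ddt ((b - T 2 1 x) * f t x + (- r - T 2 2 x) * fs t x) \<and>
        (\<lambda>s. e s x) has_ddt ((r + T 2 2 x) * e t x + T 1 2 x * es t x) \<and>
        (\<lambda>s. es s x) has_ddt ((T 2 1 x - b) * e t x + (- r + T 1 1 x) * es t x)) \<longleftrightarrow>
     (\<forall>i k. ((\<lambda>s. ?Y s $ i $ k) has_ddt ((?B ** ?Y t) $ i $ k)))" by (rule sym)
qed

end

section \<open>Equivalence of the two systems\<close>

theorem corollary3p3:
  fixes m n :: nat
    and U :: "complex set"
    and z :: "nat \<Rightarrow> complex \<Rightarrow> complex"
    and \<rho> :: "nat \<Rightarrow> complex"
    and \<Omega> :: "complex \<Rightarrow> complex set"
    and w :: "complex \<Rightarrow> complex \<Rightarrow> complex"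
    and \<kappa> :: "nat \<Rightarrow> complex \<Rightarrow> complex"
    and \<phi> \<phi>b :: "nat \<Rightarrow> complex \<Rightarrow> complex poly"
    and A :: "nat \<Rightarrow> complex ^ 2 ^ 2"
    and t :: complex
  assumes "semiclassical_deformation m U z \<rho> \<Omega> w \<kappa> \<phi> \<phi>b"
    and "n \<ge> 1"
    and "t \<in> U"
    and "residue_matrices m (\<lambda>j. z j t) (\<Omega> t) (Ymat n (w t) (\<phi> n t) (\<phi>b n t)) A"
  shows
    "let a = (\<lambda>j. z j t);
         a' = (\<lambda>j. ddt U (z j) t);
         r = ddt U (\<kappa> n) t / \<kappa> n t;
         f = (\<lambda>s. poly (\<phi> n s));
         fs = (\<lambda>s. poly (reflect_poly (\<phi>b n s)));
         e = (\<lambda>s. eps (w s) (\<phi> n s));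
         es = (\<lambda>s. eps_star n (w s) (\<phi>b n s));
         ea = (\<lambda>j. limiting_value (e t) (a j));
         esa = (\<lambda>j. limiting_value (es t) (a j));
         Y = (\<lambda>s. Ymat n (w s) (\<phi> n s) (\<phi>b n s));
         B = (\<lambda>x. Binf U (\<kappa> n) (\<lambda>s. poly (\<phi>b n s) 0) t
                    - (\<Sum>j=1..m. mat (a' j / (x - a j)) ** A j))
     in
       ((\<forall>x. x \<notin> a ` {1..m} \<longrightarrow>
           ((\<lambda>s. f s x) has_field_derivative
              (- r - (\<Sum>j=1..m. \<rho> j * (a' j / a j))
                 + 1/2 * (\<Sum>j=1..m. \<rho> j * (a' j / a j) * a j powi (- int n)
                                       * ea j * fs t (a j) * (x / (x - a j)))) * f t x
              - (1/2 * (\<Sum>j=1..m. \<rho> j * (a' j / a j) * a j powi (1 - int n)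
                                     * ea j * f t (a j) * (1 / (x - a j)))) * fs t x)
             (at t within U)) \<and>
        (\<forall>x. x \<notin> a ` {1..m} \<longrightarrow>
           ((\<lambda>s. fs s x) has_field_derivative
              (- r + 1/2 * (\<Sum>j=1..m. \<rho> j * (a' j / a j) * a j powi (1 - int n)
                                         * esa j * f t (a j) * (1 / (x - a j)))) * fs t x
              - (1/2 * (\<Sum>j=1..m. \<rho> j * (a' j / a j) * a j powi (- int n)
                                     * esa j * fs t (a j) * (x / (x - a j)))) * f t x)
             (at t within U)) \<and>
        (\<forall>x. x \<notin> sphere 0 1 \<and> x \<notin> a ` {1..m} \<longrightarrow>
           ((\<lambda>s. e s x) has_field_derivative
              (- r - 1/2 * (\<Sum>j=1..m. \<rho> j * (a' j / a j) * a j powi (- int n)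
                                         * esa j * f t (a j) * (x / (x - a j)))) * e t x
              + (1/2 * (\<Sum>j=1..m. \<rho> j * (a' j / a j) * a j powi (1 - int n)
                                     * ea j * f t (a j) * (1 / (x - a j)))) * es t x)
             (at t within U)) \<and>
        (\<forall>x. x \<notin> sphere 0 1 \<and> x \<notin> a ` {1..m} \<longrightarrow>
           ((\<lambda>s. es s x) has_field_derivative
              (- r - 1/2 * (\<Sum>j=1..m. \<rho> j * (a' j / a j) * a j powi (1 - int n)
                                         * ea j * fs t (a j) * (1 / (x - a j)))) * es t x
              + (1/2 * (\<Sum>j=1..m. \<rho> j * (a' j / a j) * a j powi (- int n)
                                     * esa j * fs t (a j) * (x / (x - a j)))) * e t x)
             (at t within U)))
       \<longleftrightarrow>
       (\<forall>x \<in> \<Omega> t - sphere 0 1. \<forall>i k.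
          ((\<lambda>s. Y s x $ i $ k) has_field_derivative (B x ** Y t x) $ i $ k) (at t within U))"
proof -
  interpret deformation_at_time m U z \<rho> \<Omega> w \<kappa> \<phi> \<phi>b t n A
    by (intro deformation_at_time.intro deformation_at_time_axioms.intro assms)
  show ?thesis
    unfolding Let_def scalar_equations_unfolded[symmetric] matrix_equations_unfolded[symmetric]
    using scalar_equations_imp_matrix_equations matrix_equations_imp_scalar_equations by blast
qed

end
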